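(* Let $K$ be a field of characteristic different from $2$ and $3$. Let $L$ be a perfect Lie algebra over $K$ (i.e. $[L,L]=L$) having no nonzero left skew Poisson structures and no nonzero right skew Poisson structures, let $A$ be an associative commutative algebra with unit over $K$, and suppose that one of $L$, $A$ is finite-dimensional. Then $\mathscr P(L\otimes A)\simeq \mathscr P(L)\otimes A$ as vector spaces, and basic Poisson structures on $L\otimes A$ can be chosen of the form $$(x\otimes a)\,\bigstar\,(y\otimes b)=(x\star y)\otimes abu,\qquad x,y\in L,\ a,b\in A,$$ for some Poisson structure $\star$ on $L$ and some $u\in A$.
   Context: All tensor products are over $K$. $L\otimes A$ is the current Lie algebra with bracket $[x\otimes a,y\otimes b]=[x,y]\otimes ab$. A Poisson structure on a Lie algebra $L$ is a bilinear map $\star:L\times L\to L$ (no associativity or commutativity required) such that $[z,x\star y]=[z,x]\star y+x\star[z,y]$ for all $x,y,z\in L$. The Poisson structures on $L$ form a vector space. A Poisson structure is trivial if it can be written as $x\star y=\omega([x,y])$ for some linear map $\omega:L\to L$ (necessarily satisfying $[z,\omega([x,y])]=\omega([z,[x,y]])$ for all $x,y,z$). $\mathscr P(L)$ is the quotient of the space of all Poisson structures on $L$ by the subspace of trivial ones. Basic Poisson structures are Poisson structures whose classes form a basis of $\mathscr P$ of the Lie algebra in question. A Poisson structure $\star$ on $L$ is left skew if $[x,y]\star z=[y,z]\star x$ for all $x,y,z\in L$, and right skew if $x\star[y,z]=y\star[z,x]$ for all $x,y,z\in L$. *)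

theory Defs
  imports "HOL-Algebra.QuotRing" "Jordan_Normal_Form.Missing_VectorSpace"
begin

subsection \<open>Linear algebra\<close>

text \<open>As for \<^const>\<open>semiring_char\<close> in the type-class setting, the characteristic is the
  nonnegative generator of the ideal of integers that vanish in the field.\<close>

definition characteristic :: "('k, 'e) ring_scheme \<Rightarrow> nat"
  where "characteristic K = Gcd {n :: nat. [n] \<cdot>\<^bsub>K\<^esub> \<one>\<^bsub>K\<^esub> = \<zero>\<^bsub>K\<^esub>}"

definition linear_iso :: "('k, 'e) ring_scheme \<Rightarrow> ('k, 'v, 'm) module_scheme
    \<Rightarrow> ('k, 'w, 'n) module_scheme \<Rightarrow> ('v \<Rightarrow> 'w) \<Rightarrow> bool"
  where "linear_iso K V W \<phi> \<longleftrightarrow>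
    linear_map K V W \<phi> \<and> bij_betw \<phi> (carrier V) (carrier W)"

definition bilinear :: "('k, 'e) ring_scheme \<Rightarrow> ('k, 'u, 'l) module_scheme
    \<Rightarrow> ('k, 'v, 'm) module_scheme \<Rightarrow> ('k, 'w, 'n) module_scheme \<Rightarrow> ('u \<Rightarrow> 'v \<Rightarrow> 'w) \<Rightarrow> bool"
  where "bilinear K U V W f \<longleftrightarrow>
    (\<forall>u\<in>carrier U. linear_map K V W (\<lambda>v. f u v)) \<and>
    (\<forall>v\<in>carrier V. linear_map K U W (\<lambda>u. f u v))"

text \<open>The record fields \<^const>\<open>mult\<close> and \<^const>\<open>one\<close> of a module carry no meaning for a bare
  vector space; they are left \<^const>\<open>undefined\<close> in the constructions below.\<close>

definition quotient_space :: "('k, 'v, 'm) module_scheme \<Rightarrow> 'v set \<Rightarrow> ('k, 'v set) module"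
  where "quotient_space V W =
    \<lparr>carrier = a_rcosets\<^bsub>V\<^esub> W, mult = undefined, one = undefined,
     zero = W, add = set_add V,
     smult = (\<lambda>c X. \<Union>x\<in>X. W +>\<^bsub>V\<^esub> (c \<odot>\<^bsub>V\<^esub> x))\<rparr>"

definition free_space :: "('k, 'e) ring_scheme \<Rightarrow> 's set \<Rightarrow> ('k, 's \<Rightarrow> 'k) module"
  where "free_space K S =
    (ring.func_space K S)
      \<lparr>carrier := {f \<in> S \<rightarrow>\<^sub>E carrier K. finite {s \<in> S. f s \<noteq> \<zero>\<^bsub>K\<^esub>}}\<rparr>"

definition free_gen :: "('k, 'e) ring_scheme \<Rightarrow> 's set \<Rightarrow> 's \<Rightarrow> 's \<Rightarrow> 'k"
  where "free_gen K S s = (\<lambda>t\<in>S. if t = s then \<one>\<^bsub>K\<^esub> else \<zero>\<^bsub>K\<^esub>)"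


subsection \<open>Tensor products\<close>

text \<open>The tensor product is the free vector space on the set of pairs modulo the subspace
  spanned by the bilinearity relations.\<close>

definition tensor_free :: "('k, 'e) ring_scheme \<Rightarrow> ('k, 'v, 'm) module_scheme
    \<Rightarrow> ('k, 'w, 'n) module_scheme \<Rightarrow> ('k, 'v \<times> 'w \<Rightarrow> 'k) module"
  where "tensor_free K V W = free_space K (carrier V \<times> carrier W)"

definition tensor_gen :: "('k, 'e) ring_scheme \<Rightarrow> ('k, 'v, 'm) module_scheme
    \<Rightarrow> ('k, 'w, 'n) module_scheme \<Rightarrow> 'v \<Rightarrow> 'w \<Rightarrow> 'v \<times> 'w \<Rightarrow> 'k"
  where "tensor_gen K V W v w = free_gen K (carrier V \<times> carrier W) (v, w)"

definition tensor_relators :: "('k, 'e) ring_scheme \<Rightarrow> ('k, 'v, 'm) module_scheme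
    \<Rightarrow> ('k, 'w, 'n) module_scheme \<Rightarrow> ('v \<times> 'w \<Rightarrow> 'k) set"
  where "tensor_relators K V W =
    (let F = tensor_free K V W; g = tensor_gen K V W in
      {g (v \<oplus>\<^bsub>V\<^esub> v') w \<ominus>\<^bsub>F\<^esub> (g v w \<oplus>\<^bsub>F\<^esub> g v' w) | v v' w.
         v \<in> carrier V \<and> v' \<in> carrier V \<and> w \<in> carrier W} \<union>
      {g v (w \<oplus>\<^bsub>W\<^esub> w') \<ominus>\<^bsub>F\<^esub> (g v w \<oplus>\<^bsub>F\<^esub> g v w') | v w w'.
         v \<in> carrier V \<and> w \<in> carrier W \<and> w' \<in> carrier W} \<union>
      {g (c \<odot>\<^bsub>V\<^esub> v) w \<ominus>\<^bsub>F\<^esub> c \<odot>\<^bsub>F\<^esub> g v w | c v w.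
         c \<in> carrier K \<and> v \<in> carrier V \<and> w \<in> carrier W} \<union>
      {g v (c \<odot>\<^bsub>W\<^esub> w) \<ominus>\<^bsub>F\<^esub> c \<odot>\<^bsub>F\<^esub> g v w | c v w.
         c \<in> carrier K \<and> v \<in> carrier V \<and> w \<in> carrier W})"

definition tensor_null :: "('k, 'e) ring_scheme \<Rightarrow> ('k, 'v, 'm) module_scheme
    \<Rightarrow> ('k, 'w, 'n) module_scheme \<Rightarrow> ('v \<times> 'w \<Rightarrow> 'k) set"
  where "tensor_null K V W = module.span K (tensor_free K V W) (tensor_relators K V W)"

definition tensor :: "('k, 'e) ring_scheme \<Rightarrow> ('k, 'v, 'm) module_scheme
    \<Rightarrow> ('k, 'w, 'n) module_scheme \<Rightarrow> ('k, ('v \<times> 'w \<Rightarrow> 'k) set) module"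
  where "tensor K V W = quotient_space (tensor_free K V W) (tensor_null K V W)"

definition pure_tensor :: "('k, 'e) ring_scheme \<Rightarrow> ('k, 'v, 'm) module_scheme
    \<Rightarrow> ('k, 'w, 'n) module_scheme \<Rightarrow> 'v \<Rightarrow> 'w \<Rightarrow> ('v \<times> 'w \<Rightarrow> 'k) set"
  where "pure_tensor K V W v w =
    tensor_null K V W +>\<^bsub>tensor_free K V W\<^esub> tensor_gen K V W v w"


subsection \<open>Lie algebras\<close>

record ('k, 'v) lie_alg = "('k, 'v) module" +
  bracket :: "'v \<Rightarrow> 'v \<Rightarrow> 'v"  (\<open>\<lbrakk>_, _\<rbrakk>\<index>\<close>)

locale lie_algebra = vectorspace K L
  for K :: "('k, 'e) ring_scheme" and L :: "('k, 'v, 'm) lie_alg_scheme" (structure) +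
  assumes bracket_bilinear: "bilinear K L L L (\<lambda>x y. \<lbrakk>x, y\<rbrakk>)"
    and bracket_alternating: "x \<in> carrier L \<Longrightarrow> \<lbrakk>x, x\<rbrakk> = \<zero>\<^bsub>L\<^esub>"
    and jacobi: "\<lbrakk>x \<in> carrier L; y \<in> carrier L; z \<in> carrier L\<rbrakk> \<Longrightarrow>
      \<lbrakk>x, \<lbrakk>y, z\<rbrakk>\<rbrakk> \<oplus>\<^bsub>L\<^esub> \<lbrakk>y, \<lbrakk>z, x\<rbrakk>\<rbrakk> \<oplus>\<^bsub>L\<^esub> \<lbrakk>z, \<lbrakk>x, y\<rbrakk>\<rbrakk> = \<zero>\<^bsub>L\<^esub>"

definition perfect :: "('k, 'e) ring_scheme \<Rightarrow> ('k, 'v, 'm) lie_alg_scheme \<Rightarrow> bool"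
  where "perfect K L \<longleftrightarrow>
    module.span K L {\<lbrakk>x, y\<rbrakk>\<^bsub>L\<^esub> | x y. x \<in> carrier L \<and> y \<in> carrier L} = carrier L"

text \<open>A commutative associative algebra with unit over \<open>K\<close> is an instance of the locale
  \<^locale>\<open>algebra\<close>. The bracket of the current Lie algebra is the unique bilinear map with the
  prescribed values on pure tensors; being required to be extensional, it is unique as a HOL
  function. Existence and uniqueness are shown in the lemma \<open>current_bracket_ex1\<close> below.\<close>

definition is_current_bracket :: "('k, 'e) ring_scheme \<Rightarrow> ('k, 'l, 'm) lie_alg_scheme
    \<Rightarrow> ('k, 'a, 'n) module_scheme
    \<Rightarrow> (('l \<times> 'a \<Rightarrow> 'k) set \<Rightarrow> ('l \<times> 'a \<Rightarrow> 'k) set \<Rightarrow> ('l \<times> 'a \<Rightarrow> 'k) set) \<Rightarrow> bool"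
  where "is_current_bracket K L A B \<longleftrightarrow>
    B \<in> carrier (tensor K L A) \<rightarrow>\<^sub>E (carrier (tensor K L A) \<rightarrow>\<^sub>E carrier (tensor K L A)) \<and>
    bilinear K (tensor K L A) (tensor K L A) (tensor K L A) B \<and>
    (\<forall>x\<in>carrier L. \<forall>y\<in>carrier L. \<forall>a\<in>carrier A. \<forall>b\<in>carrier A.
      B (pure_tensor K L A x a) (pure_tensor K L A y b)
        = pure_tensor K L A \<lbrakk>x, y\<rbrakk>\<^bsub>L\<^esub> (a \<otimes>\<^bsub>A\<^esub> b))"

definition current :: "('k, 'e) ring_scheme \<Rightarrow> ('k, 'l, 'm) lie_alg_scheme
    \<Rightarrow> ('k, 'a, 'n) module_scheme \<Rightarrow> ('k, ('l \<times> 'a \<Rightarrow> 'k) set) lie_alg"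
  where "current K L A =
    \<lparr>carrier = carrier (tensor K L A), mult = undefined, one = undefined,
     zero = zero (tensor K L A), add = add (tensor K L A), smult = smult (tensor K L A),
     bracket = (THE B. is_current_bracket K L A B)\<rparr>"


subsection \<open>Poisson structures\<close>

text \<open>Poisson structures are taken to be extensional functions, so that equality of structures
  is equality on the carrier.\<close>

definition poisson_structures :: "('k, 'e) ring_scheme \<Rightarrow> ('k, 'v, 'm) lie_alg_scheme
    \<Rightarrow> ('v \<Rightarrow> 'v \<Rightarrow> 'v) set"
  where "poisson_structures K L =
    {f \<in> carrier L \<rightarrow>\<^sub>E (carrier L \<rightarrow>\<^sub>E carrier L). bilinear K L L L f \<and>
      (\<forall>x\<in>carrier L. \<forall>y\<in>carrier L. \<forall>z\<in>carrier L.
        \<lbrakk>z, f x y\<rbrakk>\<^bsub>L\<^esub> = f \<lbrakk>z, x\<rbrakk>\<^bsub>L\<^esub> y \<oplus>\<^bsub>L\<^esub> f x \<lbrakk>z, y\<rbrakk>\<^bsub>L\<^esub>)}"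

definition poisson_space :: "('k, 'e) ring_scheme \<Rightarrow> ('k, 'v, 'm) lie_alg_scheme
    \<Rightarrow> ('k, 'v \<Rightarrow> 'v \<Rightarrow> 'v) module"
  where "poisson_space K L =
    \<lparr>carrier = poisson_structures K L, mult = undefined, one = undefined,
     zero = (\<lambda>x\<in>carrier L. \<lambda>y\<in>carrier L. \<zero>\<^bsub>L\<^esub>),
     add = (\<lambda>f g. \<lambda>x\<in>carrier L. \<lambda>y\<in>carrier L. f x y \<oplus>\<^bsub>L\<^esub> g x y),
     smult = (\<lambda>c f. \<lambda>x\<in>carrier L. \<lambda>y\<in>carrier L. c \<odot>\<^bsub>L\<^esub> f x y)\<rparr>"

definition trivial_poisson :: "('k, 'e) ring_scheme \<Rightarrow> ('k, 'v, 'm) lie_alg_scheme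
    \<Rightarrow> ('v \<Rightarrow> 'v \<Rightarrow> 'v) set"
  where "trivial_poisson K L =
    {f \<in> poisson_structures K L. \<exists>\<omega>. linear_map K L L \<omega> \<and>
      (\<forall>x\<in>carrier L. \<forall>y\<in>carrier L. f x y = \<omega> \<lbrakk>x, y\<rbrakk>\<^bsub>L\<^esub>)}"

definition poisson_quotient :: "('k, 'e) ring_scheme \<Rightarrow> ('k, 'v, 'm) lie_alg_scheme
    \<Rightarrow> ('k, ('v \<Rightarrow> 'v \<Rightarrow> 'v) set) module"  (\<open>\<P>\<close>)
  where "\<P> K L = quotient_space (poisson_space K L) (trivial_poisson K L)"

definition poisson_class :: "('k, 'e) ring_scheme \<Rightarrow> ('k, 'v, 'm) lie_alg_scheme
    \<Rightarrow> ('v \<Rightarrow> 'v \<Rightarrow> 'v) \<Rightarrow> ('v \<Rightarrow> 'v \<Rightarrow> 'v) set"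
  where "poisson_class K L f = trivial_poisson K L +>\<^bsub>poisson_space K L\<^esub> f"

text \<open>Distinct elements of a system of basic structures have distinct classes.\<close>

definition basic_poisson_structures :: "('k, 'e) ring_scheme \<Rightarrow> ('k, 'v, 'm) lie_alg_scheme
    \<Rightarrow> ('v \<Rightarrow> 'v \<Rightarrow> 'v) set \<Rightarrow> bool"
  where "basic_poisson_structures K L S \<longleftrightarrow>
    S \<subseteq> poisson_structures K L \<and> inj_on (poisson_class K L) S \<and>
    vectorspace.basis K (\<P> K L) (poisson_class K L ` S)"

definition left_skew :: "('k, 'v, 'm) lie_alg_scheme \<Rightarrow> ('v \<Rightarrow> 'v \<Rightarrow> 'v) \<Rightarrow> bool"
  where "left_skew L f \<longleftrightarrow>
    (\<forall>x\<in>carrier L. \<forall>y\<in>carrier L. \<forall>z\<in>carrier L. f \<lbrakk>x, y\<rbrakk>\<^bsub>L\<^esub> z = f \<lbrakk>y, z\<rbrakk>\<^bsub>L\<^esub> x)"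

definition right_skew :: "('k, 'v, 'm) lie_alg_scheme \<Rightarrow> ('v \<Rightarrow> 'v \<Rightarrow> 'v) \<Rightarrow> bool"
  where "right_skew L f \<longleftrightarrow>
    (\<forall>x\<in>carrier L. \<forall>y\<in>carrier L. \<forall>z\<in>carrier L. f x \<lbrakk>y, z\<rbrakk>\<^bsub>L\<^esub> = f y \<lbrakk>z, x\<rbrakk>\<^bsub>L\<^esub>)"


subsection \<open>Facts on quotients and tensor products\<close>

lemma vs_module: "vectorspace K V \<Longrightarrow> Module.module K V"
  by (simp add: vectorspace_def)

lemma linear_mapI:
  assumes "vectorspace K V" "vectorspace K W"
    and "\<And>v. v \<in> carrier V \<Longrightarrow> f v \<in> carrier W"
    and "\<And>v w. v \<in> carrier V \<Longrightarrow> w \<in> carrier V \<Longrightarrow> f (v \<oplus>\<^bsub>V\<^esub> w) = f v \<oplus>\<^bsub>W\<^esub> f w"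
    and "\<And>c v. c \<in> carrier K \<Longrightarrow> v \<in> carrier V \<Longrightarrow> f (c \<odot>\<^bsub>V\<^esub> v) = c \<odot>\<^bsub>W\<^esub> f v"
  shows "linear_map K V W f"
  using assms unfolding linear_map_def mod_hom_def mod_hom_axioms_def module_hom_def
  by (auto simp: vectorspace_def)

lemma linear_mapD:
  assumes "linear_map K V W f"
  shows "vectorspace K V" "vectorspace K W"
    and "\<And>v. v \<in> carrier V \<Longrightarrow> f v \<in> carrier W"
    and "\<And>v w. v \<in> carrier V \<Longrightarrow> w \<in> carrier V \<Longrightarrow> f (v \<oplus>\<^bsub>V\<^esub> w) = f v \<oplus>\<^bsub>W\<^esub> f w"
    and "\<And>c v. c \<in> carrier K \<Longrightarrow> v \<in> carrier V \<Longrightarrow> f (c \<odot>\<^bsub>V\<^esub> v) = c \<odot>\<^bsub>W\<^esub> f v"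
    and "f \<zero>\<^bsub>V\<^esub> = \<zero>\<^bsub>W\<^esub>"
    and "\<And>v w. v \<in> carrier V \<Longrightarrow> w \<in> carrier V \<Longrightarrow> f (v \<ominus>\<^bsub>V\<^esub> w) = f v \<ominus>\<^bsub>W\<^esub> f w"
proof -
  interpret f: linear_map K V W f by fact
  show "vectorspace K V" "vectorspace K W" by unfold_locales
  show "\<And>v. v \<in> carrier V \<Longrightarrow> f v \<in> carrier W" by simp
  show "\<And>v w. v \<in> carrier V \<Longrightarrow> w \<in> carrier V \<Longrightarrow> f (v \<oplus>\<^bsub>V\<^esub> w) = f v \<oplus>\<^bsub>W\<^esub> f w" by simp
  show "\<And>c v. c \<in> carrier K \<Longrightarrow> v \<in> carrier V \<Longrightarrow> f (c \<odot>\<^bsub>V\<^esub> v) = c \<odot>\<^bsub>W\<^esub> f v" by simp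
  show "f \<zero>\<^bsub>V\<^esub> = \<zero>\<^bsub>W\<^esub>" by simp
  show "\<And>v w. v \<in> carrier V \<Longrightarrow> w \<in> carrier V \<Longrightarrow> f (v \<ominus>\<^bsub>V\<^esub> w) = f v \<ominus>\<^bsub>W\<^esub> f w" by simp
qed

context
  fixes K :: "('k, 'e) ring_scheme" and V :: "('k, 'v, 'm) module_scheme" and N :: "'v set"
  assumes sub: "subspace K N V"
begin

lemma vs_V: "vectorspace K V"
  using sub by (simp add: subspace_def)

interpretation vectorspace K V by (rule vs_V)

lemma sub_props:
  "N \<subseteq> carrier V" "\<zero>\<^bsub>V\<^esub> \<in> N"
  "\<And>v w. v \<in> N \<Longrightarrow> w \<in> N \<Longrightarrow> v \<oplus>\<^bsub>V\<^esub> w \<in> N"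
  "\<And>c v. c \<in> carrier K \<Longrightarrow> v \<in> N \<Longrightarrow> c \<odot>\<^bsub>V\<^esub> v \<in> N"
  "\<And>v. v \<in> N \<Longrightarrow> \<ominus>\<^bsub>V\<^esub> v \<in> N"
proof -
  have s: "LinearCombinations.submodule K N V" using sub by (simp add: subspace_def)
  show "N \<subseteq> carrier V" "\<zero>\<^bsub>V\<^esub> \<in> N"
    "\<And>v w. v \<in> N \<Longrightarrow> w \<in> N \<Longrightarrow> v \<oplus>\<^bsub>V\<^esub> w \<in> N"
    and 1: "\<And>c v. c \<in> carrier K \<Longrightarrow> v \<in> N \<Longrightarrow> c \<odot>\<^bsub>V\<^esub> v \<in> N"
    using s by (auto simp: submodule_def)
  show "\<ominus>\<^bsub>V\<^esub> v \<in> N" if "v \<in> N" for v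
    using 1[of "\<ominus>\<^bsub>K\<^esub> \<one>\<^bsub>K\<^esub>" v] that \<open>N \<subseteq> carrier V\<close> by (auto simp: smult_minus_1)
qed

lemma sub_add: "additive_subgroup N V"
  by (rule additive_subgroup.intro, rule M.add.subgroupI)
     (use sub_props in \<open>auto simp flip: a_inv_def\<close>)

interpretation abelian_subgroup N V
  by (rule abelian_subgroupI3[OF sub_add M.abelian_group_axioms])

lemma coset_eq_iff:
  assumes "x \<in> carrier V" "y \<in> carrier V"
  shows "N +>\<^bsub>V\<^esub> x = N +>\<^bsub>V\<^esub> y \<longleftrightarrow> x \<ominus>\<^bsub>V\<^esub> y \<in> N"
proof
  assume "N +>\<^bsub>V\<^esub> x = N +>\<^bsub>V\<^esub> y"
  then have "x \<in> N +>\<^bsub>V\<^esub> y" using a_rcos_self[OF assms(1)] by simp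
  then show "x \<ominus>\<^bsub>V\<^esub> y \<in> N"
    using a_rcos_module[OF assms(2,1)] by (simp add: a_minus_def)
next
  assume "x \<ominus>\<^bsub>V\<^esub> y \<in> N"
  then have "x \<in> N +>\<^bsub>V\<^esub> y" using a_rcos_module[OF assms(2,1)] by (simp add: a_minus_def)
  then show "N +>\<^bsub>V\<^esub> x = N +>\<^bsub>V\<^esub> y"
    using a_repr_independence[OF _ assms(2) a_subgroup] by simp
qed

lemma coset_add:
  assumes "x \<in> carrier V" "y \<in> carrier V"
  shows "(N +>\<^bsub>V\<^esub> x) \<oplus>\<^bsub>quotient_space V N\<^esub> (N +>\<^bsub>V\<^esub> y) = N +>\<^bsub>V\<^esub> (x \<oplus>\<^bsub>V\<^esub> y)"
  using assms by (simp add: quotient_space_def a_rcos_sum)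

lemma coset_smult:
  assumes c: "c \<in> carrier K" and x: "x \<in> carrier V"
  shows "c \<odot>\<^bsub>quotient_space V N\<^esub> (N +>\<^bsub>V\<^esub> x) = N +>\<^bsub>V\<^esub> (c \<odot>\<^bsub>V\<^esub> x)"
proof -
  have "N +>\<^bsub>V\<^esub> (c \<odot>\<^bsub>V\<^esub> z) = N +>\<^bsub>V\<^esub> (c \<odot>\<^bsub>V\<^esub> x)" if z: "z \<in> N +>\<^bsub>V\<^esub> x" for z
  proof -
    from z obtain n where n: "n \<in> N" "z = n \<oplus>\<^bsub>V\<^esub> x"
      by (auto simp: a_r_coset_def r_coset_def)
    have nc: "n \<in> carrier V" using n sub_props(1) by auto
    have "c \<odot>\<^bsub>V\<^esub> z \<ominus>\<^bsub>V\<^esub> c \<odot>\<^bsub>V\<^esub> x = c \<odot>\<^bsub>V\<^esub> n"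
      using n nc c x by (simp add: smult_r_distr a_minus_def M.a_assoc M.r_neg)
    then show ?thesis using n nc c x sub_props(4) by (subst coset_eq_iff) auto
  qed
  then have "(\<Union>z\<in>N +>\<^bsub>V\<^esub> x. N +>\<^bsub>V\<^esub> (c \<odot>\<^bsub>V\<^esub> z)) = (\<Union>z\<in>N +>\<^bsub>V\<^esub> x. N +>\<^bsub>V\<^esub> (c \<odot>\<^bsub>V\<^esub> x))"
    by (rule SUP_cong[OF refl])
  also have "\<dots> = N +>\<^bsub>V\<^esub> (c \<odot>\<^bsub>V\<^esub> x)"
    using a_rcos_self[OF x] by blast
  finally show ?thesis by (simp add: quotient_space_def)
qed

lemma quotient_carrier: "carrier (quotient_space V N) = (\<lambda>x. N +>\<^bsub>V\<^esub> x) ` carrier V"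
  by (auto simp: quotient_space_def A_RCOSETS_def')

lemma quotient_zero: "\<zero>\<^bsub>quotient_space V N\<^esub> = N +>\<^bsub>V\<^esub> \<zero>\<^bsub>V\<^esub>"
  using sub_props(1) by (simp add: quotient_space_def)

lemma quotient_vs: "vectorspace K (quotient_space V N)"
  apply (rule vs_criteria)
  apply (unfold_locales)
  apply (auto simp: quotient_carrier quotient_zero coset_add coset_smult M.a_ac smult_assoc1 smult_l_distr smult_r_distr)
  using M.r_neg apply (metis M.a_inv_closed)
  done

lemma coset_linear: "linear_map K V (quotient_space V N) (\<lambda>x. N +>\<^bsub>V\<^esub> x)"
  by (rule linear_mapI) (auto simp: vs_V quotient_vs quotient_carrier coset_add coset_smult)

end


context
  fixes K :: "('k, 'e) ring_scheme" and S :: "'s set"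
  assumes fld: "field K"
begin

interpretation field K by (rule fld)

lemma free_simps:
  "carrier (free_space K S) = {f \<in> S \<rightarrow>\<^sub>E carrier K. finite {s \<in> S. f s \<noteq> \<zero>\<^bsub>K\<^esub>}}"
  "\<zero>\<^bsub>free_space K S\<^esub> = (\<lambda>s\<in>S. \<zero>\<^bsub>K\<^esub>)"
  "f \<oplus>\<^bsub>free_space K S\<^esub> g = (\<lambda>s\<in>S. f s \<oplus>\<^bsub>K\<^esub> g s)"
  "c \<odot>\<^bsub>free_space K S\<^esub> f = (\<lambda>s\<in>S. c \<otimes>\<^bsub>K\<^esub> f s)"
  by (simp_all add: free_space_def func_space_def)

lemma free_vs: "vectorspace K (free_space K S)"
proof -
  interpret F: Module.module K "func_space S" by (rule func_space_is_module)
  let ?N = "{f \<in> S \<rightarrow>\<^sub>E carrier K. finite {s \<in> S. f s \<noteq> \<zero>\<^bsub>K\<^esub>}}"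
  have "LinearCombinations.submodule K ?N (func_space S)"
  proof (rule LinearCombinations.submodule.intro)
    show "Module.module K (func_space S)" by (rule func_space_is_module)
    show "?N \<subseteq> carrier (func_space S)" by (auto simp: func_space_def)
    show "\<zero>\<^bsub>func_space S\<^esub> \<in> ?N" by (auto simp: func_space_def)
    show "f \<oplus>\<^bsub>func_space S\<^esub> g \<in> ?N" if "f \<in> ?N" "g \<in> ?N" for f g
    proof -
      have "{s \<in> S. (f \<oplus>\<^bsub>func_space S\<^esub> g) s \<noteq> \<zero>\<^bsub>K\<^esub>} \<subseteq>
          {s \<in> S. f s \<noteq> \<zero>\<^bsub>K\<^esub>} \<union> {s \<in> S. g s \<noteq> \<zero>\<^bsub>K\<^esub>}"
        using that by (auto simp: func_space_def)
      then have "finite {s \<in> S. (f \<oplus>\<^bsub>func_space S\<^esub> g) s \<noteq> \<zero>\<^bsub>K\<^esub>}"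
        using that by (auto intro: finite_subset)
      then show ?thesis using that by (auto simp: func_space_def)
    qed
    show "c \<odot>\<^bsub>func_space S\<^esub> f \<in> ?N" if "c \<in> carrier K" "f \<in> ?N" for c f
    proof -
      have "{s \<in> S. (c \<odot>\<^bsub>func_space S\<^esub> f) s \<noteq> \<zero>\<^bsub>K\<^esub>} \<subseteq> {s \<in> S. f s \<noteq> \<zero>\<^bsub>K\<^esub>}"
        using that by (auto simp: func_space_def)
      then have "finite {s \<in> S. (c \<odot>\<^bsub>func_space S\<^esub> f) s \<noteq> \<zero>\<^bsub>K\<^esub>}"
        using that by (auto intro: finite_subset)
      then show ?thesis using that by (auto simp: func_space_def)
    qed
  qed
  then have "Module.module K (free_space K S)"
    unfolding free_space_def by (rule F.submodule_is_module)
  then show ?thesis by (simp add: vectorspace_def fld)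
qed

interpretation F: vectorspace K "free_space K S" by (rule free_vs)

lemma free_gen_closed: "s \<in> S \<Longrightarrow> free_gen K S s \<in> carrier (free_space K S)"
proof -
  have "{t \<in> S. free_gen K S s t \<noteq> \<zero>\<^bsub>K\<^esub>} \<subseteq> {s}"
    by (auto simp: free_gen_def)
  then have "finite {t \<in> S. free_gen K S s t \<noteq> \<zero>\<^bsub>K\<^esub>}" by (rule finite_subset) simp
  then show ?thesis by (auto simp: free_simps free_gen_def)
qed

lemma free_induct [consumes 1, case_names zero step]:
  assumes f: "f \<in> carrier (free_space K S)"
    and zero: "P \<zero>\<^bsub>free_space K S\<^esub>"
    and step: "\<And>c s f. c \<in> carrier K \<Longrightarrow> s \<in> S \<Longrightarrow> f \<in> carrier (free_space K S) \<Longrightarrow> P f \<Longrightarrow>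
      P (f \<oplus>\<^bsub>free_space K S\<^esub> c \<odot>\<^bsub>free_space K S\<^esub> free_gen K S s)"
  shows "P f"
proof -
  have "\<forall>f \<in> carrier (free_space K S). {s \<in> S. f s \<noteq> \<zero>\<^bsub>K\<^esub>} = X \<longrightarrow> P f" if "finite X" for X
    using that
  proof (induction X rule: finite_induct)
    case empty
    show ?case
    proof (intro ballI impI)
      fix f assume "f \<in> carrier (free_space K S)" "{s \<in> S. f s \<noteq> \<zero>\<^bsub>K\<^esub>} = {}"
      then have "f = \<zero>\<^bsub>free_space K S\<^esub>"
        by (auto simp: free_simps intro!: ext)
      then show "P f" using zero by simp
    qed
  next
    case (insert s X)
    show ?case
    proof (intro ballI impI)
      fix f assume f: "f \<in> carrier (free_space K S)" and X: "{s \<in> S. f s \<noteq> \<zero>\<^bsub>K\<^esub>} = insert s X"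
      define g where "g = (\<lambda>t\<in>S. if t = s then \<zero>\<^bsub>K\<^esub> else f t)"
      have s: "s \<in> S" "f s \<in> carrier K" using X f by (auto simp: free_simps)
      have gX: "{s \<in> S. g s \<noteq> \<zero>\<^bsub>K\<^esub>} = X"
        using X insert.hyps by (auto simp: g_def split: if_splits)
      have g: "g \<in> carrier (free_space K S)"
      proof -
        have "g \<in> S \<rightarrow>\<^sub>E carrier K"
          using f by (auto simp: free_simps g_def PiE_iff)
        then show ?thesis using gX insert.hyps by (simp add: free_simps)
      qed
      have "f = g \<oplus>\<^bsub>free_space K S\<^esub> f s \<odot>\<^bsub>free_space K S\<^esub> free_gen K S s"
      proof
        fix t show "f t = (g \<oplus>\<^bsub>free_space K S\<^esub> f s \<odot>\<^bsub>free_space K S\<^esub> free_gen K S s) t"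
          using f s by (cases "t \<in> S") (auto simp: free_simps g_def free_gen_def PiE_iff extensional_def)
      qed
      then show "P f"
        using step[OF s(2,1) g] insert.IH g gX by simp
    qed
  qed
  then show ?thesis using f by (auto simp: free_simps)
qed

lemma free_lift_ex:
  fixes U :: "('k, 'u, 'n) module_scheme"
  assumes U: "vectorspace K U" and h: "\<And>s. s \<in> S \<Longrightarrow> h s \<in> carrier U"
  shows "\<exists>\<phi>. linear_map K (free_space K S) U \<phi> \<and> (\<forall>s\<in>S. \<phi> (free_gen K S s) = h s)"
proof -
  interpret U: vectorspace K U by (rule U)
  define \<phi> where "\<phi> f = (\<Oplus>\<^bsub>U\<^esub>s\<in>{s \<in> S. f s \<noteq> \<zero>\<^bsub>K\<^esub>}. f s \<odot>\<^bsub>U\<^esub> h s)" for f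
  have ext: "\<phi> f = (\<Oplus>\<^bsub>U\<^esub>s\<in>X. f s \<odot>\<^bsub>U\<^esub> h s)"
    if "f \<in> carrier (free_space K S)" "{s \<in> S. f s \<noteq> \<zero>\<^bsub>K\<^esub>} \<subseteq> X" "X \<subseteq> S" "finite X" for f X
    unfolding \<phi>_def using that h
    by (intro U.M.add.finprod_mono_neutral_cong_left) (auto simp: free_simps PiE_iff subset_iff)
  have "linear_map K (free_space K S) U \<phi>"
  proof (rule linear_mapI[OF free_vs U])
    fix f assume f: "f \<in> carrier (free_space K S)"
    show "\<phi> f \<in> carrier U"
      unfolding \<phi>_def using f h by (intro U.M.finsum_closed) (auto simp: free_simps PiE_iff)
  next
    fix f g assume f: "f \<in> carrier (free_space K S)" and g: "g \<in> carrier (free_space K S)"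
    define X where "X = {s \<in> S. f s \<noteq> \<zero>\<^bsub>K\<^esub>} \<union> {s \<in> S. g s \<noteq> \<zero>\<^bsub>K\<^esub>}"
    have X: "X \<subseteq> S" "finite X" using f g by (auto simp: X_def free_simps)
    have fg: "f \<oplus>\<^bsub>free_space K S\<^esub> g \<in> carrier (free_space K S)" using f g by simp
    have "\<phi> (f \<oplus>\<^bsub>free_space K S\<^esub> g) = (\<Oplus>\<^bsub>U\<^esub>s\<in>X. (f \<oplus>\<^bsub>free_space K S\<^esub> g) s \<odot>\<^bsub>U\<^esub> h s)"
      using X fg by (intro ext) (auto simp: X_def free_simps)
    also have "\<dots> = (\<Oplus>\<^bsub>U\<^esub>s\<in>X. f s \<odot>\<^bsub>U\<^esub> h s \<oplus>\<^bsub>U\<^esub> g s \<odot>\<^bsub>U\<^esub> h s)"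
      using X f g h by (intro U.M.finsum_cong') (auto simp: free_simps PiE_iff subset_iff U.smult_l_distr)
    also have "\<dots> = (\<Oplus>\<^bsub>U\<^esub>s\<in>X. f s \<odot>\<^bsub>U\<^esub> h s) \<oplus>\<^bsub>U\<^esub> (\<Oplus>\<^bsub>U\<^esub>s\<in>X. g s \<odot>\<^bsub>U\<^esub> h s)"
      using X f g h by (intro U.M.finsum_addf) (auto simp: free_simps PiE_iff subset_iff)
    also have "\<dots> = \<phi> f \<oplus>\<^bsub>U\<^esub> \<phi> g"
      using ext[OF f, of X] ext[OF g, of X] X by (auto simp: X_def)
    finally show "\<phi> (f \<oplus>\<^bsub>free_space K S\<^esub> g) = \<phi> f \<oplus>\<^bsub>U\<^esub> \<phi> g" .
  next
    fix c f assume c: "c \<in> carrier K" and f: "f \<in> carrier (free_space K S)"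
    define X where "X = {s \<in> S. f s \<noteq> \<zero>\<^bsub>K\<^esub>}"
    have X: "X \<subseteq> S" "finite X" using f by (auto simp: X_def free_simps)
    have cf: "c \<odot>\<^bsub>free_space K S\<^esub> f \<in> carrier (free_space K S)" using c f by simp
    have "\<phi> (c \<odot>\<^bsub>free_space K S\<^esub> f) = (\<Oplus>\<^bsub>U\<^esub>s\<in>X. (c \<odot>\<^bsub>free_space K S\<^esub> f) s \<odot>\<^bsub>U\<^esub> h s)"
      using X cf c by (intro ext) (auto simp: X_def free_simps)
    also have "\<dots> = (\<Oplus>\<^bsub>U\<^esub>s\<in>X. c \<odot>\<^bsub>U\<^esub> (f s \<odot>\<^bsub>U\<^esub> h s))"
      using X f c h by (intro U.M.finsum_cong') (auto simp: free_simps PiE_iff subset_iff U.smult_assoc1)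
    also have "\<dots> = c \<odot>\<^bsub>U\<^esub> (\<Oplus>\<^bsub>U\<^esub>s\<in>X. f s \<odot>\<^bsub>U\<^esub> h s)"
      using X f c h
      by (intro U.finsum_smult_ldistr[symmetric]) (auto simp: free_simps PiE_iff subset_iff)
    also have "\<dots> = c \<odot>\<^bsub>U\<^esub> \<phi> f" using ext[OF f, of X] X by (auto simp: X_def)
    finally show "\<phi> (c \<odot>\<^bsub>free_space K S\<^esub> f) = c \<odot>\<^bsub>U\<^esub> \<phi> f" .
  qed
  moreover have "\<phi> (free_gen K S s) = h s" if s: "s \<in> S" for s
  proof -
    have "\<phi> (free_gen K S s) = (\<Oplus>\<^bsub>U\<^esub>t\<in>{s}. free_gen K S s t \<odot>\<^bsub>U\<^esub> h t)"
      using s by (intro ext free_gen_closed) (auto simp: free_gen_def)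
    also have "\<dots> = h s" using s h by (simp add: free_gen_def U.M.finsum_singleton)
    finally show ?thesis .
  qed
  ultimately show ?thesis by blast
qed

end


context
  fixes K :: "('k, 'e) ring_scheme"
    and V :: "('k, 'v, 'm) module_scheme" and W :: "('k, 'w, 'n) module_scheme"
  assumes vsV: "vectorspace K V" and vsW: "vectorspace K W"
begin

interpretation V: vectorspace K V by (rule vsV)
interpretation W: vectorspace K W by (rule vsW)

lemma fieldK: "field K"
  by (rule V.field_axioms)

lemma tensor_free_vs: "vectorspace K (tensor_free K V W)"
  unfolding tensor_free_def by (rule free_vs[OF fieldK])

interpretation F: vectorspace K "tensor_free K V W" by (rule tensor_free_vs)

lemma tensor_gen_closed:
  "v \<in> carrier V \<Longrightarrow> w \<in> carrier W \<Longrightarrow> tensor_gen K V W v w \<in> carrier (tensor_free K V W)"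
  unfolding tensor_free_def tensor_gen_def by (rule free_gen_closed[OF fieldK]) simp

lemma tensor_relators_sub: "tensor_relators K V W \<subseteq> carrier (tensor_free K V W)"
  by (auto simp: tensor_relators_def Let_def tensor_gen_closed)

lemma tensor_null_subspace: "subspace K (tensor_null K V W) (tensor_free K V W)"
  unfolding tensor_null_def subspace_def
  using F.span_is_submodule[OF tensor_relators_sub] tensor_free_vs by blast

lemma tensor_vs: "vectorspace K (tensor K V W)"
  unfolding tensor_def by (rule quotient_vs[OF tensor_null_subspace])

lemma tensor_proj:
  "linear_map K (tensor_free K V W) (tensor K V W)
    (\<lambda>f. tensor_null K V W +>\<^bsub>tensor_free K V W\<^esub> f)"
  unfolding tensor_def by (rule coset_linear[OF tensor_null_subspace])

interpretation T: vectorspace K "tensor K V W" by (rule tensor_vs)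

lemma pure_closed:
  "v \<in> carrier V \<Longrightarrow> w \<in> carrier W \<Longrightarrow> pure_tensor K V W v w \<in> carrier (tensor K V W)"
  unfolding pure_tensor_def using linear_mapD(3)[OF tensor_proj] tensor_gen_closed by blast

lemma relator_eqI:
  assumes "x \<ominus>\<^bsub>tensor_free K V W\<^esub> y \<in> tensor_relators K V W"
    "x \<in> carrier (tensor_free K V W)" "y \<in> carrier (tensor_free K V W)"
  shows "tensor_null K V W +>\<^bsub>tensor_free K V W\<^esub> x = tensor_null K V W +>\<^bsub>tensor_free K V W\<^esub> y"
  using assms F.in_own_span[OF tensor_relators_sub] coset_eq_iff[OF tensor_null_subspace]
  unfolding tensor_null_def by blast

lemma pure_bilinear: "bilinear K V W (tensor K V W) (pure_tensor K V W)"
proof -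
  note D = linear_mapD[OF tensor_proj]
  note [simp] = tensor_gen_closed
  have 1: "pure_tensor K V W (v \<oplus>\<^bsub>V\<^esub> v') w =
      pure_tensor K V W v w \<oplus>\<^bsub>tensor K V W\<^esub> pure_tensor K V W v' w"
    if "v \<in> carrier V" "v' \<in> carrier V" "w \<in> carrier W" for v v' w
    unfolding pure_tensor_def using that
    by (subst D(4)[symmetric]; (intro relator_eqI)?)
       (auto simp: tensor_relators_def Let_def)
  have 2: "pure_tensor K V W v (w \<oplus>\<^bsub>W\<^esub> w') =
      pure_tensor K V W v w \<oplus>\<^bsub>tensor K V W\<^esub> pure_tensor K V W v w'"
    if "v \<in> carrier V" "w \<in> carrier W" "w' \<in> carrier W" for v w w'
    unfolding pure_tensor_def using that
    by (subst D(4)[symmetric]; (intro relator_eqI)?)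
       (auto simp: tensor_relators_def Let_def)
  have 3: "pure_tensor K V W (c \<odot>\<^bsub>V\<^esub> v) w = c \<odot>\<^bsub>tensor K V W\<^esub> pure_tensor K V W v w"
    if "v \<in> carrier V" "c \<in> carrier K" "w \<in> carrier W" for v c w
    unfolding pure_tensor_def using that
    by (subst D(5)[symmetric]; (intro relator_eqI)?)
       (auto simp: tensor_relators_def Let_def)
  have 4: "pure_tensor K V W v (c \<odot>\<^bsub>W\<^esub> w) = c \<odot>\<^bsub>tensor K V W\<^esub> pure_tensor K V W v w"
    if "v \<in> carrier V" "c \<in> carrier K" "w \<in> carrier W" for v c w
    unfolding pure_tensor_def using that
    by (subst D(5)[symmetric]; (intro relator_eqI)?)
       (auto simp: tensor_relators_def Let_def)
  show ?thesis
    unfolding bilinear_def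
    by (auto intro!: linear_mapI simp: vsV vsW tensor_vs pure_closed 1 2 3 4)
qed

lemma tensor_induct [consumes 1, case_names pure add]:
  assumes t: "t \<in> carrier (tensor K V W)"
    and pure: "\<And>v w. v \<in> carrier V \<Longrightarrow> w \<in> carrier W \<Longrightarrow> P (pure_tensor K V W v w)"
    and add: "\<And>s t. s \<in> carrier (tensor K V W) \<Longrightarrow> t \<in> carrier (tensor K V W) \<Longrightarrow>
      P s \<Longrightarrow> P t \<Longrightarrow> P (s \<oplus>\<^bsub>tensor K V W\<^esub> t)"
  shows "P t"
proof -
  note D = linear_mapD[OF tensor_proj]
  let ?p = "\<lambda>f. tensor_null K V W +>\<^bsub>tensor_free K V W\<^esub> f"
  have lin: "linear_map K V (tensor K V W) (\<lambda>v. pure_tensor K V W v w)" if "w \<in> carrier W" for w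
    using pure_bilinear that by (simp add: bilinear_def)
  have "f \<in> carrier (tensor_free K V W) \<Longrightarrow> P (?p f)" for f
    unfolding tensor_free_def
  proof (induction f rule: free_induct[OF fieldK, consumes 1, case_names zero step])
    case zero
    show ?case
      using pure[OF V.M.zero_closed W.M.zero_closed] linear_mapD(6)[OF lin[OF W.M.zero_closed]] D(6)
      unfolding tensor_free_def by simp
  next
    case (step c s f)
    obtain v w where s: "s = (v, w)" "v \<in> carrier V" "w \<in> carrier W" using step(2) by auto
    have g: "tensor_gen K V W v w \<in> carrier (tensor_free K V W)" using s tensor_gen_closed by simp
    have "?p (f \<oplus>\<^bsub>tensor_free K V W\<^esub> c \<odot>\<^bsub>tensor_free K V W\<^esub> tensor_gen K V W v w)
        = ?p f \<oplus>\<^bsub>tensor K V W\<^esub> c \<odot>\<^bsub>tensor K V W\<^esub> pure_tensor K V W v w"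
      using step(1,3) g D(4,5) unfolding tensor_free_def[symmetric] by (simp add: pure_tensor_def)
    also have "\<dots> = ?p f \<oplus>\<^bsub>tensor K V W\<^esub> pure_tensor K V W (c \<odot>\<^bsub>V\<^esub> v) w"
      using linear_mapD(5)[OF lin] s step(1) by simp
    finally show ?case
      using add[of "?p f" "pure_tensor K V W (c \<odot>\<^bsub>V\<^esub> v) w"] step s pure pure_closed D(3)
      by (simp add: tensor_free_def tensor_gen_def)
  qed
  then show ?thesis
    using t quotient_carrier[OF tensor_null_subspace] by (auto simp: tensor_def)
qed

lemma tensor_lift_ex:
  fixes U :: "('k, 'u, 'o) module_scheme"
  assumes U: "vectorspace K U" and b: "bilinear K V W U b"
  shows "\<exists>\<phi>. linear_map K (tensor K V W) U \<phi> \<and>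
    (\<forall>v\<in>carrier V. \<forall>w\<in>carrier W. \<phi> (pure_tensor K V W v w) = b v w)"
proof -
  interpret U: vectorspace K U by (rule U)
  have b1: "linear_map K W U (\<lambda>w. b v w)" if "v \<in> carrier V" for v
    using b that by (simp add: bilinear_def)
  have b2: "linear_map K V U (\<lambda>v. b v w)" if "w \<in> carrier W" for w
    using b that by (simp add: bilinear_def)
  have bc: "b v w \<in> carrier U" if "v \<in> carrier V" "w \<in> carrier W" for v w
    using linear_mapD(3)[OF b1] that by blast
  obtain \<psi> where \<psi>: "linear_map K (tensor_free K V W) U \<psi>"
    "\<And>v w. v \<in> carrier V \<Longrightarrow> w \<in> carrier W \<Longrightarrow> \<psi> (tensor_gen K V W v w) = b v w"
    using free_lift_ex[OF fieldK U, of "carrier V \<times> carrier W" "\<lambda>(v, w). b v w"] bc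
    unfolding tensor_free_def tensor_gen_def by auto
  interpret psi: linear_map K "tensor_free K V W" U \<psi> by (rule \<psi>)
  note [simp] = tensor_gen_closed bc \<psi>(2)
  have "tensor_relators K V W \<subseteq> psi.ker"
    using linear_mapD(4,5)[OF b1] linear_mapD(4,5)[OF b2]
    by (auto simp: tensor_relators_def Let_def psi.ker_def a_minus_def U.M.r_neg)
  then have null: "tensor_null K V W \<subseteq> psi.ker"
    unfolding tensor_null_def by (rule F.span_is_subset[OF _ psi.ker_is_submodule])
  define \<phi> where "\<phi> t = \<psi> (SOME f. f \<in> carrier (tensor_free K V W) \<and>
    tensor_null K V W +>\<^bsub>tensor_free K V W\<^esub> f = t)" for t
  have \<phi>: "\<phi> (tensor_null K V W +>\<^bsub>tensor_free K V W\<^esub> f) = \<psi> f"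
    if f: "f \<in> carrier (tensor_free K V W)" for f
  proof -
    let ?Q = "\<lambda>g. g \<in> carrier (tensor_free K V W) \<and>
      tensor_null K V W +>\<^bsub>tensor_free K V W\<^esub> g = tensor_null K V W +>\<^bsub>tensor_free K V W\<^esub> f"
    have g: "?Q (SOME g. ?Q g)" by (rule someI[of ?Q f]) (simp add: f)
    then have "(SOME g. ?Q g) \<ominus>\<^bsub>tensor_free K V W\<^esub> f \<in> psi.ker"
      using coset_eq_iff[OF tensor_null_subspace] f null by blast
    then have "\<psi> (SOME g. ?Q g) \<ominus>\<^bsub>U\<^esub> \<psi> f = \<zero>\<^bsub>U\<^esub>"
      using g f by (simp add: psi.ker_def)
    then show ?thesis
      using g f U.M.minus_equality[of "\<psi> (SOME g. ?Q g)" "\<ominus>\<^bsub>U\<^esub> \<psi> f"]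
      unfolding \<phi>_def by (simp add: a_minus_def)
  qed
  note D = linear_mapD[OF tensor_proj]
  have rep: "\<exists>f\<in>carrier (tensor_free K V W). t = tensor_null K V W +>\<^bsub>tensor_free K V W\<^esub> f"
    if "t \<in> carrier (tensor K V W)" for t
    using that quotient_carrier[OF tensor_null_subspace] by (auto simp: tensor_def)
  have "linear_map K (tensor K V W) U \<phi>"
  proof (rule linear_mapI[OF tensor_vs U])
    show "\<phi> t \<in> carrier U" if "t \<in> carrier (tensor K V W)" for t
      using rep[OF that] \<phi> by auto
    show "\<phi> (s \<oplus>\<^bsub>tensor K V W\<^esub> t) = \<phi> s \<oplus>\<^bsub>U\<^esub> \<phi> t"
      if st: "s \<in> carrier (tensor K V W)" "t \<in> carrier (tensor K V W)" for s t
    proof -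
      obtain f g where "f \<in> carrier (tensor_free K V W)" "g \<in> carrier (tensor_free K V W)"
        "s = tensor_null K V W +>\<^bsub>tensor_free K V W\<^esub> f" "t = tensor_null K V W +>\<^bsub>tensor_free K V W\<^esub> g"
        using rep[OF st(1)] rep[OF st(2)] by auto
      then show ?thesis using D(4)[symmetric] by (simp add: \<phi>)
    qed
    show "\<phi> (c \<odot>\<^bsub>tensor K V W\<^esub> t) = c \<odot>\<^bsub>U\<^esub> \<phi> t"
      if c: "c \<in> carrier K" and t: "t \<in> carrier (tensor K V W)" for c t
    proof -
      obtain f where "f \<in> carrier (tensor_free K V W)"
        "t = tensor_null K V W +>\<^bsub>tensor_free K V W\<^esub> f"
        using rep[OF t] by auto
      then show ?thesis using D(5)[symmetric] c by (simp add: \<phi>)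
    qed
  qed
  moreover have "\<phi> (pure_tensor K V W v w) = b v w" if "v \<in> carrier V" "w \<in> carrier W" for v w
    using that by (simp add: pure_tensor_def \<phi>)
  ultimately show ?thesis by blast
qed

lemma tensor_linear_eq:
  fixes U :: "('k, 'u, 'o) module_scheme"
  assumes "linear_map K (tensor K V W) U \<phi>" "linear_map K (tensor K V W) U \<psi>"
    and "\<And>v w. v \<in> carrier V \<Longrightarrow> w \<in> carrier W \<Longrightarrow>
      \<phi> (pure_tensor K V W v w) = \<psi> (pure_tensor K V W v w)"
    and t: "t \<in> carrier (tensor K V W)"
  shows "\<phi> t = \<psi> t"
  using t
  by (induction rule: tensor_induct)
     (simp_all add: assms(3) linear_mapD(4)[OF assms(1)] linear_mapD(4)[OF assms(2)])

end


subsection \<open>The current Lie algebra is well defined\<close>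

lemma lie_algebra_vs: "lie_algebra K L \<Longrightarrow> vectorspace K L"
  by (simp add: lie_algebra_def)

lemma algebra_vs: "field K \<Longrightarrow> algebra K A \<Longrightarrow> vectorspace K A"
  by (simp add: vectorspace_def algebra_def)

context
  fixes K :: "('k, 'e) ring_scheme" and L :: "('k, 'l, 'm) lie_alg_scheme"
    and A :: "('k, 'a, 'n) module_scheme"
  assumes lie: "lie_algebra K L" and alg: "algebra K A"
begin

interpretation L: lie_algebra K L by (rule lie)
interpretation A: algebra K A by (rule alg)

lemma vsA: "vectorspace K A"
  by (rule algebra_vs[OF L.field_axioms alg])

lemma vsL: "vectorspace K L"
  by (rule lie_algebra_vs[OF lie])

private abbreviation (input) "T \<equiv> tensor K L A"
private abbreviation (input) "pt \<equiv> pure_tensor K L A"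

interpretation T: vectorspace K T by (rule tensor_vs[OF vsL vsA])

lemmas pt_closed = pure_closed[OF vsL vsA]

lemma br_linear:
  "x \<in> carrier L \<Longrightarrow> linear_map K L L (\<lambda>y. \<lbrakk>x, y\<rbrakk>\<^bsub>L\<^esub>)"
  "y \<in> carrier L \<Longrightarrow> linear_map K L L (\<lambda>x. \<lbrakk>x, y\<rbrakk>\<^bsub>L\<^esub>)"
  using L.bracket_bilinear by (simp_all add: bilinear_def)

lemma pt_linear:
  "x \<in> carrier L \<Longrightarrow> linear_map K A T (pt x)"
  "a \<in> carrier A \<Longrightarrow> linear_map K L T (\<lambda>x. pt x a)"
  using pure_bilinear[OF vsL vsA] by (simp_all add: bilinear_def)

lemma A_smult_mult:
  "c \<in> carrier K \<Longrightarrow> a \<in> carrier A \<Longrightarrow> b \<in> carrier A \<Longrightarrow>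
    a \<otimes>\<^bsub>A\<^esub> (c \<odot>\<^bsub>A\<^esub> b) = c \<odot>\<^bsub>A\<^esub> (a \<otimes>\<^bsub>A\<^esub> b)"
  by (metis A.m_comm A.smult_assoc2 A.smult_closed)

lemma br_closed: "x \<in> carrier L \<Longrightarrow> y \<in> carrier L \<Longrightarrow> \<lbrakk>x, y\<rbrakk>\<^bsub>L\<^esub> \<in> carrier L"
  using linear_mapD(3)[OF br_linear(1)] by blast

lemma current_bracket_ex: "\<exists>B. is_current_bracket K L A B"
proof -
  note [simp] = br_closed pt_closed linear_mapD(4,5)[OF br_linear(1)] linear_mapD(4,5)[OF br_linear(2)]
    linear_mapD(4,5)[OF pt_linear(1)] linear_mapD(4,5)[OF pt_linear(2)]
  have "\<exists>\<phi>. linear_map K T T \<phi> \<and> (\<forall>y\<in>carrier L. \<forall>b\<in>carrier A. \<phi> (pt y b) = pt \<lbrakk>x, y\<rbrakk>\<^bsub>L\<^esub> (a \<otimes>\<^bsub>A\<^esub> b))"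
    if "x \<in> carrier L" "a \<in> carrier A" for x a
    by (rule tensor_lift_ex[OF vsL vsA tensor_vs[OF vsL vsA]])
       (use that in \<open>auto simp: bilinear_def A.r_distr A_smult_mult
          intro!: linear_mapI vsL vsA tensor_vs[OF vsL vsA]\<close>)
  then obtain m where m: "\<And>x a. x \<in> carrier L \<Longrightarrow> a \<in> carrier A \<Longrightarrow> linear_map K T T (m x a)"
    and mp: "\<And>x a y b. x \<in> carrier L \<Longrightarrow> a \<in> carrier A \<Longrightarrow> y \<in> carrier L \<Longrightarrow> b \<in> carrier A \<Longrightarrow>
      m x a (pt y b) = pt \<lbrakk>x, y\<rbrakk>\<^bsub>L\<^esub> (a \<otimes>\<^bsub>A\<^esub> b)"
    by metis
  note [simp] = mp linear_mapD(3-5)[OF m]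
  have ma: "m (x \<oplus>\<^bsub>L\<^esub> x') a t = m x a t \<oplus>\<^bsub>T\<^esub> m x' a t"
    if "x \<in> carrier L" "x' \<in> carrier L" "a \<in> carrier A" "t \<in> carrier T" for x x' a t
    using that(4)
    by (induction rule: tensor_induct[OF vsL vsA, consumes 1, case_names pure add])
       (use that(1-3) in \<open>simp_all add: T.M.a_ac\<close>)
  have mb: "m x (a \<oplus>\<^bsub>A\<^esub> a') t = m x a t \<oplus>\<^bsub>T\<^esub> m x a' t"
    if "x \<in> carrier L" "a \<in> carrier A" "a' \<in> carrier A" "t \<in> carrier T" for x a a' t
    using that(4)
    by (induction rule: tensor_induct[OF vsL vsA, consumes 1, case_names pure add])
       (use that(1-3) in \<open>simp_all add: T.M.a_ac A.l_distr\<close>)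
  have mc: "m (c \<odot>\<^bsub>L\<^esub> x) a t = c \<odot>\<^bsub>T\<^esub> m x a t"
    if "c \<in> carrier K" "x \<in> carrier L" "a \<in> carrier A" "t \<in> carrier T" for x c a t
    using that(4)
    by (induction rule: tensor_induct[OF vsL vsA, consumes 1, case_names pure add])
       (use that(1-3) in \<open>simp_all add: T.smult_r_distr\<close>)
  have md: "m x (c \<odot>\<^bsub>A\<^esub> a) t = c \<odot>\<^bsub>T\<^esub> m x a t"
    if "c \<in> carrier K" "x \<in> carrier L" "a \<in> carrier A" "t \<in> carrier T" for x c a t
    using that(4)
    by (induction rule: tensor_induct[OF vsL vsA, consumes 1, case_names pure add])
       (use that(1-3) in \<open>simp_all add: T.smult_r_distr A.smult_assoc2\<close>)
  have "\<exists>\<phi>. linear_map K T T \<phi> \<and> (\<forall>x\<in>carrier L. \<forall>a\<in>carrier A. \<phi> (pt x a) = m x a t)"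
    if t: "t \<in> carrier T" for t
    by (rule tensor_lift_ex[OF vsL vsA tensor_vs[OF vsL vsA]])
       (use t in \<open>auto simp: bilinear_def ma mb mc md
          intro!: linear_mapI vsL vsA tensor_vs[OF vsL vsA]\<close>)
  then obtain n where n: "\<And>t. t \<in> carrier T \<Longrightarrow> linear_map K T T (n t)"
    and np: "\<And>t x a. t \<in> carrier T \<Longrightarrow> x \<in> carrier L \<Longrightarrow> a \<in> carrier A \<Longrightarrow> n t (pt x a) = m x a t"
    by metis
  note [simp] = np linear_mapD(3-5)[OF n]
  have na: "n (t \<oplus>\<^bsub>T\<^esub> t') s = n t s \<oplus>\<^bsub>T\<^esub> n t' s"
    if "t \<in> carrier T" "t' \<in> carrier T" "s \<in> carrier T" for t t' s
    using that(3)
    by (induction rule: tensor_induct[OF vsL vsA, consumes 1, case_names pure add])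
       (use that(1-2) in \<open>simp_all add: T.M.a_ac\<close>)
  have nb: "n (c \<odot>\<^bsub>T\<^esub> t) s = c \<odot>\<^bsub>T\<^esub> n t s"
    if "t \<in> carrier T" "c \<in> carrier K" "s \<in> carrier T" for t c s
    using that(3)
    by (induction rule: tensor_induct[OF vsL vsA, consumes 1, case_names pure add])
       (use that(1-2) in \<open>simp_all add: T.smult_r_distr\<close>)
  let ?B = "\<lambda>s\<in>carrier T. \<lambda>t\<in>carrier T. n t s"
  have "is_current_bracket K L A ?B"
    unfolding is_current_bracket_def bilinear_def
    by (auto intro!: linear_mapI tensor_vs[OF vsL vsA] simp: na nb)
  then show ?thesis by blast
qed

lemma tensor_bilinear_eq:
  fixes U :: "('k, 'u, 'o) module_scheme"
  assumes B: "bilinear K T T U B" and C: "bilinear K T T U C"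
    and eq: "\<And>x y a b. x \<in> carrier L \<Longrightarrow> y \<in> carrier L \<Longrightarrow> a \<in> carrier A \<Longrightarrow> b \<in> carrier A \<Longrightarrow>
      B (pt x a) (pt y b) = C (pt x a) (pt y b)"
    and s: "s \<in> carrier T" and t: "t \<in> carrier T"
  shows "B s t = C s t"
proof (rule tensor_linear_eq[OF vsL vsA, where \<phi> = "\<lambda>s. B s t" and \<psi> = "\<lambda>s. C s t", OF _ _ _ s])
  show "linear_map K T U (\<lambda>s. B s t)" "linear_map K T U (\<lambda>s. C s t)"
    using B C t by (simp_all add: bilinear_def)
  fix x a assume x: "x \<in> carrier L" and a: "a \<in> carrier A"
  show "B (pt x a) t = C (pt x a) t"
    by (rule tensor_linear_eq[OF vsL vsA, where \<phi> = "B (pt x a)" and \<psi> = "C (pt x a)", OF _ _ _ t])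
       (use B C x a eq pt_closed in \<open>auto simp: bilinear_def\<close>)
qed

lemma current_bracket_ex1: "\<exists>!B. is_current_bracket K L A B"
proof (rule ex_ex1I[OF current_bracket_ex])
  fix B C assume B: "is_current_bracket K L A B" and C: "is_current_bracket K L A C"
  have eq: "B s t = C s t" if "s \<in> carrier T" "t \<in> carrier T" for s t
    by (rule tensor_bilinear_eq[OF _ _ _ that])
       (use B C in \<open>auto simp: is_current_bracket_def\<close>)
  show "B = C"
  proof (rule PiE_ext)
    show "B \<in> carrier T \<rightarrow>\<^sub>E (carrier T \<rightarrow>\<^sub>E carrier T)"
      "C \<in> carrier T \<rightarrow>\<^sub>E (carrier T \<rightarrow>\<^sub>E carrier T)"
      using B C by (simp_all add: is_current_bracket_def)
    then show "B s = C s" if "s \<in> carrier T" for s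
      using that eq by (intro PiE_ext[of "B s" "carrier T" "\<lambda>_. carrier T" "C s"]) auto
  qed
qed

lemma current_bracket: "is_current_bracket K L A (bracket (current K L A))"
  using theI'[OF current_bracket_ex1] by (simp add: current_def)

lemma current_simps:
  "carrier (current K L A) = carrier T" "\<zero>\<^bsub>current K L A\<^esub> = \<zero>\<^bsub>T\<^esub>"
  "s \<oplus>\<^bsub>current K L A\<^esub> t = s \<oplus>\<^bsub>T\<^esub> t" "c \<odot>\<^bsub>current K L A\<^esub> t = c \<odot>\<^bsub>T\<^esub> t"
  by (simp_all add: current_def)

lemma current_vs: "vectorspace K (current K L A)"
  by (rule vs_criteria)
     (auto simp: current_simps L.field_axioms T.M.a_ac T.smult_assoc1 T.smult_l_distr T.smult_r_distr
       intro: bexI[of _ "\<ominus>\<^bsub>T\<^esub> _"] T.M.r_neg)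

lemma current_lie_algebra: "lie_algebra K (current K L A)"
proof (rule lie_algebra.intro[OF current_vs], rule lie_algebra_axioms.intro)
  let ?C = "current K L A"
  let ?B = "\<lambda>s t. \<lbrakk>s, t\<rbrakk>\<^bsub>?C\<^esub>"
  have B: "bilinear K T T T ?B"
    and p: "\<And>x y a b. x \<in> carrier L \<Longrightarrow> y \<in> carrier L \<Longrightarrow> a \<in> carrier A \<Longrightarrow> b \<in> carrier A \<Longrightarrow>
      ?B (pt x a) (pt y b) = pt \<lbrakk>x, y\<rbrakk>\<^bsub>L\<^esub> (a \<otimes>\<^bsub>A\<^esub> b)"
    using current_bracket by (auto simp: is_current_bracket_def)
  have B1: "linear_map K T T (?B s)" if "s \<in> carrier T" for s using B that by (simp add: bilinear_def)
  have B2: "linear_map K T T (\<lambda>s. ?B s t)" if "t \<in> carrier T" for t using B that by (simp add: bilinear_def)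
  note [simp] = br_closed pt_closed p linear_mapD(3-5)[OF B1] linear_mapD(4,5)[OF B2]
  note ind = tensor_induct[OF vsL vsA, consumes 1, case_names pure add]
  show "bilinear K ?C ?C ?C ?B"
    by (auto simp: bilinear_def current_simps intro!: linear_mapI current_vs)
  have L0: "pt x a \<oplus>\<^bsub>T\<^esub> pt y a = \<zero>\<^bsub>T\<^esub>"
    if "x \<in> carrier L" "y \<in> carrier L" "a \<in> carrier A" "x \<oplus>\<^bsub>L\<^esub> y = \<zero>\<^bsub>L\<^esub>" for x y a
    using linear_mapD(4)[OF pt_linear(2)[OF that(3)] that(1,2)] linear_mapD(6)[OF pt_linear(2)[OF that(3)]]
      that(4) by simp
  have anti: "\<lbrakk>x, y\<rbrakk>\<^bsub>L\<^esub> \<oplus>\<^bsub>L\<^esub> \<lbrakk>y, x\<rbrakk>\<^bsub>L\<^esub> = \<zero>\<^bsub>L\<^esub>" if "x \<in> carrier L" "y \<in> carrier L" for x y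
    using L.bracket_alternating[of "x \<oplus>\<^bsub>L\<^esub> y"] that L.bracket_alternating[of x] L.bracket_alternating[of y]
    by (simp add: linear_mapD(4)[OF br_linear(1)] linear_mapD(4)[OF br_linear(2)] L.M.a_ac)
  have antip: "?B s t \<oplus>\<^bsub>T\<^esub> ?B t s = \<zero>\<^bsub>T\<^esub>" if s: "s \<in> carrier T" and t: "t \<in> carrier T" for s t
    using s
  proof (induction s rule: ind)
    case (pure x a)
    show ?case using t
    proof (induction t rule: ind)
      case (pure y b)
      then show ?case using \<open>x \<in> carrier L\<close> \<open>a \<in> carrier A\<close> anti by (simp add: L0 A.m_comm[of b a])
    next
      case (add t t')
      have "?B (pt x a) (t \<oplus>\<^bsub>T\<^esub> t') \<oplus>\<^bsub>T\<^esub> ?B (t \<oplus>\<^bsub>T\<^esub> t') (pt x a)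
        = (?B (pt x a) t \<oplus>\<^bsub>T\<^esub> ?B t (pt x a)) \<oplus>\<^bsub>T\<^esub> (?B (pt x a) t' \<oplus>\<^bsub>T\<^esub> ?B t' (pt x a))"
        using add(1,2) pure by (simp add: T.M.a_ac)
      then show ?case using add by simp
    qed
  next
    case (add s s')
    have "?B (s \<oplus>\<^bsub>T\<^esub> s') t \<oplus>\<^bsub>T\<^esub> ?B t (s \<oplus>\<^bsub>T\<^esub> s')
      = (?B s t \<oplus>\<^bsub>T\<^esub> ?B t s) \<oplus>\<^bsub>T\<^esub> (?B s' t \<oplus>\<^bsub>T\<^esub> ?B t s')"
      using add(1,2) t by (simp add: T.M.a_ac)
    then show ?case using add by simp
  qed
  have alt: "?B s s = \<zero>\<^bsub>T\<^esub>" if "s \<in> carrier T" for s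
    using that
  proof (induction s rule: ind)
    case (pure x a)
    then show ?case using L.bracket_alternating[of x] linear_mapD(6)[OF pt_linear(2)] by simp
  next
    case (add s t)
    then show ?case using antip[of s t] by (simp add: T.M.a_ac)
  qed
  then show "?B s s = \<zero>\<^bsub>?C\<^esub>" if "s \<in> carrier ?C" for s
    using that by (simp add: current_simps)
  define J where "J s t u = ?B s (?B t u) \<oplus>\<^bsub>T\<^esub> ?B t (?B u s) \<oplus>\<^bsub>T\<^esub> ?B u (?B s t)" for s t u
  have Jcyc: "J s t u = J t u s" if "s \<in> carrier T" "t \<in> carrier T" "u \<in> carrier T" for s t u
    using that by (simp add: J_def T.M.a_ac)
  have Jadd: "J (s \<oplus>\<^bsub>T\<^esub> s') t u = J s t u \<oplus>\<^bsub>T\<^esub> J s' t u"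
    if "s \<in> carrier T" "s' \<in> carrier T" "t \<in> carrier T" "u \<in> carrier T" for s s' t u
    using that by (simp add: J_def T.M.a_ac)
  have J0: "J (pt x a) (pt y b) (pt z c) = \<zero>\<^bsub>T\<^esub>"
    if "x \<in> carrier L" "y \<in> carrier L" "z \<in> carrier L" "a \<in> carrier A" "b \<in> carrier A" "c \<in> carrier A"
    for x y z a b c
  proof -
    have e: "b \<otimes>\<^bsub>A\<^esub> (c \<otimes>\<^bsub>A\<^esub> a) = a \<otimes>\<^bsub>A\<^esub> (b \<otimes>\<^bsub>A\<^esub> c)" "c \<otimes>\<^bsub>A\<^esub> (a \<otimes>\<^bsub>A\<^esub> b) = a \<otimes>\<^bsub>A\<^esub> (b \<otimes>\<^bsub>A\<^esub> c)"
      using that by (simp_all add: A.m_ac)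
    show ?thesis
      using that L.jacobi[of x y z] e
      by (simp add: J_def linear_mapD(4)[OF pt_linear(2), symmetric] linear_mapD(6)[OF pt_linear(2)])
  qed
  have J1: "J s (pt y b) (pt z c) = \<zero>\<^bsub>T\<^esub>"
    if "s \<in> carrier T" "y \<in> carrier L" "z \<in> carrier L" "b \<in> carrier A" "c \<in> carrier A" for s y z b c
    using that(1) by (induction s rule: ind) (simp_all add: J0 Jadd that(2-))
  have J2: "J s t (pt z c) = \<zero>\<^bsub>T\<^esub>"
    if "s \<in> carrier T" "t \<in> carrier T" "z \<in> carrier L" "c \<in> carrier A" for s t z c
    using that(2)
  proof (induction t rule: ind)
    case (pure y b) then show ?case using that by (simp add: J1)
  next
    case (add t t')
    then show ?case
      using that Jcyc[of s "t \<oplus>\<^bsub>T\<^esub> t'" "pt z c"] Jcyc[of s t "pt z c"] Jcyc[of s t' "pt z c"]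
      by (simp add: Jadd)
  qed
  have J3: "J s t u = \<zero>\<^bsub>T\<^esub>" if "s \<in> carrier T" "t \<in> carrier T" "u \<in> carrier T" for s t u
    using that(3)
  proof (induction u rule: ind)
    case (pure y b) then show ?case using that by (simp add: J2)
  next
    case (add u u')
    then show ?case
      using that Jcyc[of "u \<oplus>\<^bsub>T\<^esub> u'" s t] Jcyc[of u s t] Jcyc[of u' s t]
      by (simp add: Jadd)
  qed
  then show "?B s (?B t u) \<oplus>\<^bsub>?C\<^esub> ?B t (?B u s) \<oplus>\<^bsub>?C\<^esub> ?B u (?B s t) = \<zero>\<^bsub>?C\<^esub>"
    if "s \<in> carrier ?C" "t \<in> carrier ?C" "u \<in> carrier ?C" for s t u
    using that by (simp add: current_simps J_def)
qed

end

end

theory Submission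
  imports Defs
begin

text \<open>
Let \<open>F\<close> be a Poisson structure on \<open>L \<otimes> A\<close>. The Poisson identity says that every derivation
\<open>[z \<otimes> c, -]\<close> satisfies the Leibniz rule for \<open>F\<close>. On \<open>L \<otimes> A\<close> this derivation is \<open>c\<close> times
\<open>[z \<otimes> 1, -]\<close>, where \<open>c\<close> acts through the \<open>A\<close>-module structure. Subtracting \<open>c\<close> times the identity for
\<open>z \<otimes> 1\<close> from the identity for \<open>z \<otimes> c\<close> leaves \<open>G([z,x], y) + H(x, [z,y]) = 0\<close>, where \<open>G\<close> and \<open>H\<close>
measure the failure of \<open>F(x \<otimes> a, y \<otimes> b)\<close> to be \<open>A\<close>-linear in \<open>a\<close> and in \<open>b\<close>. Exchanging letters by
means of the antisymmetry of the bracket shows that \<open>H\<close> is right skew. The identities for \<open>z \<otimes> 1\<close>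
also show that each coordinate of \<open>H\<close> with respect to a basis of \<open>A\<close> is a Poisson structure on \<open>L\<close>.
So \<open>H = 0\<close>, then \<open>G\<close> vanishes on brackets, and \<open>G = 0\<close> because \<open>L\<close> is perfect
(\<open>current_poisson_scale\<close>).

Hence \<open>F(x \<otimes> a, y \<otimes> b) = ab F(x \<otimes> 1, y \<otimes> 1)\<close>, and \<open>F\<close> is determined by the Poisson structures on
\<open>L\<close> that are the coordinates of \<open>F(x \<otimes> 1, y \<otimes> 1)\<close> (\<open>current_poisson_zeroI\<close>). By the dimension
hypothesis only finitely many of these components are nonzero (\<open>component_poisson_finite\<close>), so \<open>F\<close>
is a finite sum of structures of the form \<open>(x \<otimes> a, y \<otimes> b) \<mapsto> f(x,y) \<otimes> abu\<close>
(\<open>current_poisson_induct\<close>).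

Sending \<open>f \<otimes> u\<close> to such an extension maps trivial structures to trivial ones, and so does taking
components. Both maps therefore descend to the quotients: the first one gives a linear map
\<open>\<P>(L) \<otimes> A \<rightarrow> \<P>(L \<otimes> A)\<close>, which is surjective by the previous paragraph, and the components detect
every coordinate of its argument, which makes it injective (\<open>current_poisson_quotient_iso\<close>). The
classes of the extensions generate \<open>\<P>(L \<otimes> A)\<close>, and a generating set contains a basis
(\<open>current_basic_poisson_structures\<close>).
\<close>
section \<open>Linear and bilinear maps\<close>

lemma linear_map_id: "vectorspace K V \<Longrightarrow> linear_map K V V (\<lambda>v. v)"
  by (rule linear_mapI) auto

lemma linear_map_comp:
  assumes "linear_map K V W f" and "linear_map K U V g"
  shows "linear_map K U W (\<lambda>u. f (g u))"
  using linear_mapD[OF assms(1)] linear_mapD[OF assms(2)] by (intro linear_mapI) simp_all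

lemma linear_map_add:
  assumes f: "linear_map K V W f" and g: "linear_map K V W g"
  shows "linear_map K V W (\<lambda>v. f v \<oplus>\<^bsub>W\<^esub> g v)"
proof -
  interpret W: vectorspace K W by (rule linear_mapD(2)[OF f])
  note [simp] = linear_mapD(3-5)[OF f] linear_mapD(3-5)[OF g]
  show ?thesis
    by (rule linear_mapI[OF linear_mapD(1,2)[OF f]]) (simp_all add: W.M.a_ac W.smult_r_distr)
qed

lemma linear_map_smult:
  assumes f: "linear_map K V W f" and c: "c \<in> carrier K"
  shows "linear_map K V W (\<lambda>v. c \<odot>\<^bsub>W\<^esub> f v)"
proof -
  interpret W: vectorspace K W by (rule linear_mapD(2)[OF f])
  note [simp] = linear_mapD(3-5)[OF f]
  show ?thesis
    by (rule linear_mapI[OF linear_mapD(1,2)[OF f]])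
       (simp_all add: W.smult_r_distr c W.smult_assoc1[symmetric] W.R.m_comm)
qed

lemma linear_map_zero:
  "vectorspace K V \<Longrightarrow> vectorspace K W \<Longrightarrow> linear_map K V W (\<lambda>v. \<zero>\<^bsub>W\<^esub>)"
  by (rule linear_mapI)
     (auto simp: vectorspace_def module.smult_r_null Module.module.axioms(2)[THEN abelian_group.axioms(1)]
        abelian_monoid.zero_closed abelian_monoid.l_zero)

lemma linear_map_cong:
  assumes "linear_map K V W f" and "\<And>v. v \<in> carrier V \<Longrightarrow> f v = g v"
  shows "linear_map K V W g"
proof -
  interpret V: vectorspace K V by (rule linear_mapD(1)[OF assms(1)])
  show ?thesis
    by (rule linear_mapI[OF linear_mapD(1,2)[OF assms(1)]])
       (simp_all add: assms(2)[symmetric] linear_mapD(3-5)[OF assms(1)])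
qed

text \<open>The records of \<open>current K L A\<close> and \<open>tensor K L A\<close> differ only in fields that have no influence
  on linearity; this lemma moves linear maps between them.\<close>
lemma linear_map_transfer:
  assumes f: "linear_map K V W f" and V': "vectorspace K V'" and W': "vectorspace K W'"
    and "carrier V' = carrier V" "add V' = add V" "smult V' = smult V"
    and "carrier W' = carrier W" "add W' = add W" "smult W' = smult W"
  shows "linear_map K V' W' f"
  using linear_mapD(3-5)[OF f] assms(4-) by (intro linear_mapI[OF V' W']) simp_all

lemma linear_map_diff:
  assumes f: "linear_map K V W f" and g: "linear_map K V W g"
  shows "linear_map K V W (\<lambda>v. f v \<ominus>\<^bsub>W\<^esub> g v)"
proof (rule linear_mapI[OF linear_mapD(1,2)[OF f]])
  interpret W: vectorspace K W by (rule linear_mapD(2)[OF f])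
  note [simp] = linear_mapD(3-5)[OF f] linear_mapD(3-5)[OF g]
  show "f v \<ominus>\<^bsub>W\<^esub> g v \<in> carrier W" if "v \<in> carrier V" for v using that by simp
  show "f (v \<oplus>\<^bsub>V\<^esub> w) \<ominus>\<^bsub>W\<^esub> g (v \<oplus>\<^bsub>V\<^esub> w) = f v \<ominus>\<^bsub>W\<^esub> g v \<oplus>\<^bsub>W\<^esub> (f w \<ominus>\<^bsub>W\<^esub> g w)"
    if "v \<in> carrier V" "w \<in> carrier V" for v w
    using that by (simp add: a_minus_def W.M.minus_add W.M.a_ac)
  show "f (c \<odot>\<^bsub>V\<^esub> v) \<ominus>\<^bsub>W\<^esub> g (c \<odot>\<^bsub>V\<^esub> v) = c \<odot>\<^bsub>W\<^esub> (f v \<ominus>\<^bsub>W\<^esub> g v)"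
    if "c \<in> carrier K" "v \<in> carrier V" for c v
    using that by (simp add: a_minus_def W.smult_r_distr W.smult_r_minus)
qed

lemma linear_map_inj_onI:
  assumes f: "linear_map K V W f"
    and ker: "\<And>v. v \<in> carrier V \<Longrightarrow> f v = \<zero>\<^bsub>W\<^esub> \<Longrightarrow> v = \<zero>\<^bsub>V\<^esub>"
  shows "inj_on f (carrier V)"
proof (rule inj_onI)
  interpret V: vectorspace K V by (rule linear_mapD(1)[OF f])
  interpret W: vectorspace K W by (rule linear_mapD(2)[OF f])
  fix x y assume xy: "x \<in> carrier V" "y \<in> carrier V" and "f x = f y"
  then have "f (x \<ominus>\<^bsub>V\<^esub> y) = \<zero>\<^bsub>W\<^esub>"
    using linear_mapD(3,7)[OF f] by (simp add: a_minus_def W.M.r_neg)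
  then have "x \<ominus>\<^bsub>V\<^esub> y = \<zero>\<^bsub>V\<^esub>" using ker xy by simp
  then show "x = y" using xy by simp
qed

lemma linear_iso_inv:
  assumes "linear_iso K V W f"
  shows "linear_iso K W V (inv_into (carrier V) f)"
proof -
  have f: "linear_map K V W f" and b: "bij_betw f (carrier V) (carrier W)"
    using assms by (simp_all add: linear_iso_def)
  interpret V: vectorspace K V by (rule linear_mapD(1)[OF f])
  let ?g = "inv_into (carrier V) f"
  have g: "?g w \<in> carrier V" "f (?g w) = w" if "w \<in> carrier W" for w
    using b that by (auto simp: bij_betw_def inv_into_into f_inv_into_f)
  have gf: "?g w = v" if "v \<in> carrier V" "f v = w" for v w
    using b that by (auto simp: bij_betw_def)
  have "linear_map K W V ?g"
    by (rule linear_mapI[OF linear_mapD(2,1)[OF f]])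
       (auto intro!: gf simp: g linear_mapD(4,5)[OF f])
  then show ?thesis using bij_betw_inv_into[OF b] by (simp add: linear_iso_def)
qed

lemma linear_map_zero_on_span:
  assumes f: "linear_map K V W f" and X: "X \<subseteq> carrier V" and span: "module.span K V X = carrier V"
    and zero: "\<And>x. x \<in> X \<Longrightarrow> f x = \<zero>\<^bsub>W\<^esub>" and v: "v \<in> carrier V"
  shows "f v = \<zero>\<^bsub>W\<^esub>"
proof -
  interpret V: vectorspace K V by (rule linear_mapD(1)[OF f])
  interpret f: linear_map K V W f by (rule f)
  have "X \<subseteq> f.ker" using X zero by (auto simp: f.ker_def)
  then have "module.span K V X \<subseteq> f.ker"
    by (rule V.span_is_subset[OF _ f.ker_is_submodule])
  then show ?thesis using v span by (auto simp: f.ker_def)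
qed

text \<open>The universal property of the quotient: the value on a coset is read off from a chosen
  representative, and two representatives differ by an element of the kernel.\<close>
lemma quotient_lift_ex:
  assumes N: "subspace K N V" and f: "linear_map K V U f"
    and zero: "\<And>n. n \<in> N \<Longrightarrow> f n = \<zero>\<^bsub>U\<^esub>"
  shows "\<exists>g. linear_map K (quotient_space V N) U g \<and> (\<forall>v\<in>carrier V. g (N +>\<^bsub>V\<^esub> v) = f v)"
proof -
  interpret V: vectorspace K V by (rule linear_mapD(1)[OF f])
  interpret U: vectorspace K U by (rule linear_mapD(2)[OF f])
  define g where "g X = f (SOME v. v \<in> carrier V \<and> N +>\<^bsub>V\<^esub> v = X)" for X
  have g: "g (N +>\<^bsub>V\<^esub> v) = f v" if v: "v \<in> carrier V" for v
  proof -
    let ?w = "SOME w. w \<in> carrier V \<and> N +>\<^bsub>V\<^esub> w = N +>\<^bsub>V\<^esub> v"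
    have w: "?w \<in> carrier V \<and> N +>\<^bsub>V\<^esub> ?w = N +>\<^bsub>V\<^esub> v"
      by (rule someI[of _ v]) (simp add: v)
    then have "?w \<ominus>\<^bsub>V\<^esub> v \<in> N" using coset_eq_iff[OF N] v by blast
    then have "f ?w \<ominus>\<^bsub>U\<^esub> f v = \<zero>\<^bsub>U\<^esub>" using linear_mapD(7)[OF f] zero w v by metis
    then show ?thesis using linear_mapD(3)[OF f] w v by (simp add: g_def)
  qed
  have rep: "\<exists>v\<in>carrier V. X = N +>\<^bsub>V\<^esub> v" if "X \<in> carrier (quotient_space V N)" for X
    using that by (auto simp: quotient_carrier[OF N])
  have "linear_map K (quotient_space V N) U g"
  proof (rule linear_mapI[OF quotient_vs[OF N] linear_mapD(2)[OF f]])
    fix X assume "X \<in> carrier (quotient_space V N)"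
    then obtain v where v: "v \<in> carrier V" "X = N +>\<^bsub>V\<^esub> v" using rep by blast
    then show "g X \<in> carrier U" by (simp add: g linear_mapD(3)[OF f])
    fix c assume "c \<in> carrier K"
    then show "g (c \<odot>\<^bsub>quotient_space V N\<^esub> X) = c \<odot>\<^bsub>U\<^esub> g X"
      using v by (simp add: coset_smult[OF N] g linear_mapD(5)[OF f])
  next
    fix X Y assume "X \<in> carrier (quotient_space V N)" "Y \<in> carrier (quotient_space V N)"
    then obtain v w where "v \<in> carrier V" "X = N +>\<^bsub>V\<^esub> v" "w \<in> carrier V" "Y = N +>\<^bsub>V\<^esub> w"
      using rep by metis
    then show "g (X \<oplus>\<^bsub>quotient_space V N\<^esub> Y) = g X \<oplus>\<^bsub>U\<^esub> g Y"
      by (simp add: coset_add[OF N] g linear_mapD(4)[OF f])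
  qed
  then show ?thesis using g by blast
qed

lemma bilinearI:
  assumes "\<And>u. u \<in> carrier U \<Longrightarrow> linear_map K V W (f u)"
    and "\<And>v. v \<in> carrier V \<Longrightarrow> linear_map K U W (\<lambda>u. f u v)"
  shows "bilinear K U V W f"
  using assms by (simp add: bilinear_def)

lemma bilinearD:
  assumes "bilinear K U V W f"
  shows "u \<in> carrier U \<Longrightarrow> linear_map K V W (f u)"
    and "v \<in> carrier V \<Longrightarrow> linear_map K U W (\<lambda>u. f u v)"
    and "u \<in> carrier U \<Longrightarrow> v \<in> carrier V \<Longrightarrow> f u v \<in> carrier W"
proof -
  show 1: "u \<in> carrier U \<Longrightarrow> linear_map K V W (f u)" for u
    using assms by (simp add: bilinear_def)
  show "v \<in> carrier V \<Longrightarrow> linear_map K U W (\<lambda>u. f u v)"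
    using assms by (simp add: bilinear_def)
  show "u \<in> carrier U \<Longrightarrow> v \<in> carrier V \<Longrightarrow> f u v \<in> carrier W"
    by (rule linear_mapD(3)[OF 1])
qed

lemma bilinear_comp:
  assumes g: "linear_map K W X g" and f: "bilinear K U V W f"
  shows "bilinear K U V X (\<lambda>u v. g (f u v))"
  by (rule bilinearI) (rule linear_map_comp[OF g], erule bilinearD[OF f])+

lemma bilinear_pull:
  assumes f: "bilinear K U V W f" and g: "linear_map K U' U g" and h: "linear_map K V' V h"
  shows "bilinear K U' V' W (\<lambda>u v. f (g u) (h v))"
proof (rule bilinearI)
  show "linear_map K V' W (\<lambda>v. f (g u) (h v))" if "u \<in> carrier U'" for u
    by (rule linear_map_comp[OF bilinearD(1)[OF f] h]) (rule linear_mapD(3)[OF g that])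
  show "linear_map K U' W (\<lambda>u. f (g u) (h v))" if "v \<in> carrier V'" for v
    by (rule linear_map_comp[OF bilinearD(2)[OF f] g]) (rule linear_mapD(3)[OF h that])
qed

lemma bilinear_cong:
  assumes f: "bilinear K U V W f"
    and eq: "\<And>u v. u \<in> carrier U \<Longrightarrow> v \<in> carrier V \<Longrightarrow> f u v = g u v"
  shows "bilinear K U V W g"
proof (rule bilinearI)
  show "linear_map K V W (g u)" if "u \<in> carrier U" for u
    by (rule linear_map_cong[OF bilinearD(1)[OF f that] eq[OF that]])
  show "linear_map K U W (\<lambda>u. g u v)" if "v \<in> carrier V" for v
    by (rule linear_map_cong[OF bilinearD(2)[OF f that] eq[OF _ that]])
qed

lemma bilinear_restrict:
  "bilinear K U V W f \<Longrightarrow> bilinear K U V W (\<lambda>u\<in>carrier U. \<lambda>v\<in>carrier V. f u v)"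
  by (erule bilinear_cong) simp

lemma bilinear_diff:
  assumes "bilinear K U V W f" and "bilinear K U V W g"
  shows "bilinear K U V W (\<lambda>u v. f u v \<ominus>\<^bsub>W\<^esub> g u v)"
  using bilinearD(1,2)[OF assms(1)] bilinearD(1,2)[OF assms(2)]
  by (intro bilinearI linear_map_diff)

lemma bilinear_add:
  assumes "bilinear K U V W f" and "bilinear K U V W g"
  shows "bilinear K U V W (\<lambda>u v. f u v \<oplus>\<^bsub>W\<^esub> g u v)"
  using bilinearD(1,2)[OF assms(1)] bilinearD(1,2)[OF assms(2)]
  by (intro bilinearI linear_map_add)

section \<open>Bases and coordinates\<close>

text \<open>A maximal linearly independent subset of \<open>G\<close> exists by Zorn's lemma, because linear dependence
  is witnessed by finitely many vectors. Each further element of \<open>G\<close> is dependent on it.\<close>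
lemma (in vectorspace) generating_set_contains_basis:
  assumes G: "G \<subseteq> carrier V" and gen: "span G = carrier V"
  shows "\<exists>B\<subseteq>G. basis B"
proof -
  have "\<exists>M\<in>{S. S \<subseteq> G \<and> lin_indpt S}. \<forall>X\<in>{S. S \<subseteq> G \<and> lin_indpt S}. M \<subseteq> X \<longrightarrow> X = M"
  proof (rule subset_Zorn')
    fix C assume C: "subset.chain {S. S \<subseteq> G \<and> lin_indpt S} C"
    then have CG: "S \<subseteq> G" "lin_indpt S" if "S \<in> C" for S
      using that by (auto simp: subset.chain_def)
    have "lin_indpt (\<Union>C)"
    proof
      assume "lin_dep (\<Union>C)"
      then obtain X a v where X: "finite X" "X \<subseteq> \<Union>C" "a \<in> X \<rightarrow> carrier K"
        "lincomb a X = \<zero>\<^bsub>V\<^esub>" "v \<in> X" "a v \<noteq> \<zero>\<^bsub>K\<^esub>"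
        by (auto simp: lin_dep_def)
      then have "C \<noteq> {}" by auto
      then obtain S where "S \<in> C" "X \<subseteq> S"
        using finite_subset_Union_chain[OF X(1,2) _ C] by blast
      then show False using X CG(2)[of S] by (auto simp: lin_dep_def)
    qed
    then show "\<Union>C \<in> {S. S \<subseteq> G \<and> lin_indpt S}" using CG by auto
  qed
  then obtain M where M: "M \<subseteq> G" "lin_indpt M"
    and max: "\<And>X. X \<subseteq> G \<Longrightarrow> lin_indpt X \<Longrightarrow> M \<subseteq> X \<Longrightarrow> X = M"
    by auto
  have MV: "M \<subseteq> carrier V" using M G by auto
  have "g \<in> span M" if g: "g \<in> G" for g
  proof (cases "g \<in> M")
    case True then show ?thesis using in_own_span[OF MV] by auto
  next
    case False
    then have "lin_dep (M \<union> {g})" using max[of "M \<union> {g}"] M g by auto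
    then show ?thesis using lin_dep_iff_in_span[OF MV M(2) _ False] g G by auto
  qed
  then have "span G \<subseteq> span M"
    by (intro span_is_subset[OF _ span_is_submodule[OF MV]]) auto
  then show ?thesis
    using M MV gen span_is_subset2[OF MV] by (intro exI[of _ M]) (auto simp: basis_def)
qed

text \<open>A basis \<open>B\<close> with its dual coordinate functionals. The expansion is stated for every finite set
  containing the support, so that the expansions of several vectors can be taken over one set.\<close>
locale coordinates = vectorspace K A
  for K :: "('k, 'e) ring_scheme" and A :: "('k, 'a, 'n) module_scheme" +
  fixes B :: "'a set" and \<xi> :: "'a \<Rightarrow> 'a \<Rightarrow> 'k"
  assumes basis_closed: "B \<subseteq> carrier A"
    and coord_closed: "\<lbrakk>b \<in> B; a \<in> carrier A\<rbrakk> \<Longrightarrow> \<xi> b a \<in> carrier K"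
    and coord_add: "\<lbrakk>b \<in> B; a \<in> carrier A; a' \<in> carrier A\<rbrakk> \<Longrightarrow> \<xi> b (a \<oplus>\<^bsub>A\<^esub> a') = \<xi> b a \<oplus>\<^bsub>K\<^esub> \<xi> b a'"
    and coord_smult: "\<lbrakk>b \<in> B; c \<in> carrier K; a \<in> carrier A\<rbrakk> \<Longrightarrow> \<xi> b (c \<odot>\<^bsub>A\<^esub> a) = c \<otimes>\<^bsub>K\<^esub> \<xi> b a"
    and coord_basis: "\<lbrakk>b \<in> B; b' \<in> B\<rbrakk> \<Longrightarrow> \<xi> b b' = (if b' = b then \<one>\<^bsub>K\<^esub> else \<zero>\<^bsub>K\<^esub>)"
    and coord_finite: "a \<in> carrier A \<Longrightarrow> finite {b \<in> B. \<xi> b a \<noteq> \<zero>\<^bsub>K\<^esub>}"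
    and coord_expand: "\<lbrakk>a \<in> carrier A; finite Y; Y \<subseteq> B; {b \<in> B. \<xi> b a \<noteq> \<zero>\<^bsub>K\<^esub>} \<subseteq> Y\<rbrakk> \<Longrightarrow>
      a = (\<Oplus>\<^bsub>A\<^esub>b\<in>Y. \<xi> b a \<odot>\<^bsub>A\<^esub> b)"

text \<open>Inverting this isomorphism turns a vector into its finitely supported coefficient family, which is
  how the coordinate functionals of an arbitrary basis are obtained.\<close>
lemma (in vectorspace) free_space_on_basis_iso:
  assumes B: "basis B"
  shows "\<exists>\<phi>. linear_iso K (free_space K B) V \<phi> \<and> (\<forall>b\<in>B. \<phi> (free_gen K B b) = b) \<and>
    (\<forall>f\<in>carrier (free_space K B). \<forall>Y. finite Y \<and> Y \<subseteq> B \<and> {b \<in> B. f b \<noteq> \<zero>\<^bsub>K\<^esub>} \<subseteq> Y \<longrightarrow>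
      \<phi> f = lincomb f Y)"
proof -
  have fld: "field K" by (rule field_axioms)
  have vs: "vectorspace K V" by unfold_locales
  have BV: "B \<subseteq> carrier V" and li: "lin_indpt B" and gen: "span B = carrier V"
    using B by (auto simp: basis_def)
  interpret F: vectorspace K "free_space K B" by (rule free_vs[OF fld])
  obtain \<phi> where \<phi>: "linear_map K (free_space K B) V \<phi>"
    and \<phi>g: "\<And>b. b \<in> B \<Longrightarrow> \<phi> (free_gen K B b) = b"
    using free_lift_ex[OF fld vs, of B "\<lambda>b. b"] BV by auto
  have fc: "f b \<in> carrier K" if "f \<in> carrier (free_space K B)" "b \<in> B" for f b
    using that by (auto simp: free_simps[OF fld])
  have neutral: "lincomb f X = lincomb f Y"
    if "f \<in> carrier (free_space K B)" "finite Y" "Y \<subseteq> B" "X \<subseteq> Y" "{b \<in> B. f b \<noteq> \<zero>\<^bsub>K\<^esub>} \<subseteq> X" for f X Y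
  proof -
    have "f b \<odot>\<^bsub>V\<^esub> b = \<zero>\<^bsub>V\<^esub>" if "b \<in> Y - X" for b
    proof -
      have "b \<in> carrier V" "f b = \<zero>\<^bsub>K\<^esub>" using that \<open>Y \<subseteq> B\<close> \<open>_ \<subseteq> X\<close> BV by auto
      then show ?thesis by simp
    qed
    moreover have "(\<lambda>b. f b \<odot>\<^bsub>V\<^esub> b) \<in> Y \<rightarrow> carrier V"
      using \<open>Y \<subseteq> B\<close> BV fc[OF that(1)] by auto
    ultimately show ?thesis
      unfolding lincomb_def using that(2,4)
      by (intro M.add.finprod_mono_neutral_cong_left) simp_all
  qed
  \<comment> \<open>The support of \<open>f\<close> does not grow monotonically along the induction, because of cancellation.
    So the expansion is first shown over all sufficiently large index sets, then over the support.\<close>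
  have large: "\<exists>Y0. finite Y0 \<and> Y0 \<subseteq> B \<and> (\<forall>Y. finite Y \<and> Y \<subseteq> B \<and> Y0 \<subseteq> Y \<longrightarrow> \<phi> f = lincomb f Y)"
    if "f \<in> carrier (free_space K B)" for f
    using that
  proof (induction f rule: free_induct[OF fld, consumes 1, case_names zero step])
    case zero
    have "lincomb \<zero>\<^bsub>free_space K B\<^esub> Y = \<zero>\<^bsub>V\<^esub>" if "Y \<subseteq> B" for Y
      unfolding lincomb_def using that BV
      by (intro M.add.finprod_one_eqI) (auto simp: free_simps[OF fld] subset_iff)
    then show ?case using linear_mapD(6)[OF \<phi>] by (intro exI[of _ "{}"]) simp
  next
    case (step c s f)
    from step(4) obtain Y0 where Y0: "finite Y0" "Y0 \<subseteq> B"
      and Y0': "\<forall>Y. finite Y \<and> Y \<subseteq> B \<and> Y0 \<subseteq> Y \<longrightarrow> \<phi> f = lincomb f Y"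
      by (elim exE conjE) (rule that)
    have gs: "free_gen K B s \<in> carrier (free_space K B)" using step(2) by (rule free_gen_closed[OF fld])
    let ?g = "f \<oplus>\<^bsub>free_space K B\<^esub> c \<odot>\<^bsub>free_space K B\<^esub> free_gen K B s"
    have "\<phi> ?g = lincomb ?g Y" if Y: "finite Y" "Y \<subseteq> B" "insert s Y0 \<subseteq> Y" for Y
    proof -
      have YV: "Y \<subseteq> carrier V" using Y BV by auto
      have "lincomb ?g Y = (\<Oplus>\<^bsub>V\<^esub>b\<in>Y. f b \<odot>\<^bsub>V\<^esub> b \<oplus>\<^bsub>V\<^esub> (if s = b then c \<odot>\<^bsub>V\<^esub> b else \<zero>\<^bsub>V\<^esub>))"
        unfolding lincomb_def using Y YV step(1,2) fc[OF step(3)] gs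
        by (intro M.finsum_cong')
           (auto simp: free_simps[OF fld] free_gen_def subset_iff smult_l_distr)
      also have "\<dots> = lincomb f Y \<oplus>\<^bsub>V\<^esub> (\<Oplus>\<^bsub>V\<^esub>b\<in>Y. if s = b then c \<odot>\<^bsub>V\<^esub> b else \<zero>\<^bsub>V\<^esub>)"
        unfolding lincomb_def using Y YV step(1) fc[OF step(3)]
        by (intro M.finsum_addf) (auto simp: subset_iff)
      also have "(\<Oplus>\<^bsub>V\<^esub>b\<in>Y. if s = b then c \<odot>\<^bsub>V\<^esub> b else \<zero>\<^bsub>V\<^esub>) = c \<odot>\<^bsub>V\<^esub> s"
        using Y YV step(1) by (intro M.finsum_singleton) auto
      also have "lincomb f Y \<oplus>\<^bsub>V\<^esub> c \<odot>\<^bsub>V\<^esub> s = \<phi> ?g"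
        using Y Y0'[rule_format, of Y] step(1-3) gs \<phi>g by (simp add: linear_mapD(4,5)[OF \<phi>])
      finally show ?thesis by simp
    qed
    then show ?case using Y0 step(2) by (intro exI[of _ "insert s Y0"]) auto
  qed
  have exp: "\<phi> f = lincomb f Y"
    if "f \<in> carrier (free_space K B)" "finite Y" "Y \<subseteq> B" "{b \<in> B. f b \<noteq> \<zero>\<^bsub>K\<^esub>} \<subseteq> Y" for f Y
  proof -
    from large[OF that(1)] obtain Y0 where "finite Y0" "Y0 \<subseteq> B"
      and "\<forall>Y. finite Y \<and> Y \<subseteq> B \<and> Y0 \<subseteq> Y \<longrightarrow> \<phi> f = lincomb f Y"
      by (elim exE conjE) (rule that)
    then show ?thesis using neutral[OF that(1), of "Y \<union> Y0" Y] that by simp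
  qed
  have "inj_on \<phi> (carrier (free_space K B))"
  proof (rule linear_map_inj_onI[OF \<phi>])
    fix f assume f: "f \<in> carrier (free_space K B)" "\<phi> f = \<zero>\<^bsub>V\<^esub>"
    let ?Y = "{b \<in> B. f b \<noteq> \<zero>\<^bsub>K\<^esub>}"
    have Y: "finite ?Y" "?Y \<subseteq> B" using f by (auto simp: free_simps[OF fld])
    have "f \<in> ?Y \<rightarrow> {\<zero>\<^bsub>K\<^esub>}"
      using not_lindepD[OF li Y, of f] exp[OF f(1) Y] f fc by auto
    then have "f b = \<zero>\<^bsub>K\<^esub>" if "b \<in> B" for b using that by auto
    then show "f = \<zero>\<^bsub>free_space K B\<^esub>" using f(1) by (auto simp: free_simps[OF fld] intro!: ext)
  qed
  moreover have "\<phi> ` carrier (free_space K B) = carrier V"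
  proof
    show "\<phi> ` carrier (free_space K B) \<subseteq> carrier V" using linear_mapD(3)[OF \<phi>] by auto
    show "carrier V \<subseteq> \<phi> ` carrier (free_space K B)"
    proof
      fix v assume "v \<in> carrier V"
      then have "v \<in> span B" using gen by simp
      then obtain a X where X: "finite X" "X \<subseteq> B" "a \<in> X \<rightarrow> carrier K" "v = lincomb a X"
        unfolding span_def by blast
      define f where "f = (\<lambda>b\<in>B. if b \<in> X then a b else \<zero>\<^bsub>K\<^esub>)"
      have "{b \<in> B. f b \<noteq> \<zero>\<^bsub>K\<^esub>} \<subseteq> X" by (auto simp: f_def split: if_splits)
      moreover from this have "f \<in> carrier (free_space K B)"
      proof -
        have "finite {b \<in> B. f b \<noteq> \<zero>\<^bsub>K\<^esub>}" using finite_subset[OF \<open>_ \<subseteq> X\<close> X(1)] .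
        moreover have "f \<in> B \<rightarrow>\<^sub>E carrier K" using X(3) by (auto simp: f_def)
        ultimately show ?thesis by (simp add: free_simps[OF fld])
      qed
      moreover have "lincomb f X = v"
        unfolding X(4) lincomb_def using X BV by (intro M.finsum_cong') (auto simp: f_def)
      ultimately show "v \<in> \<phi> ` carrier (free_space K B)" using exp[of f X] X(1,2) by (intro image_eqI[where x = f]) simp_all
    qed
  qed
  ultimately have "linear_iso K (free_space K B) V \<phi>"
    using \<phi> by (simp add: linear_iso_def bij_betw_def)
  then show ?thesis using \<phi>g exp by blast
qed

lemma coordinates_ex:
  assumes vs: "vectorspace K A"
  shows "\<exists>B \<xi>. coordinates K A B \<xi> \<and> (vectorspace.fin_dim K A \<longrightarrow> finite B)"
proof -
  interpret vectorspace K A by (rule vs)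
  have fld: "field K" by (rule field_axioms)
  have "span (carrier A) = carrier A"
    using in_own_span[of "carrier A"] span_is_subset2[of "carrier A"] by auto
  then obtain B where B: "basis B" using generating_set_contains_basis[of "carrier A"] by auto
  then have BV: "B \<subseteq> carrier A" and li: "lin_indpt B" by (auto simp: basis_def)
  from free_space_on_basis_iso[OF B] obtain \<phi> where iso: "linear_iso K (free_space K B) A \<phi>"
    and gen: "\<forall>b\<in>B. \<phi> (free_gen K B b) = b"
    and exp: "\<forall>f\<in>carrier (free_space K B). \<forall>Y. finite Y \<and> Y \<subseteq> B \<and> {b \<in> B. f b \<noteq> \<zero>\<^bsub>K\<^esub>} \<subseteq> Y \<longrightarrow>
      \<phi> f = lincomb f Y"
    by (elim exE conjE) (rule that)
  define \<psi> where "\<psi> = inv_into (carrier (free_space K B)) \<phi>"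
  have \<psi>: "linear_map K A (free_space K B) \<psi>"
    using linear_iso_inv[OF iso] by (simp add: \<psi>_def linear_iso_def)
  have bij: "bij_betw \<phi> (carrier (free_space K B)) (carrier A)"
    using iso by (simp add: linear_iso_def)
  have \<phi>\<psi>: "\<phi> (\<psi> a) = a" if "a \<in> carrier A" for a
    using bij that by (auto simp: \<psi>_def bij_betw_def f_inv_into_f)
  have \<psi>b: "\<psi> b = free_gen K B b" if "b \<in> B" for b
    using bij free_gen_closed[OF fld that] gen that
    by (metis \<psi>_def bij_betw_def inv_into_f_f)
  have c: "\<psi> a \<in> carrier (free_space K B)" if "a \<in> carrier A" for a
    using linear_mapD(3)[OF \<psi> that] .
  have "coordinates K A B (\<lambda>b a. \<psi> a b)"
  proof (unfold_locales, goal_cases)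
    case 1 show ?case by (rule BV)
  next
    case (2 b a) then show ?case using c by (auto simp: free_simps[OF fld])
  next
    case (3 b a a') then show ?case
      using linear_mapD(4)[OF \<psi>] by (simp add: free_simps[OF fld])
  next
    case (4 b c a) then show ?case
      using linear_mapD(5)[OF \<psi>] by (simp add: free_simps[OF fld])
  next
    case (5 b b') then show ?case by (auto simp: \<psi>b free_gen_def)
  next
    case (6 a) then show ?case using c by (auto simp: free_simps[OF fld])
  next
    case (7 a Y) then show ?case using exp[rule_format, OF c, of a Y] \<phi>\<psi>[of a] by (simp add: lincomb_def)
  qed
  then show ?thesis using fin_dim_li_fin[OF _ li BV] by blast
qed

section \<open>Maps on tensor products\<close>

lemma pure_linear:
  assumes "vectorspace K V" "vectorspace K W"
  shows "v \<in> carrier V \<Longrightarrow> linear_map K W (tensor K V W) (pure_tensor K V W v)"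
    and "w \<in> carrier W \<Longrightarrow> linear_map K V (tensor K V W) (\<lambda>v. pure_tensor K V W v w)"
  using bilinearD[OF pure_bilinear[OF assms]] by blast+

lemma tensor_map_ex:
  assumes f: "linear_map K V V' f" and g: "linear_map K W W' g"
  shows "\<exists>h. linear_map K (tensor K V W) (tensor K V' W') h \<and>
    (\<forall>v\<in>carrier V. \<forall>w\<in>carrier W. h (pure_tensor K V W v w) = pure_tensor K V' W' (f v) (g w))"
  by (rule tensor_lift_ex[OF linear_mapD(1)[OF f] linear_mapD(1)[OF g]
        tensor_vs[OF linear_mapD(2)[OF f] linear_mapD(2)[OF g]]])
     (rule bilinear_pull[OF pure_bilinear[OF linear_mapD(2)[OF f] linear_mapD(2)[OF g]] f g])

text \<open>A map that is bilinear in each of its two pairs of arguments factors through the tensor products.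
  The universal property is applied first to the second pair and then to the first; uniqueness of the
  lift gives linearity in the parameters that are held fixed.\<close>
lemma tensor_bilinear_lift_ex:
  assumes V: "vectorspace K V" and W: "vectorspace K W" and U: "vectorspace K U"
    and l: "\<And>x a. x \<in> carrier V \<Longrightarrow> a \<in> carrier W \<Longrightarrow> bilinear K V W U (m x a)"
    and r: "\<And>y b. y \<in> carrier V \<Longrightarrow> b \<in> carrier W \<Longrightarrow> bilinear K V W U (\<lambda>x a. m x a y b)"
  shows "\<exists>F. bilinear K (tensor K V W) (tensor K V W) U F \<and>
    (\<forall>x\<in>carrier V. \<forall>a\<in>carrier W. \<forall>y\<in>carrier V. \<forall>b\<in>carrier W.
      F (pure_tensor K V W x a) (pure_tensor K V W y b) = m x a y b)"
proof -
  let ?T = "tensor K V W" and ?p = "pure_tensor K V W"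
  interpret V: vectorspace K V by (rule V)
  interpret W: vectorspace K W by (rule W)
  interpret U: vectorspace K U by (rule U)
  note T = tensor_vs[OF V W]
  interpret T: vectorspace K ?T by (rule T)
  have "\<exists>\<phi>. linear_map K ?T U \<phi> \<and> (\<forall>y\<in>carrier V. \<forall>b\<in>carrier W. \<phi> (?p y b) = m x a y b)"
    if "x \<in> carrier V" "a \<in> carrier W" for x a
    by (rule tensor_lift_ex[OF V W U l[OF that]])
  then obtain n where n: "\<And>x a. x \<in> carrier V \<Longrightarrow> a \<in> carrier W \<Longrightarrow> linear_map K ?T U (n x a)"
    and np: "\<And>x a y b. x \<in> carrier V \<Longrightarrow> a \<in> carrier W \<Longrightarrow> y \<in> carrier V \<Longrightarrow> b \<in> carrier W \<Longrightarrow>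
      n x a (?p y b) = m x a y b"
    by metis
  have r1: "linear_map K V U (\<lambda>x. m x a y b)" if "a \<in> carrier W" "y \<in> carrier V" "b \<in> carrier W" for a y b
    using bilinearD(2)[OF r] that by blast
  have r2: "linear_map K W U (\<lambda>a. m x a y b)" if "x \<in> carrier V" "y \<in> carrier V" "b \<in> carrier W" for x y b
    using bilinearD(1)[OF r] that by blast
  have nb: "bilinear K V W U (\<lambda>x a. n x a t)" if t: "t \<in> carrier ?T" for t
    unfolding bilinear_def
  proof (intro conjI ballI)
    fix x assume x: "x \<in> carrier V"
    show "linear_map K W U (\<lambda>a. n x a t)"
    proof (rule linear_mapI[OF W U])
      show "n x a t \<in> carrier U" if "a \<in> carrier W" for a
        using linear_mapD(3)[OF n[OF x that] t] .
      show "n x (a \<oplus>\<^bsub>W\<^esub> a') t = n x a t \<oplus>\<^bsub>U\<^esub> n x a' t" if "a \<in> carrier W" "a' \<in> carrier W" for a a'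
        by (rule tensor_linear_eq[OF V W n linear_map_add[OF n n] _ t])
           (use x that in \<open>simp_all add: np linear_mapD(4)[OF r2]\<close>)
      show "n x (c \<odot>\<^bsub>W\<^esub> a) t = c \<odot>\<^bsub>U\<^esub> n x a t" if "c \<in> carrier K" "a \<in> carrier W" for c a
        by (rule tensor_linear_eq[OF V W n linear_map_smult[OF n] _ t])
           (use x that in \<open>simp_all add: np linear_mapD(5)[OF r2]\<close>)
    qed
  next
    fix a assume a: "a \<in> carrier W"
    show "linear_map K V U (\<lambda>x. n x a t)"
    proof (rule linear_mapI[OF V U])
      show "n x a t \<in> carrier U" if "x \<in> carrier V" for x
        using linear_mapD(3)[OF n[OF that a] t] .
      show "n (x \<oplus>\<^bsub>V\<^esub> x') a t = n x a t \<oplus>\<^bsub>U\<^esub> n x' a t" if "x \<in> carrier V" "x' \<in> carrier V" for x x'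
        by (rule tensor_linear_eq[OF V W n linear_map_add[OF n n] _ t])
           (use a that in \<open>simp_all add: np linear_mapD(4)[OF r1]\<close>)
      show "n (c \<odot>\<^bsub>V\<^esub> x) a t = c \<odot>\<^bsub>U\<^esub> n x a t" if "c \<in> carrier K" "x \<in> carrier V" for c x
        by (rule tensor_linear_eq[OF V W n linear_map_smult[OF n] _ t])
           (use a that in \<open>simp_all add: np linear_mapD(5)[OF r1]\<close>)
    qed
  qed
  have "\<exists>\<phi>. linear_map K ?T U \<phi> \<and> (\<forall>x\<in>carrier V. \<forall>a\<in>carrier W. \<phi> (?p x a) = n x a t)"
    if "t \<in> carrier ?T" for t
    by (rule tensor_lift_ex[OF V W U nb[OF that]])
  then obtain F where F: "\<And>t. t \<in> carrier ?T \<Longrightarrow> linear_map K ?T U (F t)"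
    and Fp: "\<And>t x a. t \<in> carrier ?T \<Longrightarrow> x \<in> carrier V \<Longrightarrow> a \<in> carrier W \<Longrightarrow> F t (?p x a) = n x a t"
    by metis
  have "linear_map K ?T U (\<lambda>t. F t s)" if s: "s \<in> carrier ?T" for s
  proof (rule linear_mapI[OF T U])
    show "F t s \<in> carrier U" if "t \<in> carrier ?T" for t
      using linear_mapD(3)[OF F[OF that] s] .
    show "F (t \<oplus>\<^bsub>?T\<^esub> t') s = F t s \<oplus>\<^bsub>U\<^esub> F t' s" if "t \<in> carrier ?T" "t' \<in> carrier ?T" for t t'
      by (rule tensor_linear_eq[OF V W F linear_map_add[OF F F] _ s])
         (use that in \<open>simp_all add: Fp linear_mapD(4)[OF n]\<close>)
    show "F (c \<odot>\<^bsub>?T\<^esub> t) s = c \<odot>\<^bsub>U\<^esub> F t s" if "c \<in> carrier K" "t \<in> carrier ?T" for c t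
      by (rule tensor_linear_eq[OF V W F linear_map_smult[OF F] _ s])
         (use that in \<open>simp_all add: Fp linear_mapD(5)[OF n]\<close>)
  qed
  then have "bilinear K ?T ?T U (\<lambda>s t. F t s)" using F by (simp add: bilinear_def)
  then show ?thesis
    by (intro exI[of _ "\<lambda>s t. F t s"]) (simp add: Fp np pure_closed[OF V W])
qed

section \<open>Coordinates on a tensor product\<close>

context coordinates
begin

text \<open>The map \<open>id \<otimes> \<xi> b\<close> from \<open>V \<otimes> A\<close> to \<open>V \<otimes> K = V\<close>.\<close>
definition tensor_coord :: "('k, 'v, 'm) module_scheme \<Rightarrow> 'a \<Rightarrow> ('v \<times> 'a \<Rightarrow> 'k) set \<Rightarrow> 'v"
  where "tensor_coord V b = (SOME \<kappa>. linear_map K (tensor K V A) V \<kappa> \<and>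
    (\<forall>v\<in>carrier V. \<forall>a\<in>carrier A. \<kappa> (pure_tensor K V A v a) = \<xi> b a \<odot>\<^bsub>V\<^esub> v))"

lemma vs_A: "vectorspace K A"
  by unfold_locales

lemma
  assumes V: "vectorspace K V" and b: "b \<in> B"
  shows tensor_coord_linear: "linear_map K (tensor K V A) V (tensor_coord V b)"
    and tensor_coord_pure: "v \<in> carrier V \<Longrightarrow> a \<in> carrier A \<Longrightarrow>
      tensor_coord V b (pure_tensor K V A v a) = \<xi> b a \<odot>\<^bsub>V\<^esub> v"
proof -
  interpret V: vectorspace K V by (rule V)
  have "bilinear K V A V (\<lambda>v a. \<xi> b a \<odot>\<^bsub>V\<^esub> v)"
    unfolding bilinear_def using b R.m_comm
    by (auto intro!: linear_mapI V vs_A simp: coord_closed coord_add coord_smult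
        V.smult_l_distr V.smult_r_distr V.smult_assoc1[symmetric])
  from someI_ex[OF tensor_lift_ex[OF V vs_A V this]]
  have *: "linear_map K (tensor K V A) V (tensor_coord V b) \<and>
    (\<forall>v\<in>carrier V. \<forall>a\<in>carrier A. tensor_coord V b (pure_tensor K V A v a) = \<xi> b a \<odot>\<^bsub>V\<^esub> v)"
    unfolding tensor_coord_def .
  then show "linear_map K (tensor K V A) V (tensor_coord V b)"
    and "v \<in> carrier V \<Longrightarrow> a \<in> carrier A \<Longrightarrow>
      tensor_coord V b (pure_tensor K V A v a) = \<xi> b a \<odot>\<^bsub>V\<^esub> v"
    by auto
qed

lemma tensor_coord_finite:
  assumes V: "vectorspace K V" and t: "t \<in> carrier (tensor K V A)"
  shows "finite {b \<in> B. tensor_coord V b t \<noteq> \<zero>\<^bsub>V\<^esub>}"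
  using t
proof (induction t rule: tensor_induct[OF V vs_A, consumes 1, case_names pure add])
  interpret V: vectorspace K V by (rule V)
  {
    case (pure v a)
    have "{b \<in> B. tensor_coord V b (pure_tensor K V A v a) \<noteq> \<zero>\<^bsub>V\<^esub>} \<subseteq> {b \<in> B. \<xi> b a \<noteq> \<zero>\<^bsub>K\<^esub>}"
      using pure by (auto simp: tensor_coord_pure[OF V])
    then show ?case using coord_finite[OF pure(2)] by (rule finite_subset)
  next
    case (add s t)
    have "{b \<in> B. tensor_coord V b (s \<oplus>\<^bsub>tensor K V A\<^esub> t) \<noteq> \<zero>\<^bsub>V\<^esub>} \<subseteq>
      {b \<in> B. tensor_coord V b s \<noteq> \<zero>\<^bsub>V\<^esub>} \<union> {b \<in> B. tensor_coord V b t \<noteq> \<zero>\<^bsub>V\<^esub>}"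
      using add(1,2) by (auto simp: linear_mapD(4)[OF tensor_coord_linear[OF V]])
    then show ?case using add by (auto intro: finite_subset)
  }
qed

text \<open>The sum ranges over an arbitrary large index set: the supports of two tensors and of their sum
  differ, and the induction needs a set that serves for all three.\<close>
lemma tensor_expand:
  assumes V: "vectorspace K V" and t: "t \<in> carrier (tensor K V A)"
  shows "\<exists>X. finite X \<and> X \<subseteq> B \<and> (\<forall>Y. finite Y \<and> X \<subseteq> Y \<and> Y \<subseteq> B \<longrightarrow>
    t = (\<Oplus>\<^bsub>tensor K V A\<^esub>b\<in>Y. pure_tensor K V A (tensor_coord V b t) b))"
  using t
proof (induction t rule: tensor_induct[OF V vs_A, consumes 1, case_names pure add])
  interpret V: vectorspace K V by (rule V)
  interpret T: vectorspace K "tensor K V A" by (rule tensor_vs[OF V vs_A])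
  {
    case (pure v a)
    let ?X = "{b \<in> B. \<xi> b a \<noteq> \<zero>\<^bsub>K\<^esub>}"
    have "pure_tensor K V A v a =
        (\<Oplus>\<^bsub>tensor K V A\<^esub>b\<in>Y. pure_tensor K V A (tensor_coord V b (pure_tensor K V A v a)) b)"
      if Y: "finite Y" "?X \<subseteq> Y" "Y \<subseteq> B" for Y
    proof -
      have YA: "Y \<subseteq> carrier A" using Y basis_closed by auto
      interpret p: linear_map K A "tensor K V A" "pure_tensor K V A v"
        by (rule pure_linear(1)[OF V vs_A pure(1)])
      have "pure_tensor K V A v a = pure_tensor K V A v (\<Oplus>\<^bsub>A\<^esub>b\<in>Y. \<xi> b a \<odot>\<^bsub>A\<^esub> b)"
        using coord_expand[OF pure(2) Y(1,3,2)] by simp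
      also have "\<dots> = (\<Oplus>\<^bsub>tensor K V A\<^esub>b\<in>Y. pure_tensor K V A v (\<xi> b a \<odot>\<^bsub>A\<^esub> b))"
        using YA Y(3) pure(2) coord_closed by (intro p.hom_sum) (auto simp: subset_iff)
      also have "\<dots> = (\<Oplus>\<^bsub>tensor K V A\<^esub>b\<in>Y. pure_tensor K V A (tensor_coord V b (pure_tensor K V A v a)) b)"
        using pure YA Y(3) coord_closed
        by (intro T.M.finsum_cong')
           (auto simp: tensor_coord_pure[OF V] subset_iff pure_closed[OF V vs_A]
             linear_mapD(5)[OF pure_linear(1)[OF V vs_A]] linear_mapD(5)[OF pure_linear(2)[OF V vs_A]])
      finally show ?thesis .
    qed
    then show ?case using coord_finite[OF pure(2)] by (intro exI[of _ ?X]) auto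
  next
    case (add s t)
    let ?e = "\<lambda>t Y. \<Oplus>\<^bsub>tensor K V A\<^esub>b\<in>Y. pure_tensor K V A (tensor_coord V b t) b"
    from add(3) obtain X where X: "finite X" "X \<subseteq> B"
      and Xs: "\<forall>Y. finite Y \<and> X \<subseteq> Y \<and> Y \<subseteq> B \<longrightarrow> s = ?e s Y"
      by (elim exE conjE) (rule that)
    from add(4) obtain X' where X': "finite X'" "X' \<subseteq> B"
      and Xt: "\<forall>Y. finite Y \<and> X' \<subseteq> Y \<and> Y \<subseteq> B \<longrightarrow> t = ?e t Y"
      by (elim exE conjE) (rule that)
    have "s \<oplus>\<^bsub>tensor K V A\<^esub> t = ?e (s \<oplus>\<^bsub>tensor K V A\<^esub> t) Y"
      if Y: "finite Y" "X \<union> X' \<subseteq> Y" "Y \<subseteq> B" for Y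
    proof -
      have Yb: "b \<in> B" "b \<in> carrier A" if "b \<in> Y" for b using that Y basis_closed by auto
      note c = linear_mapD(3,4)[OF tensor_coord_linear[OF V Yb(1)]]
      have "?e (s \<oplus>\<^bsub>tensor K V A\<^esub> t) Y = (\<Oplus>\<^bsub>tensor K V A\<^esub>b\<in>Y.
          pure_tensor K V A (tensor_coord V b s) b \<oplus>\<^bsub>tensor K V A\<^esub> pure_tensor K V A (tensor_coord V b t) b)"
        using add(1,2)
        by (intro T.M.finsum_cong')
           (simp_all add: c Yb pure_closed[OF V vs_A] linear_mapD(4)[OF pure_linear(2)[OF V vs_A]] Pi_def)
      also have "\<dots> = ?e s Y \<oplus>\<^bsub>tensor K V A\<^esub> ?e t Y"
        using add(1,2) by (intro T.M.finsum_addf) (simp_all add: c Yb pure_closed[OF V vs_A] Pi_def)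
      also have "\<dots> = s \<oplus>\<^bsub>tensor K V A\<^esub> t"
        using Xs[rule_format, of Y] Xt[rule_format, of Y] Y by simp
      finally show ?thesis by simp
    qed
    then show ?case using X X' by (intro exI[of _ "X \<union> X'"]) simp
  }
qed

lemma tensor_eq_zeroI:
  assumes V: "vectorspace K V" and t: "t \<in> carrier (tensor K V A)"
    and zero: "\<And>b. b \<in> B \<Longrightarrow> tensor_coord V b t = \<zero>\<^bsub>V\<^esub>"
  shows "t = \<zero>\<^bsub>tensor K V A\<^esub>"
proof -
  interpret T: vectorspace K "tensor K V A" by (rule tensor_vs[OF V vs_A])
  from tensor_expand[OF V t] obtain X where X: "finite X" "X \<subseteq> B" and
    e: "\<forall>Y. finite Y \<and> X \<subseteq> Y \<and> Y \<subseteq> B \<longrightarrow>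
      t = (\<Oplus>\<^bsub>tensor K V A\<^esub>b\<in>Y. pure_tensor K V A (tensor_coord V b t) b)"
    by (elim exE conjE) (rule that)
  have "t = (\<Oplus>\<^bsub>tensor K V A\<^esub>b\<in>X. pure_tensor K V A (tensor_coord V b t) b)"
    using e X by simp
  also have "\<dots> = (\<Oplus>\<^bsub>tensor K V A\<^esub>b\<in>X. \<zero>\<^bsub>tensor K V A\<^esub>)"
    using X basis_closed
    by (intro T.M.finsum_cong') (auto simp: zero subset_iff linear_mapD(6)[OF pure_linear(2)[OF V vs_A]])
  also have "\<dots> = \<zero>\<^bsub>tensor K V A\<^esub>" by (rule T.M.finsum_zero)
  finally show ?thesis .
qed

end

section \<open>The space of Poisson structures\<close>

lemma poisson_space_simps:
  "carrier (poisson_space K L) = poisson_structures K L"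
  "\<zero>\<^bsub>poisson_space K L\<^esub> = (\<lambda>x\<in>carrier L. \<lambda>y\<in>carrier L. \<zero>\<^bsub>L\<^esub>)"
  "f \<oplus>\<^bsub>poisson_space K L\<^esub> g = (\<lambda>x\<in>carrier L. \<lambda>y\<in>carrier L. f x y \<oplus>\<^bsub>L\<^esub> g x y)"
  "c \<odot>\<^bsub>poisson_space K L\<^esub> f = (\<lambda>x\<in>carrier L. \<lambda>y\<in>carrier L. c \<odot>\<^bsub>L\<^esub> f x y)"
  by (simp_all add: poisson_space_def)

context
  fixes K :: "('k, 'e) ring_scheme" and L :: "('k, 'l, 'm) lie_alg_scheme"
  assumes lie: "lie_algebra K L"
begin

interpretation L: lie_algebra K L by (rule lie)

lemma bracket_linear:
  "x \<in> carrier L \<Longrightarrow> linear_map K L L (\<lambda>y. \<lbrakk>x, y\<rbrakk>\<^bsub>L\<^esub>)"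
  "y \<in> carrier L \<Longrightarrow> linear_map K L L (\<lambda>x. \<lbrakk>x, y\<rbrakk>\<^bsub>L\<^esub>)"
  using L.bracket_bilinear by (simp_all add: bilinear_def)

lemma bracket_closed: "x \<in> carrier L \<Longrightarrow> y \<in> carrier L \<Longrightarrow> \<lbrakk>x, y\<rbrakk>\<^bsub>L\<^esub> \<in> carrier L"
  using linear_mapD(3)[OF bracket_linear(1)] .

lemma bracket_anticomm:
  assumes x: "x \<in> carrier L" and y: "y \<in> carrier L"
  shows "\<lbrakk>y, x\<rbrakk>\<^bsub>L\<^esub> = \<ominus>\<^bsub>L\<^esub> \<lbrakk>x, y\<rbrakk>\<^bsub>L\<^esub>"
proof -
  have "\<lbrakk>y, x\<rbrakk>\<^bsub>L\<^esub> \<oplus>\<^bsub>L\<^esub> \<lbrakk>x, y\<rbrakk>\<^bsub>L\<^esub> = \<zero>\<^bsub>L\<^esub>"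
    using L.bracket_alternating[of "x \<oplus>\<^bsub>L\<^esub> y"] x y L.bracket_alternating[of x] L.bracket_alternating[of y]
    by (simp add: linear_mapD(4)[OF bracket_linear(1)] linear_mapD(4)[OF bracket_linear(2)]
        bracket_closed L.M.a_ac)
  then show ?thesis using x y by (simp add: L.M.minus_equality bracket_closed)
qed

text \<open>Restriction to the carrier turns an arbitrary bilinear map with the Poisson identity into the
  extensional function that represents it.\<close>
lemma poissonI:
  assumes "bilinear K L L L f"
    and "\<And>x y z. x \<in> carrier L \<Longrightarrow> y \<in> carrier L \<Longrightarrow> z \<in> carrier L \<Longrightarrow>
      \<lbrakk>z, f x y\<rbrakk>\<^bsub>L\<^esub> = f \<lbrakk>z, x\<rbrakk>\<^bsub>L\<^esub> y \<oplus>\<^bsub>L\<^esub> f x \<lbrakk>z, y\<rbrakk>\<^bsub>L\<^esub>"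
  shows "(\<lambda>x\<in>carrier L. \<lambda>y\<in>carrier L. f x y) \<in> poisson_structures K L"
  using bilinear_restrict[OF assms(1)] assms(2) bilinearD(3)[OF assms(1)]
  by (simp add: poisson_structures_def bracket_closed)

lemma poissonD:
  assumes "f \<in> poisson_structures K L"
  shows "bilinear K L L L f"
    and "x \<in> carrier L \<Longrightarrow> y \<in> carrier L \<Longrightarrow> z \<in> carrier L \<Longrightarrow>
      \<lbrakk>z, f x y\<rbrakk>\<^bsub>L\<^esub> = f \<lbrakk>z, x\<rbrakk>\<^bsub>L\<^esub> y \<oplus>\<^bsub>L\<^esub> f x \<lbrakk>z, y\<rbrakk>\<^bsub>L\<^esub>"
    and "x \<in> carrier L \<Longrightarrow> y \<in> carrier L \<Longrightarrow> f x y \<in> carrier L"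
  using assms by (auto simp: poisson_structures_def)

lemma poisson_eqI:
  assumes "f \<in> poisson_structures K L" and "g \<in> poisson_structures K L"
    and "\<And>x y. x \<in> carrier L \<Longrightarrow> y \<in> carrier L \<Longrightarrow> f x y = g x y"
  shows "f = g"
proof (rule PiE_ext)
  show "f \<in> carrier L \<rightarrow>\<^sub>E (carrier L \<rightarrow>\<^sub>E carrier L)" "g \<in> carrier L \<rightarrow>\<^sub>E (carrier L \<rightarrow>\<^sub>E carrier L)"
    using assms(1,2) by (simp_all add: poisson_structures_def)
  then show "f x = g x" if "x \<in> carrier L" for x
    using that assms(3) by (intro PiE_ext[of "f x" "carrier L" "\<lambda>_. carrier L" "g x"]) auto
qed

lemma poisson_zero: "\<zero>\<^bsub>poisson_space K L\<^esub> \<in> poisson_structures K L"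
  unfolding poisson_space_simps
  by (rule poissonI)
     (auto simp: bilinear_def linear_map_zero L.vectorspace_axioms linear_mapD(6)[OF bracket_linear(1)])

lemma poisson_add:
  assumes f: "f \<in> poisson_structures K L" and g: "g \<in> poisson_structures K L"
  shows "f \<oplus>\<^bsub>poisson_space K L\<^esub> g \<in> poisson_structures K L"
  unfolding poisson_space_simps
proof (rule poissonI)
  show "bilinear K L L L (\<lambda>x y. f x y \<oplus>\<^bsub>L\<^esub> g x y)"
    using poissonD(1)[OF f] poissonD(1)[OF g] by (auto simp: bilinear_def intro: linear_map_add)
  fix x y z assume "x \<in> carrier L" "y \<in> carrier L" "z \<in> carrier L"
  then show "\<lbrakk>z, f x y \<oplus>\<^bsub>L\<^esub> g x y\<rbrakk>\<^bsub>L\<^esub> = f \<lbrakk>z, x\<rbrakk>\<^bsub>L\<^esub> y \<oplus>\<^bsub>L\<^esub> g \<lbrakk>z, x\<rbrakk>\<^bsub>L\<^esub> y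
      \<oplus>\<^bsub>L\<^esub> (f x \<lbrakk>z, y\<rbrakk>\<^bsub>L\<^esub> \<oplus>\<^bsub>L\<^esub> g x \<lbrakk>z, y\<rbrakk>\<^bsub>L\<^esub>)"
    using poissonD(2)[OF f, of x y z] poissonD(2)[OF g, of x y z]
    by (simp add: linear_mapD(4)[OF bracket_linear(1)] poissonD(3)[OF f] poissonD(3)[OF g]
        bracket_closed L.M.a_ac)
qed

lemma poisson_smult:
  assumes f: "f \<in> poisson_structures K L" and c: "c \<in> carrier K"
  shows "c \<odot>\<^bsub>poisson_space K L\<^esub> f \<in> poisson_structures K L"
  unfolding poisson_space_simps
proof (rule poissonI)
  show "bilinear K L L L (\<lambda>x y. c \<odot>\<^bsub>L\<^esub> f x y)"
    using poissonD(1)[OF f] c by (auto simp: bilinear_def intro: linear_map_smult)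
  fix x y z assume "x \<in> carrier L" "y \<in> carrier L" "z \<in> carrier L"
  then show "\<lbrakk>z, c \<odot>\<^bsub>L\<^esub> f x y\<rbrakk>\<^bsub>L\<^esub> = c \<odot>\<^bsub>L\<^esub> f \<lbrakk>z, x\<rbrakk>\<^bsub>L\<^esub> y \<oplus>\<^bsub>L\<^esub> c \<odot>\<^bsub>L\<^esub> f x \<lbrakk>z, y\<rbrakk>\<^bsub>L\<^esub>"
    using poissonD(2)[OF f, of x y z] c
    by (simp add: linear_mapD(5)[OF bracket_linear(1)] poissonD(3)[OF f] bracket_closed L.smult_r_distr)
qed

lemma poisson_space_vs: "vectorspace K (poisson_space K L)"
proof (rule vs_criteria)
  let ?P = "poisson_space K L"
  show "field K" by (rule L.field_axioms)
  show "\<zero>\<^bsub>?P\<^esub> \<in> carrier ?P" using poisson_zero by (simp add: poisson_space_simps(1))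
  show "\<forall>f g. f \<in> carrier ?P \<and> g \<in> carrier ?P \<longrightarrow> f \<oplus>\<^bsub>?P\<^esub> g \<in> carrier ?P"
    using poisson_add by (simp add: poisson_space_simps(1))
  show "\<forall>c f. c \<in> carrier K \<and> f \<in> carrier ?P \<longrightarrow> c \<odot>\<^bsub>?P\<^esub> f \<in> carrier ?P"
    using poisson_smult by (simp add: poisson_space_simps(1))
  show "\<forall>f\<in>carrier ?P. \<exists>g\<in>carrier ?P. f \<oplus>\<^bsub>?P\<^esub> g = \<zero>\<^bsub>?P\<^esub>"
  proof
    fix f assume f: "f \<in> carrier ?P"
    then have f': "f \<in> poisson_structures K L" by (simp add: poisson_space_simps)
    have g: "\<ominus>\<^bsub>K\<^esub> \<one>\<^bsub>K\<^esub> \<odot>\<^bsub>?P\<^esub> f \<in> poisson_structures K L" using f' by (intro poisson_smult) auto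
    have "f \<oplus>\<^bsub>?P\<^esub> (\<ominus>\<^bsub>K\<^esub> \<one>\<^bsub>K\<^esub> \<odot>\<^bsub>?P\<^esub> f) = \<zero>\<^bsub>?P\<^esub>"
      by (rule poisson_eqI[OF poisson_add[OF f' g] poisson_zero])
         (simp add: poisson_space_simps poissonD(3)[OF f'] L.smult_minus_1 L.M.r_neg)
    then show "\<exists>g\<in>carrier ?P. f \<oplus>\<^bsub>?P\<^esub> g = \<zero>\<^bsub>?P\<^esub>" using g by (auto simp: poisson_space_simps(1))
  qed
qed (auto simp: poisson_space_simps(1) intro!: poisson_eqI poisson_zero poisson_add poisson_smult,
     auto simp: poisson_space_simps poissonD(3) L.M.a_ac L.smult_assoc1 L.smult_l_distr L.smult_r_distr)

lemma trivial_poissonI: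
  assumes "f \<in> poisson_structures K L" and "linear_map K L L \<omega>"
    and "\<And>x y. x \<in> carrier L \<Longrightarrow> y \<in> carrier L \<Longrightarrow> f x y = \<omega> \<lbrakk>x, y\<rbrakk>\<^bsub>L\<^esub>"
  shows "f \<in> trivial_poisson K L"
  using assms by (auto simp: trivial_poisson_def)

lemma trivial_poisson_subspace: "subspace K (trivial_poisson K L) (poisson_space K L)"
proof -
  have "LinearCombinations.submodule K (trivial_poisson K L) (poisson_space K L)"
  proof (rule LinearCombinations.submodule.intro)
    show "Module.module K (poisson_space K L)" by (rule vs_module[OF poisson_space_vs])
    show "trivial_poisson K L \<subseteq> carrier (poisson_space K L)"
      by (auto simp: trivial_poisson_def poisson_space_simps)
    show "\<zero>\<^bsub>poisson_space K L\<^esub> \<in> trivial_poisson K L"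
      by (rule trivial_poissonI[OF poisson_zero, where \<omega> = "\<lambda>x. \<zero>\<^bsub>L\<^esub>"])
         (auto simp: poisson_space_simps linear_map_zero L.vectorspace_axioms)
    show "f \<oplus>\<^bsub>poisson_space K L\<^esub> g \<in> trivial_poisson K L"
      if fg: "f \<in> trivial_poisson K L" "g \<in> trivial_poisson K L" for f g
    proof -
      obtain \<omega> \<omega>' where "linear_map K L L \<omega>" "linear_map K L L \<omega>'"
        "\<forall>x\<in>carrier L. \<forall>y\<in>carrier L. f x y = \<omega> \<lbrakk>x, y\<rbrakk>\<^bsub>L\<^esub>"
        "\<forall>x\<in>carrier L. \<forall>y\<in>carrier L. g x y = \<omega>' \<lbrakk>x, y\<rbrakk>\<^bsub>L\<^esub>"
        using fg by (auto simp: trivial_poisson_def)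
      then show ?thesis using fg
        by (intro trivial_poissonI[where \<omega> = "\<lambda>x. \<omega> x \<oplus>\<^bsub>L\<^esub> \<omega>' x"] poisson_add linear_map_add)
           (auto simp: trivial_poisson_def poisson_space_simps)
    qed
    show "c \<odot>\<^bsub>poisson_space K L\<^esub> f \<in> trivial_poisson K L"
      if c: "c \<in> carrier K" and f: "f \<in> trivial_poisson K L" for c f
    proof -
      obtain \<omega> where "linear_map K L L \<omega>"
        "\<forall>x\<in>carrier L. \<forall>y\<in>carrier L. f x y = \<omega> \<lbrakk>x, y\<rbrakk>\<^bsub>L\<^esub>"
        using f by (auto simp: trivial_poisson_def)
      then show ?thesis using c f
        by (intro trivial_poissonI[where \<omega> = "\<lambda>x. c \<odot>\<^bsub>L\<^esub> \<omega> x"] poisson_smult linear_map_smult)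
           (auto simp: trivial_poisson_def poisson_space_simps)
    qed
  qed
  then show ?thesis using poisson_space_vs by (simp add: subspace_def)
qed

lemma poisson_quotient_vs: "vectorspace K (\<P> K L)"
  unfolding poisson_quotient_def by (rule quotient_vs[OF trivial_poisson_subspace])

lemma poisson_class_linear: "linear_map K (poisson_space K L) (\<P> K L) (poisson_class K L)"
  unfolding poisson_quotient_def poisson_class_def
  by (rule coset_linear[OF trivial_poisson_subspace])

lemma poisson_quotient_carrier: "carrier (\<P> K L) = poisson_class K L ` poisson_structures K L"
  unfolding poisson_quotient_def poisson_class_def
  using quotient_carrier[OF trivial_poisson_subspace] by (simp add: poisson_space_simps(1))

lemma poisson_quotient_lift_ex:
  assumes "linear_map K (poisson_space K L) U \<phi>"
    and "\<And>f. f \<in> trivial_poisson K L \<Longrightarrow> \<phi> f = \<zero>\<^bsub>U\<^esub>"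
  shows "\<exists>g. linear_map K (\<P> K L) U g \<and> (\<forall>f\<in>poisson_structures K L. g (poisson_class K L f) = \<phi> f)"
  using quotient_lift_ex[OF trivial_poisson_subspace assms]
  by (simp add: poisson_quotient_def poisson_class_def poisson_space_simps(1))

lemma poisson_class_trivial:
  assumes "f \<in> trivial_poisson K L"
  shows "poisson_class K L f = \<zero>\<^bsub>\<P> K L\<^esub>"
proof -
  interpret P: vectorspace K "poisson_space K L" by (rule poisson_space_vs)
  have f: "f \<in> carrier (poisson_space K L)"
    using assms by (auto simp: trivial_poisson_def poisson_space_simps(1))
  then have "f \<ominus>\<^bsub>poisson_space K L\<^esub> \<zero>\<^bsub>poisson_space K L\<^esub> = f"
    by (simp add: a_minus_def)
  then have "poisson_class K L f = poisson_class K L \<zero>\<^bsub>poisson_space K L\<^esub>"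
    unfolding poisson_class_def using coset_eq_iff[OF trivial_poisson_subspace f] assms by simp
  then show ?thesis using linear_mapD(6)[OF poisson_class_linear] by simp
qed

end

section \<open>Extending Poisson structures to the current Lie algebra\<close>

text \<open>The structure \<open>(x \<otimes> a, y \<otimes> b) \<mapsto> f(x,y) \<otimes> abu\<close> on \<open>L \<otimes> A\<close>. It is determined by these values,
  since pure tensors generate.\<close>
definition extend_poisson where
  "extend_poisson K L A f u = (SOME F. F \<in> poisson_structures K (current K L A) \<and>
    (\<forall>x\<in>carrier L. \<forall>y\<in>carrier L. \<forall>a\<in>carrier A. \<forall>b\<in>carrier A.
      F (pure_tensor K L A x a) (pure_tensor K L A y b) =
        pure_tensor K L A (f x y) (a \<otimes>\<^bsub>A\<^esub> b \<otimes>\<^bsub>A\<^esub> u)))"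

text \<open>The action of \<open>c\<close> on \<open>L \<otimes> A\<close> as an \<open>A\<close>-module.\<close>
definition scale_tensor where
  "scale_tensor K L A c = (SOME h. linear_map K (tensor K L A) (tensor K L A) h \<and>
    (\<forall>x\<in>carrier L. \<forall>a\<in>carrier A.
      h (pure_tensor K L A x a) = pure_tensor K L A x (c \<otimes>\<^bsub>A\<^esub> a)))"

context
  fixes K :: "('k, 'e) ring_scheme" and L :: "('k, 'l, 'm) lie_alg_scheme"
    and A :: "('k, 'a, 'n) module_scheme"
  assumes lie: "lie_algebra K L" and alg: "algebra K A"
begin

interpretation L: lie_algebra K L by (rule lie)
interpretation A: algebra K A by (rule alg)

private abbreviation (input) "T \<equiv> tensor K L A"
private abbreviation (input) "C \<equiv> current K L A"
private abbreviation (input) "pt \<equiv> pure_tensor K L A"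
private abbreviation (input) "sc \<equiv> scale_tensor K L A"
private abbreviation (input) "ext \<equiv> extend_poisson K L A"

private lemmas vsL = vsL[OF lie alg] and vsA = vsA[OF lie alg]
private lemmas vsT = tensor_vs[OF vsL vsA]
private lemmas vsC = current_vs[OF lie alg]
private lemmas lieC = current_lie_algebra[OF lie alg]
private lemmas simpsC = current_simps[OF lie alg]
private lemmas pt_closed = pt_closed[OF lie alg]

interpretation T: vectorspace K T by (rule vsT)

lemma current_linear_iff: "linear_map K C C f \<longleftrightarrow> linear_map K T T f"
proof
  show "linear_map K T T f" if "linear_map K C C f"
    by (rule linear_map_transfer[OF that vsT vsT]) (simp_all add: current_def)
  show "linear_map K C C f" if "linear_map K T T f"
    by (rule linear_map_transfer[OF that vsC vsC]) (simp_all add: current_def)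
qed

lemma current_bilinear_iff: "bilinear K C C C F \<longleftrightarrow> bilinear K T T T F"
  by (simp add: bilinear_def current_linear_iff simpsC)

lemma current_bracket_bilinear: "bilinear K T T T (bracket C)"
  using current_bracket[OF lie alg] by (simp add: is_current_bracket_def)

lemma current_bracket_pure:
  "\<lbrakk>x \<in> carrier L; y \<in> carrier L; a \<in> carrier A; b \<in> carrier A\<rbrakk> \<Longrightarrow>
    \<lbrakk>pt x a, pt y b\<rbrakk>\<^bsub>C\<^esub> = pt \<lbrakk>x, y\<rbrakk>\<^bsub>L\<^esub> (a \<otimes>\<^bsub>A\<^esub> b)"
  using current_bracket[OF lie alg] by (simp add: is_current_bracket_def)

lemma current_bracket_linear:
  "s \<in> carrier T \<Longrightarrow> linear_map K T T (\<lambda>t. \<lbrakk>s, t\<rbrakk>\<^bsub>C\<^esub>)"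
  "t \<in> carrier T \<Longrightarrow> linear_map K T T (\<lambda>s. \<lbrakk>s, t\<rbrakk>\<^bsub>C\<^esub>)"
  by (rule bilinearD(1,2)[OF current_bracket_bilinear], assumption)+

lemma mult_linear:
  "c \<in> carrier A \<Longrightarrow> linear_map K A A (\<lambda>a. c \<otimes>\<^bsub>A\<^esub> a)"
  by (rule linear_mapI[OF vsA vsA]) (simp_all add: A.r_distr A_smult_mult[OF lie alg])

lemma
  assumes c: "c \<in> carrier A"
  shows scale_tensor_linear: "linear_map K T T (scale_tensor K L A c)"
    and scale_tensor_pure: "x \<in> carrier L \<Longrightarrow> a \<in> carrier A \<Longrightarrow>
      scale_tensor K L A c (pt x a) = pt x (c \<otimes>\<^bsub>A\<^esub> a)"
proof -
  from someI_ex[OF tensor_map_ex[OF linear_map_id[OF vsL] mult_linear[OF c]]]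
  have *: "linear_map K T T (scale_tensor K L A c) \<and> (\<forall>x\<in>carrier L. \<forall>a\<in>carrier A.
    scale_tensor K L A c (pt x a) = pt x (c \<otimes>\<^bsub>A\<^esub> a))"
    unfolding scale_tensor_def .
  then show "linear_map K T T (scale_tensor K L A c)"
    and "x \<in> carrier L \<Longrightarrow> a \<in> carrier A \<Longrightarrow> scale_tensor K L A c (pt x a) = pt x (c \<otimes>\<^bsub>A\<^esub> a)"
    by auto
qed

text \<open>The bracket of the current Lie algebra is \<open>A\<close>-bilinear. The next two lemmas are the instances of
  this fact by which the Poisson identities for \<open>z \<otimes> c\<close> and \<open>z \<otimes> 1\<close> are compared.\<close>
lemma current_bracket_scale:
  assumes z: "z \<in> carrier L" and c: "c \<in> carrier A" and t: "t \<in> carrier T"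
  shows "\<lbrakk>pt z c, t\<rbrakk>\<^bsub>C\<^esub> = scale_tensor K L A c \<lbrakk>pt z \<one>\<^bsub>A\<^esub>, t\<rbrakk>\<^bsub>C\<^esub>"
  by (rule tensor_linear_eq[OF vsL vsA _ _ _ t,
        OF current_bracket_linear(1) linear_map_comp[OF scale_tensor_linear current_bracket_linear(1)]])
     (simp_all add: pt_closed z c current_bracket_pure scale_tensor_pure bracket_closed[OF lie])

lemma current_bracket_one_scale:
  assumes z: "z \<in> carrier L" and c: "c \<in> carrier A" and t: "t \<in> carrier T"
  shows "\<lbrakk>pt z \<one>\<^bsub>A\<^esub>, scale_tensor K L A c t\<rbrakk>\<^bsub>C\<^esub> = scale_tensor K L A c \<lbrakk>pt z \<one>\<^bsub>A\<^esub>, t\<rbrakk>\<^bsub>C\<^esub>"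
  by (rule tensor_linear_eq[OF vsL vsA _ _ _ t,
        OF linear_map_comp[OF current_bracket_linear(1) scale_tensor_linear]
           linear_map_comp[OF scale_tensor_linear current_bracket_linear(1)]])
     (simp_all add: pt_closed z c current_bracket_pure scale_tensor_pure bracket_closed[OF lie])

lemma current_poissonD:
  assumes F: "F \<in> poisson_structures K C"
  shows "bilinear K T T T F"
    and "s \<in> carrier T \<Longrightarrow> t \<in> carrier T \<Longrightarrow> F s t \<in> carrier T"
    and "\<lbrakk>x \<in> carrier L; y \<in> carrier L; z \<in> carrier L; a \<in> carrier A; b \<in> carrier A; c \<in> carrier A\<rbrakk> \<Longrightarrow>
      \<lbrakk>pt z c, F (pt x a) (pt y b)\<rbrakk>\<^bsub>C\<^esub> =
        F (pt \<lbrakk>z, x\<rbrakk>\<^bsub>L\<^esub> (c \<otimes>\<^bsub>A\<^esub> a)) (pt y b) \<oplus>\<^bsub>T\<^esub> F (pt x a) (pt \<lbrakk>z, y\<rbrakk>\<^bsub>L\<^esub> (c \<otimes>\<^bsub>A\<^esub> b))"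
proof -
  show b: "bilinear K T T T F"
    using poissonD(1)[OF lieC F] by (simp add: current_bilinear_iff)
  show "s \<in> carrier T \<Longrightarrow> t \<in> carrier T \<Longrightarrow> F s t \<in> carrier T"
    by (rule bilinearD(3)[OF b])
  show "\<lbrakk>pt z c, F (pt x a) (pt y b)\<rbrakk>\<^bsub>C\<^esub> =
      F (pt \<lbrakk>z, x\<rbrakk>\<^bsub>L\<^esub> (c \<otimes>\<^bsub>A\<^esub> a)) (pt y b) \<oplus>\<^bsub>T\<^esub> F (pt x a) (pt \<lbrakk>z, y\<rbrakk>\<^bsub>L\<^esub> (c \<otimes>\<^bsub>A\<^esub> b))"
    if "x \<in> carrier L" "y \<in> carrier L" "z \<in> carrier L" "a \<in> carrier A" "b \<in> carrier A" "c \<in> carrier A"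
    using poissonD(2)[OF lieC F, of "pt x a" "pt y b" "pt z c"] that
    by (simp add: simpsC pt_closed current_bracket_pure)
qed

lemma current_poisson_eqI:
  assumes F: "F \<in> poisson_structures K C" and G: "G \<in> poisson_structures K C"
    and eq: "\<And>x y a b. \<lbrakk>x \<in> carrier L; y \<in> carrier L; a \<in> carrier A; b \<in> carrier A\<rbrakk> \<Longrightarrow>
      F (pt x a) (pt y b) = G (pt x a) (pt y b)"
  shows "F = G"
  using tensor_bilinear_eq[OF lie alg current_poissonD(1)[OF F] current_poissonD(1)[OF G] eq]
  by (intro poisson_eqI[OF lieC F G]) (simp add: simpsC)

text \<open>The Poisson identity is trilinear, so it suffices to check it on pure tensors.\<close>
lemma current_poissonI:
  assumes F: "bilinear K T T T F"
    and eq: "\<And>x y z a b c.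
      \<lbrakk>x \<in> carrier L; y \<in> carrier L; z \<in> carrier L; a \<in> carrier A; b \<in> carrier A; c \<in> carrier A\<rbrakk> \<Longrightarrow>
      \<lbrakk>pt z c, F (pt x a) (pt y b)\<rbrakk>\<^bsub>C\<^esub> =
        F (pt \<lbrakk>z, x\<rbrakk>\<^bsub>L\<^esub> (c \<otimes>\<^bsub>A\<^esub> a)) (pt y b) \<oplus>\<^bsub>T\<^esub> F (pt x a) (pt \<lbrakk>z, y\<rbrakk>\<^bsub>L\<^esub> (c \<otimes>\<^bsub>A\<^esub> b))"
  shows "(\<lambda>s\<in>carrier T. \<lambda>t\<in>carrier T. F s t) \<in> poisson_structures K C"
proof -
  note b = bilinearD(3)[OF F]
  have 1: "\<lbrakk>pt z c, F s t\<rbrakk>\<^bsub>C\<^esub> = F \<lbrakk>pt z c, s\<rbrakk>\<^bsub>C\<^esub> t \<oplus>\<^bsub>T\<^esub> F s \<lbrakk>pt z c, t\<rbrakk>\<^bsub>C\<^esub>"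
    if zc: "z \<in> carrier L" "c \<in> carrier A" and st: "s \<in> carrier T" "t \<in> carrier T" for z c s t
  proof (rule tensor_bilinear_eq[OF lie alg, where B = "\<lambda>s t. \<lbrakk>pt z c, F s t\<rbrakk>\<^bsub>C\<^esub>" and
        C = "\<lambda>s t. F \<lbrakk>pt z c, s\<rbrakk>\<^bsub>C\<^esub> t \<oplus>\<^bsub>T\<^esub> F s \<lbrakk>pt z c, t\<rbrakk>\<^bsub>C\<^esub>", OF _ _ _ st])
    note ad = current_bracket_linear(1)[OF pt_closed[OF zc]]
    show "bilinear K T T T (\<lambda>s t. \<lbrakk>pt z c, F s t\<rbrakk>\<^bsub>C\<^esub>)" by (rule bilinear_comp[OF ad F])
    show "bilinear K T T T (\<lambda>s t. F \<lbrakk>pt z c, s\<rbrakk>\<^bsub>C\<^esub> t \<oplus>\<^bsub>T\<^esub> F s \<lbrakk>pt z c, t\<rbrakk>\<^bsub>C\<^esub>)"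
      by (intro bilinear_add bilinear_pull[OF F ad linear_map_id[OF vsT]]
          bilinear_pull[OF F linear_map_id[OF vsT] ad])
  qed (simp add: eq zc current_bracket_pure)
  have "\<lbrakk>r, F s t\<rbrakk>\<^bsub>C\<^esub> = F \<lbrakk>r, s\<rbrakk>\<^bsub>C\<^esub> t \<oplus>\<^bsub>T\<^esub> F s \<lbrakk>r, t\<rbrakk>\<^bsub>C\<^esub>"
    if r: "r \<in> carrier T" and st: "s \<in> carrier T" "t \<in> carrier T" for r s t
    by (rule tensor_linear_eq[OF vsL vsA current_bracket_linear(2)[OF b[OF st]]
          linear_map_add[OF linear_map_comp[OF bilinearD(2)[OF F st(2)] current_bracket_linear(2)[OF st(1)]]
            linear_map_comp[OF bilinearD(1)[OF F st(1)] current_bracket_linear(2)[OF st(2)]]] _ r])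
       (rule 1[OF _ _ st])
  then show ?thesis
    using F poissonI[OF lieC, of F] by (simp add: current_bilinear_iff simpsC)
qed

lemma
  assumes f: "f \<in> poisson_structures K L" and u: "u \<in> carrier A"
  shows extend_poisson_closed: "extend_poisson K L A f u \<in> poisson_structures K C"
    and extend_poisson_pure: "\<lbrakk>x \<in> carrier L; y \<in> carrier L; a \<in> carrier A; b \<in> carrier A\<rbrakk> \<Longrightarrow>
      extend_poisson K L A f u (pt x a) (pt y b) = pt (f x y) (a \<otimes>\<^bsub>A\<^esub> b \<otimes>\<^bsub>A\<^esub> u)"
proof -
  \<comment> \<open>The factor \<open>abu\<close> is linear in \<open>a\<close> and in \<open>b\<close>, and \<open>f\<close> is bilinear, so the universal property
    applies to each pair of arguments.\<close>
  have m: "linear_map K A A (\<lambda>b. a \<otimes>\<^bsub>A\<^esub> b \<otimes>\<^bsub>A\<^esub> u)" "linear_map K A A (\<lambda>b. b \<otimes>\<^bsub>A\<^esub> a \<otimes>\<^bsub>A\<^esub> u)"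
    if "a \<in> carrier A" for a
    using that u
    by (auto intro: linear_map_cong[OF mult_linear[of "a \<otimes>\<^bsub>A\<^esub> u"]] simp: A.m_ac)
  note fl = bilinearD[OF poissonD(1)[OF lie f]]
  have "\<exists>F. bilinear K T T T F \<and> (\<forall>x\<in>carrier L. \<forall>a\<in>carrier A. \<forall>y\<in>carrier L. \<forall>b\<in>carrier A.
      F (pt x a) (pt y b) = pt (f x y) (a \<otimes>\<^bsub>A\<^esub> b \<otimes>\<^bsub>A\<^esub> u))"
  proof (rule tensor_bilinear_lift_ex[OF vsL vsA vsT])
    fix x a assume "x \<in> carrier L" "a \<in> carrier A"
    then show "bilinear K L A T (\<lambda>y b. pt (f x y) (a \<otimes>\<^bsub>A\<^esub> b \<otimes>\<^bsub>A\<^esub> u))"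
      using bilinear_pull[OF pure_bilinear[OF vsL vsA] fl(1) m(1)] by blast
  next
    fix y b assume "y \<in> carrier L" "b \<in> carrier A"
    then show "bilinear K L A T (\<lambda>x a. pt (f x y) (a \<otimes>\<^bsub>A\<^esub> b \<otimes>\<^bsub>A\<^esub> u))"
      using bilinear_pull[OF pure_bilinear[OF vsL vsA] fl(2) m(2)] by blast
  qed
  then obtain F where F: "bilinear K T T T F"
    and Fp: "\<And>x y a b. \<lbrakk>x \<in> carrier L; a \<in> carrier A; y \<in> carrier L; b \<in> carrier A\<rbrakk> \<Longrightarrow>
      F (pt x a) (pt y b) = pt (f x y) (a \<otimes>\<^bsub>A\<^esub> b \<otimes>\<^bsub>A\<^esub> u)" by blast
  have "(\<lambda>s\<in>carrier T. \<lambda>t\<in>carrier T. F s t) \<in> poisson_structures K C"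
  proof (rule current_poissonI[OF F])
    fix x y z a b c
    assume xyz: "x \<in> carrier L" "y \<in> carrier L" "z \<in> carrier L"
      and abc: "a \<in> carrier A" "b \<in> carrier A" "c \<in> carrier A"
    have e: "c \<otimes>\<^bsub>A\<^esub> a \<otimes>\<^bsub>A\<^esub> b \<otimes>\<^bsub>A\<^esub> u = c \<otimes>\<^bsub>A\<^esub> (a \<otimes>\<^bsub>A\<^esub> b \<otimes>\<^bsub>A\<^esub> u)"
      "a \<otimes>\<^bsub>A\<^esub> (c \<otimes>\<^bsub>A\<^esub> b) \<otimes>\<^bsub>A\<^esub> u = c \<otimes>\<^bsub>A\<^esub> (a \<otimes>\<^bsub>A\<^esub> b \<otimes>\<^bsub>A\<^esub> u)"
      using abc u by (simp_all add: A.m_ac)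
    show "\<lbrakk>pt z c, F (pt x a) (pt y b)\<rbrakk>\<^bsub>C\<^esub> =
      F (pt \<lbrakk>z, x\<rbrakk>\<^bsub>L\<^esub> (c \<otimes>\<^bsub>A\<^esub> a)) (pt y b) \<oplus>\<^bsub>T\<^esub> F (pt x a) (pt \<lbrakk>z, y\<rbrakk>\<^bsub>L\<^esub> (c \<otimes>\<^bsub>A\<^esub> b))"
      using xyz abc u poissonD(2)[OF lie f xyz]
      by (simp add: Fp bracket_closed[OF lie] current_bracket_pure poissonD(3)[OF lie f] e
          linear_mapD(4)[OF pure_linear(2)[OF vsL vsA]])
  qed
  then have "\<exists>F. F \<in> poisson_structures K C \<and>
      (\<forall>x\<in>carrier L. \<forall>y\<in>carrier L. \<forall>a\<in>carrier A. \<forall>b\<in>carrier A.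
        F (pt x a) (pt y b) = pt (f x y) (a \<otimes>\<^bsub>A\<^esub> b \<otimes>\<^bsub>A\<^esub> u))"
    by (intro exI[of _ "\<lambda>s\<in>carrier T. \<lambda>t\<in>carrier T. F s t"]) (simp add: Fp pt_closed)
  from someI_ex[OF this] have *: "extend_poisson K L A f u \<in> poisson_structures K C \<and>
      (\<forall>x\<in>carrier L. \<forall>y\<in>carrier L. \<forall>a\<in>carrier A. \<forall>b\<in>carrier A.
        extend_poisson K L A f u (pt x a) (pt y b) = pt (f x y) (a \<otimes>\<^bsub>A\<^esub> b \<otimes>\<^bsub>A\<^esub> u))"
    unfolding extend_poisson_def .
  then show "extend_poisson K L A f u \<in> poisson_structures K C"
    and "\<lbrakk>x \<in> carrier L; y \<in> carrier L; a \<in> carrier A; b \<in> carrier A\<rbrakk> \<Longrightarrow>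
      extend_poisson K L A f u (pt x a) (pt y b) = pt (f x y) (a \<otimes>\<^bsub>A\<^esub> b \<otimes>\<^bsub>A\<^esub> u)"
    by auto
qed

lemma extend_poisson_bilinear:
  "bilinear K (poisson_space K L) A (poisson_space K C) (extend_poisson K L A)"
proof -
  note ext = extend_poisson_closed extend_poisson_pure
  note sp = poisson_space_simps
  note ops = poisson_add[OF lie] poisson_smult[OF lie] poisson_add[OF lieC] poisson_smult[OF lieC]
  have "linear_map K A (poisson_space K C) (extend_poisson K L A f)"
    if f: "f \<in> poisson_structures K L" for f
  proof (rule linear_mapI[OF vsA poisson_space_vs[OF lieC]])
    fix u v assume uv: "u \<in> carrier A" "v \<in> carrier A"
    show "extend_poisson K L A f (u \<oplus>\<^bsub>A\<^esub> v) =
      extend_poisson K L A f u \<oplus>\<^bsub>poisson_space K C\<^esub> extend_poisson K L A f v"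
      by (rule current_poisson_eqI)
         (use f uv in \<open>simp_all add: ops ext, simp_all add: sp ext simpsC pt_closed A.r_distr
            linear_mapD(4)[OF pure_linear(1)[OF vsL vsA]] poissonD(3)[OF lie]\<close>)
  next
    fix c u assume cu: "c \<in> carrier K" "u \<in> carrier A"
    show "extend_poisson K L A f (c \<odot>\<^bsub>A\<^esub> u) = c \<odot>\<^bsub>poisson_space K C\<^esub> extend_poisson K L A f u"
      by (rule current_poisson_eqI)
         (use f cu in \<open>simp_all add: ops ext, simp_all add: sp ext simpsC pt_closed A_smult_mult[OF lie alg]
            linear_mapD(5)[OF pure_linear(1)[OF vsL vsA]] poissonD(3)[OF lie]\<close>)
  qed (simp add: sp ext f)
  moreover have "linear_map K (poisson_space K L) (poisson_space K C) (\<lambda>f. extend_poisson K L A f u)"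
    if u: "u \<in> carrier A" for u
  proof (rule linear_mapI[OF poisson_space_vs[OF lie] poisson_space_vs[OF lieC]])
    fix f g assume "f \<in> carrier (poisson_space K L)" "g \<in> carrier (poisson_space K L)"
    then have fg: "f \<in> poisson_structures K L" "g \<in> poisson_structures K L" by (simp_all add: sp(1))
    show "extend_poisson K L A (f \<oplus>\<^bsub>poisson_space K L\<^esub> g) u =
      extend_poisson K L A f u \<oplus>\<^bsub>poisson_space K C\<^esub> extend_poisson K L A g u"
      by (rule current_poisson_eqI)
         (use u fg in \<open>simp_all add: ops ext, simp_all add: sp ext simpsC pt_closed
            linear_mapD(4)[OF pure_linear(2)[OF vsL vsA]] poissonD(3)[OF lie]\<close>)
  next
    fix c f assume c: "c \<in> carrier K" and "f \<in> carrier (poisson_space K L)"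
    then have f: "f \<in> poisson_structures K L" by (simp add: sp(1))
    show "extend_poisson K L A (c \<odot>\<^bsub>poisson_space K L\<^esub> f) u =
      c \<odot>\<^bsub>poisson_space K C\<^esub> extend_poisson K L A f u"
      by (rule current_poisson_eqI)
         (use u c f in \<open>simp_all add: ops ext, simp_all add: sp ext simpsC pt_closed
            linear_mapD(5)[OF pure_linear(2)[OF vsL vsA]] poissonD(3)[OF lie]\<close>)
  qed (simp add: sp(1) ext u)
  ultimately show ?thesis by (simp add: bilinear_def sp(1))
qed

text \<open>If \<open>f\<close> comes from \<open>\<omega>\<close>, then its extension comes from the tensor product of \<open>\<omega>\<close> with
  multiplication by \<open>u\<close>.\<close>
lemma extend_poisson_trivial:
  assumes f: "f \<in> trivial_poisson K L" and u: "u \<in> carrier A"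
  shows "extend_poisson K L A f u \<in> trivial_poisson K C"
proof -
  have fp: "f \<in> poisson_structures K L" using f by (simp add: trivial_poisson_def)
  obtain \<omega> where \<omega>: "linear_map K L L \<omega>"
    and f\<omega>: "\<forall>x\<in>carrier L. \<forall>y\<in>carrier L. f x y = \<omega> \<lbrakk>x, y\<rbrakk>\<^bsub>L\<^esub>"
    using f by (auto simp: trivial_poisson_def)
  obtain \<Omega> where \<Omega>: "linear_map K T T \<Omega>"
    and \<Omega>p: "\<forall>x\<in>carrier L. \<forall>a\<in>carrier A. \<Omega> (pt x a) = pt (\<omega> x) (u \<otimes>\<^bsub>A\<^esub> a)"
    using tensor_map_ex[OF \<omega> mult_linear[OF u]] by blast
  show ?thesis
  proof (rule trivial_poissonI[OF lieC extend_poisson_closed[OF fp u], where \<omega> = \<Omega>])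
    show "linear_map K C C \<Omega>" using \<Omega> by (simp add: current_linear_iff)
    fix s t assume "s \<in> carrier C" "t \<in> carrier C"
    then have st: "s \<in> carrier T" "t \<in> carrier T" by (simp_all add: simpsC)
    show "extend_poisson K L A f u s t = \<Omega> \<lbrakk>s, t\<rbrakk>\<^bsub>C\<^esub>"
    proof (rule tensor_bilinear_eq[OF lie alg current_poissonD(1)[OF extend_poisson_closed[OF fp u]]
            bilinear_comp[OF \<Omega> current_bracket_bilinear] _ st])
      fix x y a b
      assume "x \<in> carrier L" "y \<in> carrier L" "a \<in> carrier A" "b \<in> carrier A"
      then show "extend_poisson K L A f u (pt x a) (pt y b) = \<Omega> \<lbrakk>pt x a, pt y b\<rbrakk>\<^bsub>C\<^esub>"
        using u by (simp add: extend_poisson_pure[OF fp] current_bracket_pure bracket_closed[OF lie]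
            f\<omega> \<Omega>p A.m_comm[of "a \<otimes>\<^bsub>A\<^esub> b" u])
    qed
  qed
qed

section \<open>Invariant maps in coordinates\<close>

context
  fixes B :: "'a set" and \<xi> :: "'a \<Rightarrow> 'a \<Rightarrow> 'k"
  assumes coord: "coordinates K A B \<xi>"
begin

interpretation coordinates K A B \<xi> by (rule coord)

private abbreviation (input) "\<kappa> \<equiv> tensor_coord L"

private lemmas br_closed = bracket_closed[OF lie]
private lemmas \<kappa>_linear = tensor_coord_linear[OF vsL]

lemma tensor_coord_bracket:
  assumes b: "b \<in> B" and z: "z \<in> carrier L" and t: "t \<in> carrier T"
  shows "\<kappa> b \<lbrakk>pt z \<one>\<^bsub>A\<^esub>, t\<rbrakk>\<^bsub>C\<^esub> = \<lbrakk>z, \<kappa> b t\<rbrakk>\<^bsub>L\<^esub>"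
  by (rule tensor_linear_eq[OF vsL vs_A
        linear_map_comp[OF \<kappa>_linear[OF b] current_bracket_linear(1)[OF pt_closed[OF z A.one_closed]]]
        linear_map_comp[OF bracket_linear(1)[OF lie z] \<kappa>_linear[OF b]] _ t])
     (simp add: current_bracket_pure tensor_coord_pure[OF vsL b] z br_closed
        coord_closed[OF b] linear_mapD(5)[OF bracket_linear(1)[OF lie]])

text \<open>The coordinate maps \<open>L \<otimes> A \<rightarrow> L\<close> commute with the action of \<open>L\<close>, so an \<open>L\<close>-invariant bilinear map
  with values in \<open>L \<otimes> A\<close> is a family of Poisson structures on \<open>L\<close>.\<close>
lemma tensor_coord_poisson:
  assumes H: "bilinear K L L T H" and b: "b \<in> B"
    and inv: "\<And>x y z. \<lbrakk>x \<in> carrier L; y \<in> carrier L; z \<in> carrier L\<rbrakk> \<Longrightarrow>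
      \<lbrakk>pt z \<one>\<^bsub>A\<^esub>, H x y\<rbrakk>\<^bsub>C\<^esub> = H \<lbrakk>z, x\<rbrakk>\<^bsub>L\<^esub> y \<oplus>\<^bsub>T\<^esub> H x \<lbrakk>z, y\<rbrakk>\<^bsub>L\<^esub>"
  shows "(\<lambda>x\<in>carrier L. \<lambda>y\<in>carrier L. \<kappa> b (H x y)) \<in> poisson_structures K L"
proof (rule poissonI[OF lie bilinear_comp[OF \<kappa>_linear[OF b] H]])
  note Hc = bilinearD(3)[OF H]
  fix x y z assume xyz: "x \<in> carrier L" "y \<in> carrier L" "z \<in> carrier L"
  have "\<lbrakk>z, \<kappa> b (H x y)\<rbrakk>\<^bsub>L\<^esub> = \<kappa> b (H \<lbrakk>z, x\<rbrakk>\<^bsub>L\<^esub> y \<oplus>\<^bsub>T\<^esub> H x \<lbrakk>z, y\<rbrakk>\<^bsub>L\<^esub>)"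
    using tensor_coord_bracket[OF b xyz(3) Hc[OF xyz(1,2)]] inv[OF xyz] by simp
  then show "\<lbrakk>z, \<kappa> b (H x y)\<rbrakk>\<^bsub>L\<^esub> = \<kappa> b (H \<lbrakk>z, x\<rbrakk>\<^bsub>L\<^esub> y) \<oplus>\<^bsub>L\<^esub> \<kappa> b (H x \<lbrakk>z, y\<rbrakk>\<^bsub>L\<^esub>)"
    using xyz by (simp add: linear_mapD(4)[OF \<kappa>_linear[OF b]] Hc br_closed)
qed

lemma invariant_right_skew_zero:
  assumes H: "bilinear K L L T H"
    and inv: "\<And>x y z. \<lbrakk>x \<in> carrier L; y \<in> carrier L; z \<in> carrier L\<rbrakk> \<Longrightarrow>
      \<lbrakk>pt z \<one>\<^bsub>A\<^esub>, H x y\<rbrakk>\<^bsub>C\<^esub> = H \<lbrakk>z, x\<rbrakk>\<^bsub>L\<^esub> y \<oplus>\<^bsub>T\<^esub> H x \<lbrakk>z, y\<rbrakk>\<^bsub>L\<^esub>"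
    and skew: "\<And>x y z. \<lbrakk>x \<in> carrier L; y \<in> carrier L; z \<in> carrier L\<rbrakk> \<Longrightarrow>
      H x \<lbrakk>y, z\<rbrakk>\<^bsub>L\<^esub> = H y \<lbrakk>z, x\<rbrakk>\<^bsub>L\<^esub>"
    and no_right_skew: "\<And>f. f \<in> poisson_structures K L \<Longrightarrow> right_skew L f \<Longrightarrow> f = \<zero>\<^bsub>poisson_space K L\<^esub>"
    and x: "x \<in> carrier L" and y: "y \<in> carrier L"
  shows "H x y = \<zero>\<^bsub>T\<^esub>"
proof (rule tensor_eq_zeroI[OF vsL bilinearD(3)[OF H x y]])
  fix b assume b: "b \<in> B"
  let ?h = "\<lambda>x\<in>carrier L. \<lambda>y\<in>carrier L. \<kappa> b (H x y)"
  have "right_skew L ?h"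
    unfolding right_skew_def
  proof (intro ballI)
    fix x y z assume "x \<in> carrier L" "y \<in> carrier L" "z \<in> carrier L"
    then show "?h x \<lbrakk>y, z\<rbrakk>\<^bsub>L\<^esub> = ?h y \<lbrakk>z, x\<rbrakk>\<^bsub>L\<^esub>" using skew[of x y z] by (simp add: br_closed)
  qed
  then have "?h = \<zero>\<^bsub>poisson_space K L\<^esub>"
    using no_right_skew tensor_coord_poisson[OF H b inv] by blast
  then have "?h x y = \<zero>\<^bsub>poisson_space K L\<^esub> x y" by simp
  then show "\<kappa> b (H x y) = \<zero>\<^bsub>L\<^esub>" using x y by (simp add: poisson_space_simps)
qed

section \<open>Poisson structures on the current Lie algebra are linear over \<open>A\<close>\<close>

text \<open>The rigidity step: a Poisson structure on \<open>L \<otimes> A\<close> is automatically \<open>A\<close>-bilinear. The maps \<open>H\<close>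
  and \<open>G\<close> of the proof are the defects of linearity in the second and in the first argument.\<close>
lemma current_poisson_scale:
  assumes perf: "perfect K L"
    and no_right_skew: "\<And>f. f \<in> poisson_structures K L \<Longrightarrow> right_skew L f \<Longrightarrow> f = \<zero>\<^bsub>poisson_space K L\<^esub>"
    and F: "F \<in> poisson_structures K C"
    and x: "x \<in> carrier L" and y: "y \<in> carrier L"
    and a: "a \<in> carrier A" and b: "b \<in> carrier A" and c: "c \<in> carrier A"
  shows "F (pt x a) (pt y (c \<otimes>\<^bsub>A\<^esub> b)) = sc c (F (pt x a) (pt y b))"
    and "F (pt x (c \<otimes>\<^bsub>A\<^esub> a)) (pt y b) = sc c (F (pt x a) (pt y b))"
proof -
  define P where "P x y = F (pt x a) (pt y b)" for x y
  define P' where "P' x y = F (pt x a) (pt y (c \<otimes>\<^bsub>A\<^esub> b))" for x y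
  define P'' where "P'' x y = F (pt x (c \<otimes>\<^bsub>A\<^esub> a)) (pt y b)" for x y
  define H where "H x y = P' x y \<ominus>\<^bsub>T\<^esub> sc c (P x y)" for x y
  define G where "G x y = P'' x y \<ominus>\<^bsub>T\<^esub> sc c (P x y)" for x y
  note sc = scale_tensor_linear[OF c]
  note cb = A.m_closed[OF c b] and ca = A.m_closed[OF c a]
  have bil: "bilinear K L L T (\<lambda>x y. F (pt x a') (pt y b'))" if "a' \<in> carrier A" "b' \<in> carrier A" for a' b'
    using that by (intro bilinear_pull[OF current_poissonD(1)[OF F]] pure_linear(2)[OF vsL vs_A])
  have bP: "bilinear K L L T P" "bilinear K L L T P'" "bilinear K L L T P''"
    unfolding P_def P'_def P''_def by (intro bil a b cb ca)+
  have bH: "bilinear K L L T H" unfolding H_def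
    by (intro bilinear_diff bP bilinear_comp[OF sc])
  have bG: "bilinear K L L T G" unfolding G_def
    by (intro bilinear_diff bP bilinear_comp[OF sc])
  note cl = bilinearD(3)[OF bP(1)] bilinearD(3)[OF bP(2)] bilinearD(3)[OF bP(3)]
    bilinearD(3)[OF bH] bilinearD(3)[OF bG] linear_mapD(3)[OF sc]
  note inv = current_poissonD(3)[OF F]
  have invP: "\<lbrakk>pt z \<one>\<^bsub>A\<^esub>, P x y\<rbrakk>\<^bsub>C\<^esub> = P \<lbrakk>z, x\<rbrakk>\<^bsub>L\<^esub> y \<oplus>\<^bsub>T\<^esub> P x \<lbrakk>z, y\<rbrakk>\<^bsub>L\<^esub>"
    and invP': "\<lbrakk>pt z \<one>\<^bsub>A\<^esub>, P' x y\<rbrakk>\<^bsub>C\<^esub> = P' \<lbrakk>z, x\<rbrakk>\<^bsub>L\<^esub> y \<oplus>\<^bsub>T\<^esub> P' x \<lbrakk>z, y\<rbrakk>\<^bsub>L\<^esub>"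
    and invc: "\<lbrakk>pt z c, P x y\<rbrakk>\<^bsub>C\<^esub> = P'' \<lbrakk>z, x\<rbrakk>\<^bsub>L\<^esub> y \<oplus>\<^bsub>T\<^esub> P' x \<lbrakk>z, y\<rbrakk>\<^bsub>L\<^esub>"
    if "x \<in> carrier L" "y \<in> carrier L" "z \<in> carrier L" for x y z
    using that a b c cb unfolding P_def P'_def P''_def by (simp_all add: inv)
  \<comment> \<open>The Poisson identity for \<open>z \<otimes> c\<close> minus \<open>c\<close> times the one for \<open>z \<otimes> 1\<close>: both have the same left
    hand side because the bracket is \<open>A\<close>-linear.\<close>
  have rel: "G \<lbrakk>z, x\<rbrakk>\<^bsub>L\<^esub> y \<oplus>\<^bsub>T\<^esub> H x \<lbrakk>z, y\<rbrakk>\<^bsub>L\<^esub> = \<zero>\<^bsub>T\<^esub>"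
    if xyz: "x \<in> carrier L" "y \<in> carrier L" "z \<in> carrier L" for x y z
  proof -
    have "P'' \<lbrakk>z, x\<rbrakk>\<^bsub>L\<^esub> y \<oplus>\<^bsub>T\<^esub> P' x \<lbrakk>z, y\<rbrakk>\<^bsub>L\<^esub> =
        sc c (P \<lbrakk>z, x\<rbrakk>\<^bsub>L\<^esub> y) \<oplus>\<^bsub>T\<^esub> sc c (P x \<lbrakk>z, y\<rbrakk>\<^bsub>L\<^esub>)" (is "?l = ?r")
      using invc[OF xyz] invP[OF xyz] current_bracket_scale[OF xyz(3) c cl(1)[OF xyz(1,2)]] xyz
      by (simp add: cl br_closed linear_mapD(4)[OF sc])
    moreover have "G \<lbrakk>z, x\<rbrakk>\<^bsub>L\<^esub> y \<oplus>\<^bsub>T\<^esub> H x \<lbrakk>z, y\<rbrakk>\<^bsub>L\<^esub> = ?l \<ominus>\<^bsub>T\<^esub> ?r"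
      using xyz by (simp add: G_def H_def cl br_closed a_minus_def T.M.minus_add T.M.a_ac)
    ultimately show ?thesis using xyz by (simp add: cl br_closed a_minus_def T.M.r_neg)
  qed
  have invH: "\<lbrakk>pt z \<one>\<^bsub>A\<^esub>, H x y\<rbrakk>\<^bsub>C\<^esub> = H \<lbrakk>z, x\<rbrakk>\<^bsub>L\<^esub> y \<oplus>\<^bsub>T\<^esub> H x \<lbrakk>z, y\<rbrakk>\<^bsub>L\<^esub>"
    if xyz: "x \<in> carrier L" "y \<in> carrier L" "z \<in> carrier L" for x y z
  proof -
    note ad = current_bracket_linear(1)[OF pt_closed[OF xyz(3) A.one_closed]]
    have "\<lbrakk>pt z \<one>\<^bsub>A\<^esub>, H x y\<rbrakk>\<^bsub>C\<^esub> = \<lbrakk>pt z \<one>\<^bsub>A\<^esub>, P' x y\<rbrakk>\<^bsub>C\<^esub> \<ominus>\<^bsub>T\<^esub> sc c \<lbrakk>pt z \<one>\<^bsub>A\<^esub>, P x y\<rbrakk>\<^bsub>C\<^esub>"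
      unfolding H_def using xyz
      by (simp add: linear_mapD(7)[OF ad] cl current_bracket_one_scale[OF _ c])
    also have "\<dots> = H \<lbrakk>z, x\<rbrakk>\<^bsub>L\<^esub> y \<oplus>\<^bsub>T\<^esub> H x \<lbrakk>z, y\<rbrakk>\<^bsub>L\<^esub>"
      unfolding invP[OF xyz] invP'[OF xyz] H_def using xyz
      by (simp add: cl br_closed linear_mapD(4)[OF sc] a_minus_def T.M.minus_add T.M.a_ac)
    finally show ?thesis .
  qed
  have HG: "H x \<lbrakk>z, y\<rbrakk>\<^bsub>L\<^esub> = \<ominus>\<^bsub>T\<^esub> G \<lbrakk>z, x\<rbrakk>\<^bsub>L\<^esub> y"
    if xyz: "x \<in> carrier L" "y \<in> carrier L" "z \<in> carrier L" for x y z
    using rel[OF xyz] xyz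
    by (metis T.M.minus_equality T.M.a_comm cl(4,5) br_closed)
  \<comment> \<open>Two applications of \<open>HG\<close>, joined by the antisymmetry of the bracket inside \<open>H\<close> and inside \<open>G\<close>.\<close>
  have skewH: "H x \<lbrakk>y, z\<rbrakk>\<^bsub>L\<^esub> = H y \<lbrakk>z, x\<rbrakk>\<^bsub>L\<^esub>"
    if xyz: "x \<in> carrier L" "y \<in> carrier L" "z \<in> carrier L" for x y z
  proof -
    have neg: "g (\<ominus>\<^bsub>L\<^esub> v) = \<ominus>\<^bsub>T\<^esub> g v" if g: "linear_map K L T g" and v: "v \<in> carrier L" for g v
    proof -
      interpret g: linear_map K L T g by (rule g)
      show ?thesis using v by (rule g.f_neg)
    qed
    have "H y \<lbrakk>z, x\<rbrakk>\<^bsub>L\<^esub> = \<ominus>\<^bsub>T\<^esub> H y \<lbrakk>x, z\<rbrakk>\<^bsub>L\<^esub>"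
      using bracket_anticomm[OF lie xyz(1,3)] neg[OF bilinearD(1)[OF bH]] xyz br_closed by simp
    also have "\<dots> = G \<lbrakk>x, y\<rbrakk>\<^bsub>L\<^esub> z"
      using HG[OF xyz(2,3,1)] xyz by (simp add: cl br_closed)
    also have "\<dots> = \<ominus>\<^bsub>T\<^esub> G \<lbrakk>y, x\<rbrakk>\<^bsub>L\<^esub> z"
      using bracket_anticomm[OF lie xyz(2,1)] neg[OF bilinearD(2)[OF bG]] xyz br_closed by simp
    also have "\<dots> = H x \<lbrakk>y, z\<rbrakk>\<^bsub>L\<^esub>" using HG[OF xyz(1,3,2)] by simp
    finally show ?thesis by simp
  qed
  have H0: "H x y = \<zero>\<^bsub>T\<^esub>" if "x \<in> carrier L" "y \<in> carrier L" for x y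
    by (rule invariant_right_skew_zero[OF bH invH skewH no_right_skew that])
  have "G x y = \<zero>\<^bsub>T\<^esub>"
  proof (rule linear_map_zero_on_span[OF bilinearD(2)[OF bG y] _ _ _ x])
    show "{\<lbrakk>x, y\<rbrakk>\<^bsub>L\<^esub> |x y. x \<in> carrier L \<and> y \<in> carrier L} \<subseteq> carrier L" using br_closed by auto
    show "module.span K L {\<lbrakk>x, y\<rbrakk>\<^bsub>L\<^esub> |x y. x \<in> carrier L \<and> y \<in> carrier L} = carrier L"
      using perf by (simp add: perfect_def)
    show "G v y = \<zero>\<^bsub>T\<^esub>" if v: "v \<in> {\<lbrakk>x, y\<rbrakk>\<^bsub>L\<^esub> |x y. x \<in> carrier L \<and> y \<in> carrier L}" for v
    proof -
      obtain z x where v: "v = \<lbrakk>z, x\<rbrakk>\<^bsub>L\<^esub>" "z \<in> carrier L" "x \<in> carrier L" using v by blast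
      then show ?thesis using rel[OF v(3) y v(2)] H0 y by (simp add: cl br_closed)
    qed
  qed
  then show "F (pt x (c \<otimes>\<^bsub>A\<^esub> a)) (pt y b) = sc c (F (pt x a) (pt y b))"
    using x y cl unfolding G_def P_def P''_def by simp
  show "F (pt x a) (pt y (c \<otimes>\<^bsub>A\<^esub> b)) = sc c (F (pt x a) (pt y b))"
    using H0[OF x y] x y cl unfolding H_def P_def P'_def by simp
qed

section \<open>Components\<close>

text \<open>By rigidity, a Poisson structure on \<open>L \<otimes> A\<close> is known from its restriction to \<open>L \<otimes> 1\<close>; this is
  the coordinate of that restriction at the basis element \<open>b\<close>.\<close>
definition component_poisson where
  "component_poisson b F = (\<lambda>x\<in>carrier L. \<lambda>y\<in>carrier L. \<kappa> b (F (pt x \<one>\<^bsub>A\<^esub>) (pt y \<one>\<^bsub>A\<^esub>)))"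

lemma at_one_bilinear:
  assumes "F \<in> poisson_structures K C"
  shows "bilinear K L L T (\<lambda>x y. F (pt x \<one>\<^bsub>A\<^esub>) (pt y \<one>\<^bsub>A\<^esub>))"
  by (intro bilinear_pull[OF current_poissonD(1)[OF assms]] pure_linear(2)[OF vsL vs_A] A.one_closed)

lemma component_poisson_closed:
  assumes b: "b \<in> B" and F: "F \<in> poisson_structures K C"
  shows "component_poisson b F \<in> poisson_structures K L"
  unfolding component_poisson_def
  by (rule tensor_coord_poisson[OF at_one_bilinear[OF F] b])
     (simp add: current_poissonD(3)[OF F])

lemma component_poisson_linear:
  assumes b: "b \<in> B"
  shows "linear_map K (poisson_space K C) (poisson_space K L) (component_poisson b)"
proof (rule linear_mapI[OF poisson_space_vs[OF lieC] poisson_space_vs[OF lie]])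
  note simps = poisson_space_simps component_poisson_def simpsC pt_closed
    linear_mapD(4,5)[OF \<kappa>_linear[OF b]] current_poissonD(2)
  note closed = component_poisson_closed[OF b]
  show "component_poisson b F \<in> carrier (poisson_space K L)" if "F \<in> carrier (poisson_space K C)" for F
    using that closed by (simp add: poisson_space_simps(1))
  show "component_poisson b (F \<oplus>\<^bsub>poisson_space K C\<^esub> G) =
      component_poisson b F \<oplus>\<^bsub>poisson_space K L\<^esub> component_poisson b G"
    if "F \<in> carrier (poisson_space K C)" "G \<in> carrier (poisson_space K C)" for F G
  proof (rule poisson_eqI[OF lie])
    have FG: "F \<in> poisson_structures K C" "G \<in> poisson_structures K C"
      using that by (simp_all add: poisson_space_simps(1))
    show "component_poisson b (F \<oplus>\<^bsub>poisson_space K C\<^esub> G) \<in> poisson_structures K L"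
      by (intro closed poisson_add[OF lieC] FG)
    show "component_poisson b F \<oplus>\<^bsub>poisson_space K L\<^esub> component_poisson b G \<in> poisson_structures K L"
      by (intro closed poisson_add[OF lie] FG)
    show "component_poisson b (F \<oplus>\<^bsub>poisson_space K C\<^esub> G) x y =
      (component_poisson b F \<oplus>\<^bsub>poisson_space K L\<^esub> component_poisson b G) x y"
      if "x \<in> carrier L" "y \<in> carrier L" for x y
      using that FG by (simp add: simps)
  qed
  show "component_poisson b (c \<odot>\<^bsub>poisson_space K C\<^esub> F) = c \<odot>\<^bsub>poisson_space K L\<^esub> component_poisson b F"
    if c: "c \<in> carrier K" and "F \<in> carrier (poisson_space K C)" for c F
  proof (rule poisson_eqI[OF lie])
    have F: "F \<in> poisson_structures K C"
      using that by (simp_all add: poisson_space_simps(1))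
    show "component_poisson b (c \<odot>\<^bsub>poisson_space K C\<^esub> F) \<in> poisson_structures K L"
      by (intro closed poisson_smult[OF lieC] F c)
    show "c \<odot>\<^bsub>poisson_space K L\<^esub> component_poisson b F \<in> poisson_structures K L"
      by (intro closed poisson_smult[OF lie] F c)
    show "component_poisson b (c \<odot>\<^bsub>poisson_space K C\<^esub> F) x y =
      (c \<odot>\<^bsub>poisson_space K L\<^esub> component_poisson b F) x y"
      if "x \<in> carrier L" "y \<in> carrier L" for x y
      using that F c by (simp add: simps)
  qed
qed

text \<open>A linear map \<open>\<Omega>\<close> that makes \<open>F\<close> trivial is restricted to \<open>L \<otimes> 1\<close> and followed by the coordinate
  map; this works because \<open>L \<otimes> 1\<close> is closed under the bracket.\<close>
lemma component_poisson_trivial: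
  assumes b: "b \<in> B" and F: "F \<in> trivial_poisson K C"
  shows "component_poisson b F \<in> trivial_poisson K L"
proof -
  obtain \<Omega> where "linear_map K C C \<Omega>"
    and F\<Omega>: "\<forall>s\<in>carrier C. \<forall>t\<in>carrier C. F s t = \<Omega> \<lbrakk>s, t\<rbrakk>\<^bsub>C\<^esub>"
    using F by (auto simp: trivial_poisson_def)
  then have \<Omega>: "linear_map K T T \<Omega>" by (simp add: current_linear_iff)
  have Fp: "F \<in> poisson_structures K C" using F by (simp add: trivial_poisson_def)
  show ?thesis
  proof (rule trivial_poissonI[OF lie component_poisson_closed[OF b Fp]])
    show "linear_map K L L (\<lambda>x. \<kappa> b (\<Omega> (pt x \<one>\<^bsub>A\<^esub>)))"
      by (intro linear_map_comp[OF \<kappa>_linear[OF b]] linear_map_comp[OF \<Omega>] pure_linear(2)[OF vsL vs_A]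
          A.one_closed)
    show "component_poisson b F x y = \<kappa> b (\<Omega> (pt \<lbrakk>x, y\<rbrakk>\<^bsub>L\<^esub> \<one>\<^bsub>A\<^esub>))"
      if "x \<in> carrier L" "y \<in> carrier L" for x y
      using that F\<Omega> by (simp add: component_poisson_def simpsC pt_closed current_bracket_pure)
  qed
qed

lemma component_poisson_extend:
  assumes b: "b \<in> B" and f: "f \<in> poisson_structures K L" and u: "u \<in> carrier A"
  shows "component_poisson b (ext f u) = \<xi> b u \<odot>\<^bsub>poisson_space K L\<^esub> f"
proof (rule poisson_eqI[OF lie component_poisson_closed[OF b extend_poisson_closed[OF f u]]
      poisson_smult[OF lie f coord_closed[OF b u]]])
  fix x y assume "x \<in> carrier L" "y \<in> carrier L"
  then show "component_poisson b (ext f u) x y = (\<xi> b u \<odot>\<^bsub>poisson_space K L\<^esub> f) x y"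
    using u by (simp add: component_poisson_def extend_poisson_pure[OF f] poisson_space_simps
        tensor_coord_pure[OF vsL b] poissonD(3)[OF lie f])
qed

text \<open>If \<open>L\<close> is spanned by a finite set \<open>E\<close>, then a component vanishes as soon as it vanishes on
  \<open>E \<times> E\<close>, and each of these finitely many values has finite support.\<close>
lemma component_poisson_finite:
  assumes fin: "vectorspace.fin_dim K L \<or> finite B" and F: "F \<in> poisson_structures K C"
  shows "finite {b \<in> B. component_poisson b F \<noteq> \<zero>\<^bsub>poisson_space K L\<^esub>}"
  using fin
proof
  assume "vectorspace.fin_dim K L"
  then obtain E where E: "finite E" "E \<subseteq> carrier L" "module.span K L E = carrier L"
    by (auto simp: L.fin_dim_def)
  let ?P = "\<lambda>x y. F (pt x \<one>\<^bsub>A\<^esub>) (pt y \<one>\<^bsub>A\<^esub>)"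
  note P = at_one_bilinear[OF F]
  let ?X = "\<Union>x\<in>E. \<Union>y\<in>E. {b \<in> B. \<kappa> b (?P x y) \<noteq> \<zero>\<^bsub>L\<^esub>}"
  have "finite ?X"
    using E(1,2) by (intro finite_UN_I tensor_coord_finite[OF vsL] bilinearD(3)[OF P]) auto
  moreover have "component_poisson b F = \<zero>\<^bsub>poisson_space K L\<^esub>" if b: "b \<in> B" "b \<notin> ?X" for b
  proof (rule poisson_eqI[OF lie component_poisson_closed[OF b(1) F] poisson_zero[OF lie]])
    fix x y assume x: "x \<in> carrier L" and y: "y \<in> carrier L"
    note bP = bilinear_comp[OF \<kappa>_linear[OF b(1)] P]
    have "\<kappa> b (?P x e) = \<zero>\<^bsub>L\<^esub>" if e: "e \<in> E" for e
      by (rule linear_map_zero_on_span[OF bilinearD(2)[OF bP] E(2,3) _ x]) (use e E(2) b in auto)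
    then have "\<kappa> b (?P x y) = \<zero>\<^bsub>L\<^esub>"
      by (intro linear_map_zero_on_span[OF bilinearD(1)[OF bP x] E(2,3) _ y])
    then show "component_poisson b F x y = \<zero>\<^bsub>poisson_space K L\<^esub> x y"
      using x y by (simp add: component_poisson_def poisson_space_simps)
  qed
  ultimately show ?thesis by (rule_tac finite_subset[of _ ?X]) auto
qed simp

text \<open>Rigidity in the form in which it is used: the components determine the structure.\<close>
lemma current_poisson_zeroI:
  assumes perf: "perfect K L"
    and no_right_skew: "\<And>f. f \<in> poisson_structures K L \<Longrightarrow> right_skew L f \<Longrightarrow> f = \<zero>\<^bsub>poisson_space K L\<^esub>"
    and F: "F \<in> poisson_structures K C"
    and zero: "\<And>b. b \<in> B \<Longrightarrow> component_poisson b F = \<zero>\<^bsub>poisson_space K L\<^esub>"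
  shows "F = \<zero>\<^bsub>poisson_space K C\<^esub>"
proof (rule current_poisson_eqI[OF F poisson_zero[OF lieC]])
  fix x y a b assume xy: "x \<in> carrier L" "y \<in> carrier L" and ab: "a \<in> carrier A" "b \<in> carrier A"
  note scale = current_poisson_scale[OF perf no_right_skew F xy]
  have "F (pt x \<one>\<^bsub>A\<^esub>) (pt y \<one>\<^bsub>A\<^esub>) = \<zero>\<^bsub>T\<^esub>"
  proof (rule tensor_eq_zeroI[OF vsL bilinearD(3)[OF at_one_bilinear[OF F] xy]])
    fix b assume "b \<in> B"
    then have "component_poisson b F x y = \<zero>\<^bsub>poisson_space K L\<^esub> x y" by (simp add: zero)
    then show "\<kappa> b (F (pt x \<one>\<^bsub>A\<^esub>) (pt y \<one>\<^bsub>A\<^esub>)) = \<zero>\<^bsub>L\<^esub>"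
      using xy by (simp add: component_poisson_def poisson_space_simps)
  qed
  then have "F (pt x (a \<otimes>\<^bsub>A\<^esub> \<one>\<^bsub>A\<^esub>)) (pt y (b \<otimes>\<^bsub>A\<^esub> \<one>\<^bsub>A\<^esub>)) = \<zero>\<^bsub>T\<^esub>"
    using ab by (simp only: scale A.one_closed A.m_closed
        linear_mapD(6)[OF scale_tensor_linear])
  then show "F (pt x a) (pt y b) = \<zero>\<^bsub>poisson_space K C\<^esub> (pt x a) (pt y b)"
    using xy ab by (simp add: poisson_space_simps simpsC pt_closed)
qed

text \<open>Subtracting \<open>f(x,y) \<otimes> abc\<close>, where \<open>f\<close> is the component of \<open>F\<close> at a basis element \<open>c\<close>, removes
  this component and changes no other. So every structure is reached from zero by adding finitely
  many extensions.\<close>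
lemma current_poisson_induct:
  assumes perf: "perfect K L"
    and no_right_skew: "\<And>f. f \<in> poisson_structures K L \<Longrightarrow> right_skew L f \<Longrightarrow> f = \<zero>\<^bsub>poisson_space K L\<^esub>"
    and fin: "vectorspace.fin_dim K L \<or> finite B"
    and zero: "Q \<zero>\<^bsub>poisson_space K C\<^esub>"
    and step: "\<And>F f u. \<lbrakk>F \<in> poisson_structures K C; Q F; f \<in> poisson_structures K L; u \<in> carrier A\<rbrakk> \<Longrightarrow>
      Q (F \<oplus>\<^bsub>poisson_space K C\<^esub> ext f u)"
    and F: "F \<in> poisson_structures K C"
  shows "Q F"
  using F
proof (induction "card {b \<in> B. component_poisson b F \<noteq> \<zero>\<^bsub>poisson_space K L\<^esub>}" arbitrary: F)
  case 0
  then have "{b \<in> B. component_poisson b F \<noteq> \<zero>\<^bsub>poisson_space K L\<^esub>} = {}"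
    using component_poisson_finite[OF fin] by simp
  then have "F = \<zero>\<^bsub>poisson_space K C\<^esub>"
    using 0 by (intro current_poisson_zeroI[OF perf no_right_skew]) auto
  then show ?case using zero by simp
next
  case (Suc n)
  let ?supp = "\<lambda>F. {b \<in> B. component_poisson b F \<noteq> \<zero>\<^bsub>poisson_space K L\<^esub>}"
  interpret PC: vectorspace K "poisson_space K C" by (rule poisson_space_vs[OF lieC])
  interpret PL: vectorspace K "poisson_space K L" by (rule poisson_space_vs[OF lie])
  have "?supp F \<noteq> {}" using Suc(2) by (metis card.empty nat.distinct(1))
  then obtain c where c: "c \<in> B" "component_poisson c F \<noteq> \<zero>\<^bsub>poisson_space K L\<^esub>" by auto
  let ?E = "ext (component_poisson c F) c"
  let ?G = "F \<ominus>\<^bsub>poisson_space K C\<^esub> ?E"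
  have cA: "c \<in> carrier A" using c(1) basis_closed by auto
  have comp: "component_poisson b F \<in> carrier (poisson_space K L)" if "b \<in> B" for b
    using component_poisson_closed[OF that Suc(3)] by (simp add: poisson_space_simps(1))
  have E: "?E \<in> carrier (poisson_space K C)"
    using extend_poisson_closed[OF component_poisson_closed[OF c(1) Suc(3)] cA]
    by (simp add: poisson_space_simps(1))
  have F: "F \<in> carrier (poisson_space K C)" using Suc(3) by (simp add: poisson_space_simps(1))
  have G: "?G \<in> poisson_structures K C"
    using PC.M.minus_closed[OF F E] by (simp add: poisson_space_simps(1))
  have compG: "component_poisson b ?G =
      (if b = c then \<zero>\<^bsub>poisson_space K L\<^esub> else component_poisson b F)" if b: "b \<in> B" for b
  proof -
    have "component_poisson b ?G = component_poisson b F \<ominus>\<^bsub>poisson_space K L\<^esub>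
        \<xi> b c \<odot>\<^bsub>poisson_space K L\<^esub> component_poisson c F"
      using linear_mapD(7)[OF component_poisson_linear[OF b] F E]
        component_poisson_extend[OF b component_poisson_closed[OF c(1) Suc(3)] cA] by simp
    then show ?thesis
      using comp[OF b] comp[OF c(1)] coord_basis[OF b c(1)]
      by (simp add: a_minus_def PL.M.r_neg split: if_splits)
  qed
  have "?supp F = insert c (?supp ?G)" "c \<notin> ?supp ?G" using c compG by (auto split: if_splits)
  then have "card (?supp ?G) = n"
    using Suc(2) component_poisson_finite[OF fin G] by simp
  then have "Q (?G \<oplus>\<^bsub>poisson_space K C\<^esub> ?E)"
    using Suc(1)[of ?G] G step component_poisson_closed[OF c(1) Suc(3)] cA by blast
  moreover have "?G \<oplus>\<^bsub>poisson_space K C\<^esub> ?E = F"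
    using F E by (simp add: a_minus_def PC.M.a_assoc PC.M.l_neg)
  ultimately show ?case by simp
qed

section \<open>The quotient by the trivial structures\<close>

text \<open>The map \<open>\<Theta>\<close> sends the tensor of the class of \<open>f\<close> with \<open>u\<close> to the class of the extension. Taking
  the component at \<open>b\<close> of the image gives back the coordinate at \<open>b\<close> of the argument, whence
  injectivity.\<close>
lemma current_poisson_quotient_iso:
  assumes perf: "perfect K L"
    and no_right_skew: "\<And>f. f \<in> poisson_structures K L \<Longrightarrow> right_skew L f \<Longrightarrow> f = \<zero>\<^bsub>poisson_space K L\<^esub>"
    and fin: "vectorspace.fin_dim K L \<or> finite B"
  shows "\<exists>\<Theta>. linear_iso K (tensor K (\<P> K L) A) (\<P> K C) \<Theta>"
proof -
  let ?Q = "tensor K (\<P> K L) A" and ?pt = "pure_tensor K (\<P> K L) A"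
  let ?cl = "poisson_class K L" and ?cC = "poisson_class K C"
  note vsQ = poisson_quotient_vs[OF lie] and vsQC = poisson_quotient_vs[OF lieC]
  note qc = poisson_quotient_carrier[OF lie]
  interpret QC: vectorspace K "\<P> K C" by (rule vsQC)
  interpret QT: vectorspace K ?Q by (rule tensor_vs[OF vsQ vs_A])
  note extb = extend_poisson_bilinear
  have "\<exists>g. linear_map K (\<P> K L) (\<P> K C) g \<and> (\<forall>f\<in>poisson_structures K L. g (?cl f) = ?cC (ext f u))"
    if u: "u \<in> carrier A" for u
    using extend_poisson_trivial[OF _ u] poisson_class_trivial[OF lieC]
    by (intro poisson_quotient_lift_ex[OF lie linear_map_comp[OF poisson_class_linear[OF lieC] bilinearD(2)[OF extb u]]])
       simp
  then obtain g where g: "\<And>u. u \<in> carrier A \<Longrightarrow> linear_map K (\<P> K L) (\<P> K C) (g u)"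
    and gcl: "\<And>u f. u \<in> carrier A \<Longrightarrow> f \<in> poisson_structures K L \<Longrightarrow> g u (?cl f) = ?cC (ext f u)"
    by metis
  have "bilinear K (\<P> K L) A (\<P> K C) (\<lambda>X u. g u X)"
  proof (rule bilinearI)
    fix X assume "X \<in> carrier (\<P> K L)"
    then obtain f where f: "f \<in> poisson_structures K L" "X = ?cl f" by (auto simp: qc)
    have "linear_map K A (\<P> K C) (\<lambda>u. ?cC (ext f u))"
      by (rule linear_map_comp[OF poisson_class_linear[OF lieC] bilinearD(1)[OF extb]])
         (simp add: poisson_space_simps(1) f)
    then show "linear_map K A (\<P> K C) (\<lambda>u. g u X)"
      by (rule linear_map_cong) (simp add: f gcl)
  qed (rule g)
  from tensor_lift_ex[OF vsQ vs_A vsQC this] obtain \<Theta> where \<Theta>: "linear_map K ?Q (\<P> K C) \<Theta>"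
    and \<Theta>p: "\<And>f u. f \<in> poisson_structures K L \<Longrightarrow> u \<in> carrier A \<Longrightarrow> \<Theta> (?pt (?cl f) u) = ?cC (ext f u)"
    using gcl by (auto simp: qc)
  have "inj_on \<Theta> (carrier ?Q)"
  proof (rule linear_map_inj_onI[OF \<Theta>])
    fix t assume t: "t \<in> carrier ?Q" and t0: "\<Theta> t = \<zero>\<^bsub>\<P> K C\<^esub>"
    show "t = \<zero>\<^bsub>?Q\<^esub>"
    proof (rule tensor_eq_zeroI[OF vsQ t])
      fix b assume b: "b \<in> B"
      obtain r where r: "linear_map K (\<P> K C) (\<P> K L) r"
        and rc: "\<forall>F\<in>poisson_structures K C. r (?cC F) = ?cl (component_poisson b F)"
        using poisson_quotient_lift_ex[OF lieC linear_map_comp[OF poisson_class_linear[OF lie] component_poisson_linear[OF b]]]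
          poisson_class_trivial[OF lie component_poisson_trivial[OF b]] by blast
      have "r (\<Theta> t) = tensor_coord (\<P> K L) b t"
      proof (rule tensor_linear_eq[OF vsQ vs_A linear_map_comp[OF r \<Theta>] tensor_coord_linear[OF vsQ b] _ t])
        fix X u assume X: "X \<in> carrier (\<P> K L)" and u: "u \<in> carrier A"
        then obtain f where f: "f \<in> poisson_structures K L" "X = ?cl f" by (auto simp: qc)
        have "r (\<Theta> (?pt X u)) = ?cl (\<xi> b u \<odot>\<^bsub>poisson_space K L\<^esub> f)"
          using f u rc extend_poisson_closed[OF f(1) u]
          by (simp add: \<Theta>p component_poisson_extend[OF b])
        also have "\<dots> = \<xi> b u \<odot>\<^bsub>\<P> K L\<^esub> X"
          using f linear_mapD(5)[OF poisson_class_linear[OF lie] coord_closed[OF b u]]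
          by (simp add: poisson_space_simps(1))
        finally show "r (\<Theta> (?pt X u)) = tensor_coord (\<P> K L) b (?pt X u)"
          using X u by (simp add: tensor_coord_pure[OF vsQ b])
      qed
      then show "tensor_coord (\<P> K L) b t = \<zero>\<^bsub>\<P> K L\<^esub>"
        using t0 linear_mapD(6)[OF r] by simp
    qed
  qed
  moreover have "\<Theta> ` carrier ?Q = carrier (\<P> K C)"
  proof
    show "\<Theta> ` carrier ?Q \<subseteq> carrier (\<P> K C)" using linear_mapD(3)[OF \<Theta>] by auto
    have "?cC F \<in> \<Theta> ` carrier ?Q" if "F \<in> poisson_structures K C" for F
    proof (rule current_poisson_induct[OF perf no_right_skew fin _ _ that])
      show "?cC \<zero>\<^bsub>poisson_space K C\<^esub> \<in> \<Theta> ` carrier ?Q"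
        using linear_mapD(6)[OF poisson_class_linear[OF lieC]] linear_mapD(6)[OF \<Theta>]
        by (metis QT.M.zero_closed imageI)
      fix F f u
      assume F: "F \<in> poisson_structures K C" "?cC F \<in> \<Theta> ` carrier ?Q"
        and f: "f \<in> poisson_structures K L" and u: "u \<in> carrier A"
      then obtain t where t: "t \<in> carrier ?Q" "?cC F = \<Theta> t" by auto
      have p: "?pt (?cl f) u \<in> carrier ?Q"
        using f u by (intro pure_closed[OF vsQ vs_A]) (auto simp: qc)
      have "?cC (F \<oplus>\<^bsub>poisson_space K C\<^esub> ext f u) = \<Theta> (t \<oplus>\<^bsub>?Q\<^esub> ?pt (?cl f) u)"
        using F f u t p extend_poisson_closed[OF f u]
        by (simp add: linear_mapD(4)[OF \<Theta>] linear_mapD(4)[OF poisson_class_linear[OF lieC]] \<Theta>p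
            poisson_space_simps(1))
      then show "?cC (F \<oplus>\<^bsub>poisson_space K C\<^esub> ext f u) \<in> \<Theta> ` carrier ?Q" using t p by simp
    qed
    then show "carrier (\<P> K C) \<subseteq> \<Theta> ` carrier ?Q" by (auto simp: poisson_quotient_carrier[OF lieC])
  qed
  ultimately show ?thesis using \<Theta> by (auto simp: linear_iso_def bij_betw_def)
qed

lemma current_basic_poisson_structures:
  assumes perf: "perfect K L"
    and no_right_skew: "\<And>f. f \<in> poisson_structures K L \<Longrightarrow> right_skew L f \<Longrightarrow> f = \<zero>\<^bsub>poisson_space K L\<^esub>"
    and fin: "vectorspace.fin_dim K L \<or> finite B"
  shows "\<exists>S. basic_poisson_structures K C S \<and>
    S \<subseteq> {ext f u | f u. f \<in> poisson_structures K L \<and> u \<in> carrier A}"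
proof -
  let ?E = "{ext f u | f u. f \<in> poisson_structures K L \<and> u \<in> carrier A}"
  let ?cC = "poisson_class K C"
  note cl = poisson_class_linear[OF lieC]
  interpret QC: vectorspace K "\<P> K C" by (rule poisson_quotient_vs[OF lieC])
  have EC: "?E \<subseteq> poisson_structures K C" using extend_poisson_closed by auto
  then have GC: "?cC ` ?E \<subseteq> carrier (\<P> K C)" by (auto simp: poisson_quotient_carrier[OF lieC])
  note own = QC.in_own_span[OF GC] and sp = sub_props[OF QC.span_is_subspace[OF GC]]
  have "?cC F \<in> QC.span (?cC ` ?E)" if "F \<in> poisson_structures K C" for F
  proof (rule current_poisson_induct[OF perf no_right_skew fin _ _ that])
    show "?cC \<zero>\<^bsub>poisson_space K C\<^esub> \<in> QC.span (?cC ` ?E)"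
      using sp(2) linear_mapD(6)[OF cl] by simp
    fix F f u
    assume F: "F \<in> poisson_structures K C" "?cC F \<in> QC.span (?cC ` ?E)"
      and fu: "f \<in> poisson_structures K L" "u \<in> carrier A"
    have "?cC (ext f u) \<in> QC.span (?cC ` ?E)" using own fu by blast
    then show "?cC (F \<oplus>\<^bsub>poisson_space K C\<^esub> ext f u) \<in> QC.span (?cC ` ?E)"
      using sp(3)[OF F(2)] F(1) extend_poisson_closed[OF fu]
      by (simp add: linear_mapD(4)[OF cl] poisson_space_simps(1))
  qed
  then have "QC.span (?cC ` ?E) = carrier (\<P> K C)"
    using sp(1) by (auto simp: poisson_quotient_carrier[OF lieC])
  then obtain D where D: "D \<subseteq> ?cC ` ?E" "QC.basis D"
    using QC.generating_set_contains_basis[OF GC] by blast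
  from D(1) obtain S where S: "S \<subseteq> ?E" "inj_on ?cC S" "?cC ` S = D"
    unfolding subset_image_inj by blast
  then have "basic_poisson_structures K C S"
    using D(2) EC by (auto simp: basic_poisson_structures_def)
  then show ?thesis using S(1) by blast
qed

end

end

theorem theorem2:
  fixes K :: "('k, 'e) ring_scheme"
    and L :: "('k, 'l, 'm) lie_alg_scheme"
    and A :: "('k, 'a, 'n) module_scheme"
  assumes "field K"
    and "characteristic K \<noteq> 2"
    and "characteristic K \<noteq> 3"
    and "lie_algebra K L"
    and "perfect K L"
    and "\<And>f. f \<in> poisson_structures K L \<Longrightarrow> left_skew L f \<Longrightarrow> f = \<zero>\<^bsub>poisson_space K L\<^esub>"
    and "\<And>f. f \<in> poisson_structures K L \<Longrightarrow> right_skew L f \<Longrightarrow> f = \<zero>\<^bsub>poisson_space K L\<^esub>"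
    and "algebra K A"
    and "vectorspace.fin_dim K L \<or> vectorspace.fin_dim K A"
  shows "(\<exists>\<phi>. linear_iso K (\<P> K (current K L A)) (tensor K (\<P> K L) A) \<phi>) \<and>
    (\<exists>S. basic_poisson_structures K (current K L A) S \<and>
      (\<forall>F\<in>S. \<exists>f\<in>poisson_structures K L. \<exists>u\<in>carrier A.
        \<forall>x\<in>carrier L. \<forall>y\<in>carrier L. \<forall>a\<in>carrier A. \<forall>b\<in>carrier A.
          F (pure_tensor K L A x a) (pure_tensor K L A y b)
            = pure_tensor K L A (f x y) (a \<otimes>\<^bsub>A\<^esub> b \<otimes>\<^bsub>A\<^esub> u)))"
proof -
  note lie = assms(4) and alg = assms(8)
  obtain B \<xi> where coord: "coordinates K A B \<xi>" and "vectorspace.fin_dim K A \<longrightarrow> finite B"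
    using coordinates_ex[OF algebra_vs[OF assms(1) alg]] by blast
  then have fin: "vectorspace.fin_dim K L \<or> finite B" using assms(9) by blast
  obtain \<Theta> where "linear_iso K (tensor K (\<P> K L) A) (\<P> K (current K L A)) \<Theta>"
    using current_poisson_quotient_iso[OF lie alg coord assms(5,7) fin] by blast
  then have "\<exists>\<phi>. linear_iso K (\<P> K (current K L A)) (tensor K (\<P> K L) A) \<phi>"
    using linear_iso_inv by blast
  moreover obtain S where S: "basic_poisson_structures K (current K L A) S"
    "S \<subseteq> {extend_poisson K L A f u | f u. f \<in> poisson_structures K L \<and> u \<in> carrier A}"
    using current_basic_poisson_structures[OF lie alg coord assms(5,7) fin] by blast
  moreover have "\<exists>f\<in>poisson_structures K L. \<exists>u\<in>carrier A.
      \<forall>x\<in>carrier L. \<forall>y\<in>carrier L. \<forall>a\<in>carrier A. \<forall>b\<in>carrier A.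
        F (pure_tensor K L A x a) (pure_tensor K L A y b)
          = pure_tensor K L A (f x y) (a \<otimes>\<^bsub>A\<^esub> b \<otimes>\<^bsub>A\<^esub> u)" if "F \<in> S" for F
  proof -
    obtain f u where "F = extend_poisson K L A f u" "f \<in> poisson_structures K L" "u \<in> carrier A"
      using S(2) \<open>F \<in> S\<close> by blast
    then show ?thesis
      by (intro bexI[of _ f] bexI[of _ u]) (simp_all add: extend_poisson_pure[OF lie alg])
  qed
  ultimately show ?thesis by blast
qed

end
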